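(* Let $A$ be a graded commutative associative algebra with a linear map $\partial:A\to A$ of degree $-1$, $\partial^2=0$ (not necessarily a derivation). Let $(C,\partial_C)$ be a subcomplex with inclusion $i:C\to A$, and suppose there is a chain map $I:(A,\partial)\to(C,\partial_C)$ with $I\circ i=\mathrm{Id}_C$ and a degree $+1$ map $s:A\to A$ with $\partial s+s\partial=i\circ I-\mathrm{Id}_A$. Let $d$ be the canonical coderivation extension of $\partial$ to $SA$, $d_C$ that of $\partial_C$ to $SC$, $\tilde I:SA\to SC$ the canonical coalgebra extension of $I$ ($\tilde I(x_1\wedge\cdots\wedge x_n)=I(x_1)\wedge\cdots\wedge I(x_n)$), and $\tilde d=\tilde\tau^{-1}\circ d\circ\tilde\tau$. Suppose $\partial_\infty$ is a coderivation on $SC$ and $\iota:(SC,\partial_\infty)\to(SA,\tilde d)$ is a coalgebra morphism with $\iota\circ\partial_\infty=\tilde d\circ\iota$ and $\iota(c)=i(c)$ for all $c\in C=\wedge^1C$. Then $\tilde\tau_C:=\tilde I\circ\tilde\tau\circ\iota:SC\to SC$ is an isomorphism of differential graded coalgebras $(SC,\partial_\infty)\to(SC,d_C)$, i.e. a bijective coalgebra morphism with $\tilde\tau_C\circ\partial_\infty=d_C\circ\tilde\tau_C$; it is the unique map making the square $\tilde I\circ\tilde\tau\circ\iota=\tilde\tau_C$ commute.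
   Context: For a graded vector space $V$, $SV=\bigoplus_{n\ge1}\wedge^nV$ (graded symmetric powers) with coproduct $\Delta(x_1\wedge\cdots\wedge x_n)=\sum\epsilon\,x_{\pi_1}\wedge x_{\pi_2}$, summed over decompositions of the index set into two nonempty subsets $\pi_1\sqcup\pi_2$, with Koszul sign $\epsilon$ from moving the $\pi_1$-elements to the left. The canonical coderivation extension of a linear map $\partial:V\to V$ is $x_1\wedge\cdots\wedge x_n\mapsto\sum_i\pm x_1\wedge\cdots\wedge\partial(x_i)\wedge\cdots\wedge x_n$ (Koszul signs). For the algebra $A$, $\tau:SA\to A$ is $\tau(x_1\wedge\cdots\wedge x_n)=x_1\cdots x_n$ and the cumulant bijection is $\tilde\tau(v)=\sum_{k\ge1}\tau^{\wedge k}\circ\Delta^{k-1}(v)$, a coalgebra automorphism of $SA$ with $\pi\circ\tilde\tau=\tau$ ($\pi$ the projection onto $A$).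
   Formalization: The ground field has characteristic 0 (bijectivity can fail in characteristic p), and the cumulant bijection is taken as the sum of (1/k!) τ^{∧k}∘Δ^{k-1}, since without 1/k! it would not be a coalgebra morphism; the definitional uniqueness clause is not stated separately. *)

theory Defs
  imports Main "HOL-Library.Poly_Mapping" "HOL-Library.Multiset"
begin

text \<open>A graded vector space over the field 'k is represented by a homogeneous basis,
  indexed by a (linearly ordered) type 'a, together with a degree function
  deg :: 'a => int.  Vectors are finitely supported coefficient functions 'a =>0 'k.
  (Every graded vector space has a homogeneous basis.)\<close>

definition smul :: "'k::comm_ring_1 \<Rightarrow> ('a \<Rightarrow>\<^sub>0 'k) \<Rightarrow> ('a \<Rightarrow>\<^sub>0 'k)" where
  "smul c v = Poly_Mapping.map (\<lambda>x. c * x) v"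

definition bvec :: "'a \<Rightarrow> ('a \<Rightarrow>\<^sub>0 'k::comm_ring_1)" where
  "bvec b = Poly_Mapping.single b 1"

definition ksgn :: "int \<Rightarrow> 'k::comm_ring_1" where
  "ksgn n = (if even n then 1 else -1)"

definition linear_map :: "(('a \<Rightarrow>\<^sub>0 'k::comm_ring_1) \<Rightarrow> ('b \<Rightarrow>\<^sub>0 'k)) \<Rightarrow> bool" where
  "linear_map f \<longleftrightarrow> (\<forall>x y. f (x + y) = f x + f y) \<and> (\<forall>c x. f (smul c x) = smul c (f x))"

definition homog :: "('a \<Rightarrow> int) \<Rightarrow> int \<Rightarrow> ('a \<Rightarrow>\<^sub>0 'k::zero) \<Rightarrow> bool" where
  "homog deg n v \<longleftrightarrow> (\<forall>b\<in>Poly_Mapping.keys v. deg b = n)"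

definition map_deg :: "('a \<Rightarrow> int) \<Rightarrow> ('b \<Rightarrow> int) \<Rightarrow> int
    \<Rightarrow> (('a \<Rightarrow>\<^sub>0 'k::zero) \<Rightarrow> ('b \<Rightarrow>\<^sub>0 'k)) \<Rightarrow> bool" where
  "map_deg degA degB p f \<longleftrightarrow> (\<forall>n v. homog degA n v \<longrightarrow> homog degB (n + p) (f v))"

definition gc_algebra :: "('a \<Rightarrow> int)
    \<Rightarrow> (('a \<Rightarrow>\<^sub>0 'k::comm_ring_1) \<Rightarrow> ('a \<Rightarrow>\<^sub>0 'k) \<Rightarrow> ('a \<Rightarrow>\<^sub>0 'k)) \<Rightarrow> bool" where
  "gc_algebra deg m \<longleftrightarrow>
     (\<forall>x. linear_map (m x)) \<and> (\<forall>y. linear_map (\<lambda>x. m x y)) \<and>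
     (\<forall>x y z. m (m x y) z = m x (m y z)) \<and>
     (\<forall>n k x y. homog deg n x \<longrightarrow> homog deg k y \<longrightarrow> homog deg (n + k) (m x y)) \<and>
     (\<forall>n k x y. homog deg n x \<longrightarrow> homog deg k y \<longrightarrow> m x y = smul (ksgn (n * k)) (m y x))"

text \<open>Basis of SV: nonempty multisets M of basis indices in which odd-degree indices
  occur at most once; M stands for e_{w_1} wedge ... wedge e_{w_n}, w the sorted list of M.
  Elements of SV are finitely supported functions on such multisets.\<close>

definition valid_mon :: "('a \<Rightarrow> int) \<Rightarrow> 'a multiset \<Rightarrow> bool" where
  "valid_mon deg M \<longleftrightarrow> M \<noteq> {#} \<and> (\<forall>b. odd (deg b) \<longrightarrow> count M b \<le> 1)"

definition SV :: "('a \<Rightarrow> int) \<Rightarrow> ('a multiset \<Rightarrow>\<^sub>0 'k::zero) set" where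
  "SV deg = {v. \<forall>M\<in>Poly_Mapping.keys v. valid_mon deg M}"

definition tdeg :: "('a \<Rightarrow> int) \<Rightarrow> 'a multiset \<Rightarrow> int" where
  "tdeg deg M = sum_mset (image_mset deg M)"

definition shomog :: "('a \<Rightarrow> int) \<Rightarrow> int \<Rightarrow> ('a multiset \<Rightarrow>\<^sub>0 'k::zero) \<Rightarrow> bool" where
  "shomog deg n v \<longleftrightarrow> (\<forall>M\<in>Poly_Mapping.keys v. tdeg deg M = n)"

text \<open>Koszul sign of rearranging x_0,...,x_{n-1} (x_i of degree deg (w!i)) into the order
  x_{ps!0}, x_{ps!1}, ... (ps a permutation of [0..<n]).\<close>
definition perm_sign :: "('a \<Rightarrow> int) \<Rightarrow> 'a list \<Rightarrow> nat list \<Rightarrow> 'k::comm_ring_1" where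
  "perm_sign deg w ps = ksgn (\<Sum>(p, q)\<in>{(p, q). p < q \<and> q < length ps \<and> ps ! q < ps ! p}.
        deg (w ! (ps ! p)) * deg (w ! (ps ! q)))"

text \<open>e_{w_1} wedge ... wedge e_{w_n} expressed in the normal-form basis: sorting sign,
  and 0 if an odd-degree index is repeated.\<close>
definition mono :: "('a::linorder \<Rightarrow> int) \<Rightarrow> 'a list \<Rightarrow> ('a multiset \<Rightarrow>\<^sub>0 'k::comm_ring_1)" where
  "mono deg w =
     (if \<exists>i j. i < j \<and> j < length w \<and> w ! i = w ! j \<and> odd (deg (w ! i)) then 0
      else smul (ksgn (int (card {(i, j). i < j \<and> j < length w \<and> w ! j < w ! i
                                   \<and> odd (deg (w ! i)) \<and> odd (deg (w ! j))})))
                (Poly_Mapping.single (mset w) 1))"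

definition wedge :: "('a::linorder \<Rightarrow> int) \<Rightarrow> ('a \<Rightarrow>\<^sub>0 'k::comm_ring_1) list
    \<Rightarrow> ('a multiset \<Rightarrow>\<^sub>0 'k)" where
  "wedge deg xs = (\<Sum>w\<in>{w. length w = length xs \<and> (\<forall>i<length xs. w ! i \<in> Poly_Mapping.keys (xs ! i))}.
       smul (\<Prod>i<length xs. Poly_Mapping.lookup (xs ! i) (w ! i)) (mono deg w))"

definition ext :: "('a multiset \<Rightarrow> ('b \<Rightarrow>\<^sub>0 'k::comm_ring_1)) \<Rightarrow> ('a multiset \<Rightarrow>\<^sub>0 'k) \<Rightarrow> ('b \<Rightarrow>\<^sub>0 'k)" where
  "ext F v = (\<Sum>M\<in>Poly_Mapping.keys v. smul (Poly_Mapping.lookup v M) (F M))"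

definition tens :: "('a \<Rightarrow>\<^sub>0 'k::comm_ring_1) \<Rightarrow> ('b \<Rightarrow>\<^sub>0 'k) \<Rightarrow> ('a \<times> 'b \<Rightarrow>\<^sub>0 'k)" where
  "tens x y = (\<Sum>M\<in>Poly_Mapping.keys x. \<Sum>N\<in>Poly_Mapping.keys y. Poly_Mapping.single (M, N) (Poly_Mapping.lookup x M * Poly_Mapping.lookup y N))"

text \<open>F (x) G with Koszul sign: (F (x) G)(x (x) y) = (-1)^(|G| |x|) F x (x) G y, where p = |G|.\<close>
definition tensmap :: "('a \<Rightarrow> int) \<Rightarrow> int
    \<Rightarrow> (('a multiset \<Rightarrow>\<^sub>0 'k::comm_ring_1) \<Rightarrow> ('c \<Rightarrow>\<^sub>0 'k))
    \<Rightarrow> (('a multiset \<Rightarrow>\<^sub>0 'k) \<Rightarrow> ('d \<Rightarrow>\<^sub>0 'k))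
    \<Rightarrow> ('a multiset \<times> 'a multiset \<Rightarrow>\<^sub>0 'k) \<Rightarrow> ('c \<times> 'd \<Rightarrow>\<^sub>0 'k)" where
  "tensmap deg p F G x = (\<Sum>(M, N)\<in>Poly_Mapping.keys x.
      smul (Poly_Mapping.lookup x (M, N) * ksgn (p * tdeg deg M))
           (tens (F (Poly_Mapping.single M 1)) (G (Poly_Mapping.single N 1))))"

definition coprod :: "('a::linorder \<Rightarrow> int) \<Rightarrow> ('a multiset \<Rightarrow>\<^sub>0 'k::comm_ring_1)
    \<Rightarrow> ('a multiset \<times> 'a multiset \<Rightarrow>\<^sub>0 'k)" where
  "coprod deg = ext (\<lambda>M. let w = sorted_list_of_multiset M; n = length w in
     (\<Sum>S\<in>{S. S \<subseteq> {..<n} \<and> S \<noteq> {} \<and> S \<noteq> {..<n}}.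
        smul (perm_sign deg w (sorted_list_of_set S @ sorted_list_of_set ({..<n} - S)))
             (tens (mono deg (nths w S)) (mono deg (nths w ({..<n} - S))))))"

definition coder_ext :: "('a::linorder \<Rightarrow> int) \<Rightarrow> (('a \<Rightarrow>\<^sub>0 'k::comm_ring_1) \<Rightarrow> ('a \<Rightarrow>\<^sub>0 'k))
    \<Rightarrow> ('a multiset \<Rightarrow>\<^sub>0 'k) \<Rightarrow> ('a multiset \<Rightarrow>\<^sub>0 'k)" where
  "coder_ext deg f = ext (\<lambda>M. let w = sorted_list_of_multiset M in
     (\<Sum>i<length w. smul (ksgn (sum_list (map deg (take i w))))
          (wedge deg ((map bvec w)[i := f (bvec (w ! i))]))))"

definition coalg_ext :: "('b::linorder \<Rightarrow> int) \<Rightarrow> (('a::linorder \<Rightarrow>\<^sub>0 'k::comm_ring_1) \<Rightarrow> ('b \<Rightarrow>\<^sub>0 'k))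
    \<Rightarrow> ('a multiset \<Rightarrow>\<^sub>0 'k) \<Rightarrow> ('b multiset \<Rightarrow>\<^sub>0 'k)" where
  "coalg_ext degB g = ext (\<lambda>M. wedge degB (map (\<lambda>b. g (bvec b)) (sorted_list_of_multiset M)))"

definition coalg_morph :: "('a::linorder \<Rightarrow> int) \<Rightarrow> ('b::linorder \<Rightarrow> int)
    \<Rightarrow> (('a multiset \<Rightarrow>\<^sub>0 'k::comm_ring_1) \<Rightarrow> ('b multiset \<Rightarrow>\<^sub>0 'k)) \<Rightarrow> bool" where
  "coalg_morph degA degB F \<longleftrightarrow>
     (\<forall>v\<in>SV degA. F v \<in> SV degB) \<and>
     (\<forall>x\<in>SV degA. \<forall>y\<in>SV degA. F (x + y) = F x + F y) \<and>
     (\<forall>c. \<forall>x\<in>SV degA. F (smul c x) = smul c (F x)) \<and>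
     (\<forall>n. \<forall>v\<in>SV degA. shomog degA n v \<longrightarrow> shomog degB n (F v)) \<and>
     (\<forall>v\<in>SV degA. coprod degB (F v) = tensmap degA 0 F F (coprod degA v))"

definition coderivation :: "('a::linorder \<Rightarrow> int)
    \<Rightarrow> (('a multiset \<Rightarrow>\<^sub>0 'k::comm_ring_1) \<Rightarrow> ('a multiset \<Rightarrow>\<^sub>0 'k)) \<Rightarrow> bool" where
  "coderivation deg D \<longleftrightarrow>
     (\<forall>v\<in>SV deg. D v \<in> SV deg) \<and>
     (\<forall>x\<in>SV deg. \<forall>y\<in>SV deg. D (x + y) = D x + D y) \<and>
     (\<forall>c. \<forall>x\<in>SV deg. D (smul c x) = smul c (D x)) \<and>
     (\<forall>n. \<forall>v\<in>SV deg. shomog deg n v \<longrightarrow> shomog deg (n - 1) (D v)) \<and>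
     (\<forall>v\<in>SV deg. coprod deg (D v) =
         tensmap deg 0 D (\<lambda>x. x) (coprod deg v) + tensmap deg (-1) (\<lambda>x. x) D (coprod deg v))"

fun listprod :: "('v \<Rightarrow> 'v \<Rightarrow> 'v) \<Rightarrow> 'v list \<Rightarrow> 'v" where
  "listprod m [] = undefined"
| "listprod m [x] = x"
| "listprod m (x # y # xs) = m x (listprod m (y # xs))"

definition tau :: "('a::linorder \<Rightarrow> int) \<Rightarrow> (('a \<Rightarrow>\<^sub>0 'k::comm_ring_1) \<Rightarrow> ('a \<Rightarrow>\<^sub>0 'k) \<Rightarrow> ('a \<Rightarrow>\<^sub>0 'k))
    \<Rightarrow> ('a multiset \<Rightarrow>\<^sub>0 'k) \<Rightarrow> ('a multiset \<Rightarrow>\<^sub>0 'k)" where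
  "tau deg m = ext (\<lambda>M. wedge deg [listprod m (map bvec (sorted_list_of_multiset M))])"

definition odec :: "nat \<Rightarrow> nat \<Rightarrow> nat set list set" where
  "odec n k = {Bs. length Bs = k \<and> (\<forall>B\<in>set Bs. B \<noteq> {}) \<and>
      (\<forall>i<k. \<forall>j<k. i \<noteq> j \<longrightarrow> Bs ! i \<inter> Bs ! j = {}) \<and> \<Union>(set Bs) = {..<n}}"

definition tau_tilde :: "('a::linorder \<Rightarrow> int) \<Rightarrow> (('a \<Rightarrow>\<^sub>0 'k::field_char_0) \<Rightarrow> ('a \<Rightarrow>\<^sub>0 'k) \<Rightarrow> ('a \<Rightarrow>\<^sub>0 'k))
    \<Rightarrow> ('a multiset \<Rightarrow>\<^sub>0 'k) \<Rightarrow> ('a multiset \<Rightarrow>\<^sub>0 'k)" where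
  "tau_tilde deg m = ext (\<lambda>M. let w = sorted_list_of_multiset M; n = length w in
     (\<Sum>k\<in>{1..n}. smul (inverse (fact k))
        (\<Sum>Bs\<in>odec n k. smul (perm_sign deg w (concat (map sorted_list_of_set Bs)))
            (wedge deg (map (\<lambda>B. listprod m (map bvec (nths w B))) Bs)))))"

definition d_tilde :: "('a::linorder \<Rightarrow> int) \<Rightarrow> (('a \<Rightarrow>\<^sub>0 'k::field_char_0) \<Rightarrow> ('a \<Rightarrow>\<^sub>0 'k) \<Rightarrow> ('a \<Rightarrow>\<^sub>0 'k))
    \<Rightarrow> (('a \<Rightarrow>\<^sub>0 'k) \<Rightarrow> ('a \<Rightarrow>\<^sub>0 'k)) \<Rightarrow> ('a multiset \<Rightarrow>\<^sub>0 'k) \<Rightarrow> ('a multiset \<Rightarrow>\<^sub>0 'k)" where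
  "d_tilde deg m f v = inv_into (SV deg) (tau_tilde deg m) (coder_ext deg f (tau_tilde deg m v))"

end

theory Submission
  imports Defs
begin

text \<open>
  The full symmetric algebra (with unit \<open>{#}\<close>) is the free graded commutative algebra, so a family
  of operators \<open>P\<^sub>a\<close>, indexed by basis elements and commuting in the graded sense, determines a unique
  linear map \<open>\<Phi>\<close> with \<open>\<Phi> 1 = 1\<close> and \<open>\<Phi> (a \<and> v) = P\<^sub>a (\<Phi> v)\<close>. If moreover
  \<open>\<Delta> P\<^sub>a = (P\<^sub>a \<otimes> 1 + 1 \<otimes> P\<^sub>a) \<Delta>\<close>, then \<open>\<Phi>\<close> is a coalgebra morphism. For the coalgebra extension of
  a linear map \<open>g\<close> one takes \<open>P\<^sub>a = g a \<and> _\<close>. For the cumulant bijection one takes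
  \<open>P\<^sub>a = (a \<and> _) + D\<^sub>a\<close>, where \<open>D\<^sub>a\<close> is the derivation extending multiplication by \<open>a\<close>: in a partition
  of \<open>{a} \<union> S\<close> the element \<open>a\<close> either is a block of its own or is joined to a block of a partition
  of \<open>S\<close>. The chain map property is checked on monomials.

  A coalgebra endomorphism that is the identity on \<open>\<and>\<^sup>1\<close> differs from the identity by a map that lowers
  the filtration by word length, hence is bijective. This applies both to the cumulant bijection and,
  since \<open>I \<circ> i = Id\<close>, to the transferred map.
\<close>

subsection \<open>Linear maps\<close>

text \<open>The reduced coproduct of \<open>a \<and> v\<close> is not just an operator applied to
  the coproduct of \<open>v\<close>: there are also the two terms in which \<open>a\<close> stands
  alone in one factor. With the unit adjoined, letters become primitive and these terms are
  absorbed, so coproduct identities turn into inductions over words. At the end the unit is removed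
  again by subtracting \<open>v \<otimes> 1\<close> and \<open>1 \<otimes> v\<close>.

  Signs are kept local: each one comes from exchanging two neighbouring letters or from carrying one
  letter to the front, and for sorting a word only the existence of a common factor is used.

  Characteristic zero enters three times: a vector equal to its negative is zero, factorials are
  inverted, and \<open>2 ^ n - 2\<close> is nonzero for \<open>n \<ge> 2\<close>.

  The differential \<open>d_tilde\<close> contains the inverse of the cumulant bijection, but no
  formula for this inverse is needed. Bijectivity alone shows that \<open>tau_tilde\<close> carries
  \<open>d_tilde\<close> to the extension of \<open>dA\<close>, and what remains is compatibility of
  the extension of \<open>I\<close> with the two differentials.\<close>

lemma lookup_smul [simp]: "Poly_Mapping.lookup (smul c v) x = c * Poly_Mapping.lookup v x"
  by (auto simp: smul_def Poly_Mapping.map.rep_eq when_def)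

lemma keys_smul: "Poly_Mapping.keys (smul c v) \<subseteq> Poly_Mapping.keys v"
  by (auto simp: in_keys_iff)

lemma smul_simps [simp]:
  "smul c 0 = 0" "smul 0 v = 0" "smul 1 v = v" "smul c (smul d v) = smul (c * d) v"
  by (auto intro!: poly_mapping_eqI simp: mult.assoc)

lemma smul_add: "smul c (u + v) = smul c u + smul c v"
  and smul_diff: "smul c (u - v) = smul c u - smul c v"
  and smul_add_left: "smul (c + d) v = smul c v + smul d v"
  and smul_minus_left: "smul (- c) v = - smul c v"
  by (auto intro!: poly_mapping_eqI simp: algebra_simps lookup_add lookup_minus)

lemma smul_single: "smul c (Poly_Mapping.single x d) = Poly_Mapping.single x (c * d)"
  by (auto intro!: poly_mapping_eqI simp: lookup_single when_def)

lemma smul_sum: "smul c (sum f A) = (\<Sum>x\<in>A. smul c (f x))"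
  by (induction A rule: infinite_finite_induct) (auto simp: smul_add)

lemma sum_smul_left: "smul (sum f A) v = (\<Sum>x\<in>A. smul (f x) v)"
  by (induction A rule: infinite_finite_induct) (auto simp: smul_add_left)

lemma linear_mapI:
  "(\<And>x y. f (x + y) = f x + f y) \<Longrightarrow> (\<And>c x. f (smul c x) = smul c (f x)) \<Longrightarrow> linear_map f"
  by (auto simp: linear_map_def)

lemma linear_map_add: "linear_map f \<Longrightarrow> f (x + y) = f x + f y"
  and linear_map_smul: "linear_map f \<Longrightarrow> f (smul c x) = smul c (f x)"
  by (auto simp: linear_map_def)

lemma linear_map_0: "linear_map f \<Longrightarrow> f 0 = 0"
  using linear_map_smul[of f 0 0] by simp

lemma linear_map_diff: "linear_map f \<Longrightarrow> f (x - y) = f x - f y"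
  using linear_map_add[of f "x - y" y] by (simp add: algebra_simps)

lemma linear_map_sum: "linear_map f \<Longrightarrow> f (sum g A) = (\<Sum>x\<in>A. f (g x))"
  by (induction A rule: infinite_finite_induct) (auto simp: linear_map_0 linear_map_add)

lemma linear_map_id [intro!]: "linear_map (\<lambda>x. x)"
  and linear_map_zero [intro!]: "linear_map (\<lambda>x. 0)"
  by (auto simp: linear_map_def)

lemma linear_map_plus [intro!]:
  "linear_map f \<Longrightarrow> linear_map g \<Longrightarrow> linear_map (\<lambda>x. f x + g x)"
  by (auto simp: linear_map_def smul_add)

lemma linear_map_minus [intro!]:
  "linear_map f \<Longrightarrow> linear_map g \<Longrightarrow> linear_map (\<lambda>x. f x - g x)"
  by (auto simp: linear_map_diff linear_map_smul linear_map_add smul_diff intro!: linear_mapI)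

lemma linear_map_scaled [intro!]: "linear_map f \<Longrightarrow> linear_map (\<lambda>x. smul c (f x))"
  by (auto simp: linear_map_def smul_add mult.commute)

lemma linear_map_comp: "linear_map f \<Longrightarrow> linear_map g \<Longrightarrow> linear_map (\<lambda>x. f (g x))"
  by (auto simp: linear_map_def)

text \<open>The formula of \<open>ext\<close> for an arbitrary basis type, since letters and pairs
  of multisets also occur as indices. \<open>ext\<close>, \<open>tens\<close> and
  \<open>tensmap\<close> are all reduced to it.\<close>

definition lin :: "('a \<Rightarrow> ('b \<Rightarrow>\<^sub>0 'k::comm_ring_1)) \<Rightarrow> ('a \<Rightarrow>\<^sub>0 'k) \<Rightarrow> ('b \<Rightarrow>\<^sub>0 'k)" where
  "lin F v = (\<Sum>x\<in>Poly_Mapping.keys v. smul (Poly_Mapping.lookup v x) (F x))"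

lemma lin_superset:
  assumes "finite A" "Poly_Mapping.keys v \<subseteq> A"
  shows "lin F v = (\<Sum>x\<in>A. smul (Poly_Mapping.lookup v x) (F x))"
  unfolding lin_def using assms by (intro sum.mono_neutral_left) (auto simp: in_keys_iff)

lemma linear_map_lin [intro!]: "linear_map (lin F)"
proof (rule linear_mapI)
  fix x y :: "'a \<Rightarrow>\<^sub>0 'b"
  let ?A = "Poly_Mapping.keys x \<union> Poly_Mapping.keys y"
  have "Poly_Mapping.keys (x + y) \<subseteq> ?A" by (rule Poly_Mapping.keys_add)
  then show "lin F (x + y) = lin F x + lin F y"
    by (simp add: lin_superset[of ?A] lookup_add smul_add_left sum.distrib)
next
  fix c and x :: "'a \<Rightarrow>\<^sub>0 'b"
  show "lin F (smul c x) = smul c (lin F x)"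
    using keys_smul[of c x] by (simp add: lin_superset[of "Poly_Mapping.keys x"] smul_sum)
qed

lemma lin_single [simp]: "lin F (Poly_Mapping.single x c) = smul c (F x)"
  by (simp add: lin_def)

lemma lin_bvec [simp]: "lin F (bvec x) = F x"
  by (simp add: bvec_def)

lemma lin_add: "lin (\<lambda>x. F x + G x) v = lin F v + lin G v"
  by (simp add: lin_def smul_add sum.distrib)

lemma lin_smul: "lin (\<lambda>x. smul c (F x)) v = smul c (lin F v)"
  by (simp add: lin_def smul_sum mult.commute)

lemma lin_zero [simp]: "lin (\<lambda>x. 0) v = 0"
  by (simp add: lin_def)

lemma lin_cong: "(\<And>x. x \<in> Poly_Mapping.keys v \<Longrightarrow> F x = G x) \<Longrightarrow> lin F v = lin G v"
  by (simp add: lin_def)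

lemma lin_bvec_self: "lin bvec v = v"
proof (rule poly_mapping_eqI)
  fix x
  have "Poly_Mapping.lookup (lin bvec v) x
      = (\<Sum>y\<in>Poly_Mapping.keys v. Poly_Mapping.lookup v y * (1 when y = x))"
    by (simp add: lin_def bvec_def lookup_sum lookup_single)
  also have "\<dots> = (\<Sum>y\<in>Poly_Mapping.keys v. if y = x then Poly_Mapping.lookup v y else 0)"
    by (intro sum.cong) (auto simp: when_def)
  finally show "Poly_Mapping.lookup (lin bvec v) x = Poly_Mapping.lookup v x"
    by (auto simp: in_keys_iff)
qed

lemma linear_map_lin_bvec: "linear_map f \<Longrightarrow> f v = lin (\<lambda>x. f (bvec x)) v"
  by (subst lin_bvec_self[symmetric]) (simp add: lin_def linear_map_sum linear_map_smul)

lemma linear_map_lin_comp: "linear_map f \<Longrightarrow> f (lin F v) = lin (\<lambda>x. f (F x)) v"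
  by (simp add: lin_def linear_map_sum linear_map_smul)

text \<open>For maps whose argument enters through the values on the basis, such as the second
  vector argument of \<open>tens\<close> or \<open>lmult\<close>.\<close>

lemma linear_map_lin_param: "(\<And>x. linear_map (F x)) \<Longrightarrow> linear_map (\<lambda>u. lin (\<lambda>x. F x u) v)"
  by (rule linear_mapI) (auto simp: linear_map_add linear_map_smul lin_add lin_smul)

lemma linear_eqI:
  assumes "linear_map f" "linear_map g" "\<And>x. x \<in> Poly_Mapping.keys v \<Longrightarrow> f (bvec x) = g (bvec x)"
  shows "f v = g v"
proof -
  have "f v = lin (\<lambda>x. f (bvec x)) v" using assms(1) by (rule linear_map_lin_bvec)
  also have "\<dots> = lin (\<lambda>x. g (bvec x)) v" using assms(3) by (rule lin_cong)
  also have "\<dots> = g v" using assms(2) by (rule linear_map_lin_bvec[symmetric])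
  finally show ?thesis .
qed

lemma keys_lin: "Poly_Mapping.keys (lin F v) \<subseteq> (\<Union>x\<in>Poly_Mapping.keys v. Poly_Mapping.keys (F x))"
proof -
  have "Poly_Mapping.keys (lin F v) \<subseteq>
      (\<Union>x\<in>Poly_Mapping.keys v. Poly_Mapping.keys (smul (Poly_Mapping.lookup v x) (F x)))"
    unfolding lin_def by (rule Poly_Mapping.keys_sum)
  also have "\<dots> \<subseteq> (\<Union>x\<in>Poly_Mapping.keys v. Poly_Mapping.keys (F x))"
    using keys_smul by fastforce
  finally show ?thesis .
qed

lemma keys_bvec: "Poly_Mapping.keys (bvec x :: _ \<Rightarrow>\<^sub>0 'k::comm_ring_1) = {x}"
  by (simp add: bvec_def)

text \<open>The bound \<open>v\<close> in the conclusion lets \<open>f\<close> and \<open>g\<close>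
  be read off an equation as abstractions over it; \<open>mono_linear_eqI\<close> has this form for
  the same reason.\<close>

lemma linear_ext:
  assumes "linear_map f" "linear_map g" "\<And>x. f (bvec x) = g (bvec x)"
  shows "\<forall>v. f v = g v"
  using linear_eqI[OF assms(1,2)] assms(3) by blast

lemma ext_eq_lin: "ext F = lin F"
  by (rule ext) (simp add: ext_def lin_def)

lemma tens_eq_lin: "tens x y = lin (\<lambda>M. lin (\<lambda>N. bvec (M, N)) y) x"
  by (simp add: tens_def lin_def smul_sum smul_single bvec_def)

lemma tensmap_eq_lin:
  "tensmap deg p F G =
    lin (\<lambda>(M, N). smul (ksgn (p * tdeg deg M)) (tens (F (bvec M)) (G (bvec N))))"
  by (rule ext) (simp add: tensmap_def lin_def bvec_def split_beta)

lemma linear_map_tensmap [intro!]: "linear_map (tensmap deg p F G)"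
  by (auto simp: tensmap_eq_lin)

lemma tens_bvec [simp]: "tens (bvec M) (bvec N) = bvec (M, N)"
  by (simp add: tens_eq_lin)

lemma linear_map_tens_left: "linear_map (\<lambda>x. tens x y)"
  unfolding tens_eq_lin by auto

lemma linear_map_tens_right: "linear_map (tens x)"
  unfolding tens_eq_lin by (auto intro!: linear_map_lin_param)

lemmas tens_linear_simps =
  linear_map_add[OF linear_map_tens_left] linear_map_add[OF linear_map_tens_right]
  linear_map_smul[OF linear_map_tens_left] linear_map_smul[OF linear_map_tens_right]
  linear_map_diff[OF linear_map_tens_left] linear_map_diff[OF linear_map_tens_right]
  linear_map_0[OF linear_map_tens_left] linear_map_0[OF linear_map_tens_right]

subsection \<open>Koszul signs\<close>

lemma ksgn_add: "ksgn (a + b) = ksgn a * ksgn b"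
  by (auto simp: ksgn_def)

lemma ksgn_0 [simp]: "ksgn 0 = 1"
  by (auto simp: ksgn_def)

lemma ksgn_square [simp]: "ksgn a * ksgn a = 1" "ksgn a * (ksgn a * b) = b"
  by (auto simp: ksgn_def)

lemma ksgn_diff_even: "even (a - b) \<Longrightarrow> ksgn a = ksgn b"
  by (auto simp: ksgn_def)

subsection \<open>Monomials\<close>

text \<open>A recursive form of the inversion count in \<open>mono\<close>, made for induction over
  words. Pairs with an even member do not count, because exchanging them costs no sign.\<close>

fun odd_inversions :: "('a::linorder \<Rightarrow> int) \<Rightarrow> 'a list \<Rightarrow> nat" where
  "odd_inversions deg [] = 0"
| "odd_inversions deg (a # w) =
     length (filter (\<lambda>b. b < a \<and> odd (deg a) \<and> odd (deg b)) w) + odd_inversions deg w"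

fun odd_repetition :: "('a \<Rightarrow> int) \<Rightarrow> 'a list \<Rightarrow> bool" where
  "odd_repetition deg [] = False"
| "odd_repetition deg (a # w) \<longleftrightarrow> odd (deg a) \<and> a \<in> set w \<or> odd_repetition deg w"

lemma odd_inversions_card:
  "card {(i, j). i < j \<and> j < length w \<and> w ! j < w ! i \<and> odd (deg (w ! i)) \<and> odd (deg (w ! j))}
    = odd_inversions deg w"
proof (induction w)
  case Nil
  then show ?case by simp
next
  case (Cons a w)
  let ?X = "\<lambda>w. {(i, j). i < j \<and> j < length w \<and> w ! j < w ! i \<and> odd (deg (w ! i)) \<and> odd (deg (w ! j))}"
  let ?Y = "{j. j < length w \<and> w ! j < a \<and> odd (deg a) \<and> odd (deg (w ! j))}"
  \<comment> \<open>A pair of positions either starts at the head or is a shifted pair of the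
    tail.\<close>
  have split: "?X (a # w) = (\<lambda>j. (0, Suc j)) ` ?Y \<union> map_prod Suc Suc ` ?X w" (is "?l = ?r")
  proof (rule set_eqI)
    fix ij :: "nat \<times> nat"
    obtain i j where ij: "ij = (i, j)" by (cases ij)
    show "ij \<in> ?l \<longleftrightarrow> ij \<in> ?r"
      unfolding ij by (cases i; cases j) (auto simp: image_iff map_prod_def)
  qed
  have fin: "finite (?X w)"
    by (rule finite_subset[of _ "{..<length w} \<times> {..<length w}"]) auto
  have "card (?X (a # w)) = card ?Y + card (?X w)"
    unfolding split using fin
    by (subst card_Un_disjoint) (auto simp: card_image inj_on_def)
  then show ?case
    by (simp add: Cons.IH length_filter_conv_card)
qed

lemma odd_repetition_iff:
  "(\<exists>i j. i < j \<and> j < length w \<and> w ! i = w ! j \<and> odd (deg (w ! i))) \<longleftrightarrow> odd_repetition deg w"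
proof (induction w)
  case Nil
  then show ?case by simp
next
  case (Cons a w)
  have "(\<exists>i j. i < j \<and> j < length (a # w) \<and> (a # w) ! i = (a # w) ! j \<and> odd (deg ((a # w) ! i)))
    \<longleftrightarrow> (\<exists>j. j < length w \<and> a = w ! j \<and> odd (deg a)) \<or>
        (\<exists>i j. i < j \<and> j < length w \<and> w ! i = w ! j \<and> odd (deg (w ! i)))" (is "?l \<longleftrightarrow> ?r")
  proof
    assume ?l
    then obtain i j where "i < j" "j < length (a # w)" "(a # w) ! i = (a # w) ! j"
      "odd (deg ((a # w) ! i))" by blast
    then show ?r by (cases i; cases j) auto
  next
    assume ?r
    then show ?l
    proof
      assume "\<exists>j. j < length w \<and> a = w ! j \<and> odd (deg a)"
      then obtain j where "j < length w" "a = w ! j" "odd (deg a)" by blast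
      then show ?l by (intro exI[of _ 0] exI[of _ "Suc j"]) auto
    next
      assume "\<exists>i j. i < j \<and> j < length w \<and> w ! i = w ! j \<and> odd (deg (w ! i))"
      then obtain i j where "i < j" "j < length w" "w ! i = w ! j" "odd (deg (w ! i))" by blast
      then show ?l by (intro exI[of _ "Suc i"] exI[of _ "Suc j"]) auto
    qed
  qed
  then show ?case
    by (auto simp: Cons.IH in_set_conv_nth)
qed

lemma mono_eq: "mono deg w = (if odd_repetition deg w then 0 else
    smul (ksgn (int (odd_inversions deg w))) (bvec (mset w)))"
  by (simp add: mono_def odd_inversions_card odd_repetition_iff bvec_def)

lemma mono_Nil: "mono deg [] = bvec {#}"
  by (simp add: mono_eq)

lemma mono_singleton: "mono deg [a] = bvec {#a#}"
  by (simp add: mono_eq)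

text \<open>In characteristic zero these word functions are the linear maps out of the full
  symmetric algebra. A rule for neighbours suffices, since every rearrangement is a chain of such
  exchanges.\<close>

definition graded_sym :: "('a \<Rightarrow> int) \<Rightarrow> ('a list \<Rightarrow> ('b \<Rightarrow>\<^sub>0 'k::comm_ring_1)) \<Rightarrow> bool" where
  "graded_sym deg G \<longleftrightarrow>
    (\<forall>u a b v. G (u @ a # b # v) = smul (ksgn (deg a * deg b)) (G (u @ b # a # v)))"

lemma odd_repetition_swap: "odd_repetition deg (u @ a # b # v) = odd_repetition deg (u @ b # a # v)"
  by (induction u) auto

text \<open>Without odd repetition two odd neighbours are distinct, so their exchange changes the
  count by exactly one; any other exchange leaves it alone. Letters further left see the same
  letters after them.\<close>

lemma odd_inversions_swap:
  assumes "\<not> odd_repetition deg (u @ a # b # v)"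
  shows "even (int (odd_inversions deg (u @ a # b # v)) -
     (deg a * deg b + int (odd_inversions deg (u @ b # a # v))))"
  using assms
proof (induction u)
  case Nil
  then have "odd (deg a) \<Longrightarrow> odd (deg b) \<Longrightarrow> a \<noteq> b" by auto
  then show ?case
    by (cases "odd (deg a)"; cases "odd (deg b)"; cases a b rule: linorder_cases) simp_all
next
  case (Cons c u)
  have "length (filter (\<lambda>b. b < c \<and> odd (deg c) \<and> odd (deg b)) (u @ a # b # v)) =
        length (filter (\<lambda>b. b < c \<and> odd (deg c) \<and> odd (deg b)) (u @ b # a # v))"
    by simp
  then have "int (odd_inversions deg ((c # u) @ a # b # v)) -
     (deg a * deg b + int (odd_inversions deg ((c # u) @ b # a # v)))
     = int (odd_inversions deg (u @ a # b # v)) -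
     (deg a * deg b + int (odd_inversions deg (u @ b # a # v)))"
    unfolding append_Cons odd_inversions.simps by linarith
  then show ?case using Cons by simp
qed

lemma graded_sym_mono:
  "graded_sym deg (mono deg :: 'a::linorder list \<Rightarrow> ('a multiset \<Rightarrow>\<^sub>0 'k::comm_ring_1))"
  unfolding graded_sym_def
proof (intro allI)
  fix u v :: "'a list" and a b
  let ?w = "u @ a # b # v" and ?w' = "u @ b # a # v"
  show "mono deg ?w = smul (ksgn (deg a * deg b)) (mono deg ?w' :: _ \<Rightarrow>\<^sub>0 'k)"
  proof (cases "odd_repetition deg ?w")
    case True
    then show ?thesis using odd_repetition_swap[of deg u a b v] by (simp add: mono_eq)
  next
    case False
    then have "ksgn (int (odd_inversions deg ?w)) =
        (ksgn (deg a * deg b) * ksgn (int (odd_inversions deg ?w')) :: 'k)"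
      using ksgn_diff_even[OF odd_inversions_swap[of deg u a b v]] by (simp add: ksgn_add)
    moreover have "mset ?w = mset ?w'" by simp
    ultimately show ?thesis
      using False odd_repetition_swap[of deg u a b v] by (simp only: mono_eq if_False smul_simps)
  qed
qed

lemma graded_symD:
  "graded_sym deg G \<Longrightarrow> G (u @ a # b # v) = smul (ksgn (deg a * deg b)) (G (u @ b # a # v))"
  unfolding graded_sym_def by blast

lemma graded_sym_shift:
  assumes "graded_sym deg G"
  shows "graded_sym deg (\<lambda>w. G (c # w))"
  unfolding graded_sym_def
proof (intro allI)
  fix u a b v
  show "G (c # u @ a # b # v) = smul (ksgn (deg a * deg b)) (G (c # u @ b # a # v))"
    using graded_symD[OF assms, of "c # u" a b v] unfolding append_Cons .
qed

lemma graded_sym_move: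
  assumes "graded_sym deg G"
  shows "G (u @ a # v) = smul (ksgn (deg a * sum_list (map deg u))) (G (a # u @ v))"
  using assms
proof (induction u arbitrary: G)
  case Nil
  then show ?case by simp
next
  case (Cons b u)
  have "G ((b # u) @ a # v) = smul (ksgn (deg a * sum_list (map deg u))) (G (b # a # u @ v))"
    using Cons.IH[OF graded_sym_shift[OF Cons.prems]] by simp
  also have "G (b # a # u @ v) = smul (ksgn (deg a * deg b)) (G (a # b # u @ v))"
    using graded_symD[OF Cons.prems, of "[]" b a] by (simp add: mult.commute)
  finally show ?case by (simp add: ksgn_add distrib_left mult.commute)
qed

text \<open>Two functions are treated at once because the factor \<open>c\<close> depends on the
  word only. Comparing a function with \<open>mono\<close> in this way avoids computing the sign of
  a sorting permutation.\<close>

lemma graded_sym_insort: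
  assumes "graded_sym deg G" "graded_sym deg H"
  shows "\<exists>c. G (a # w) = smul c (G (insort a w)) \<and> H (a # w) = smul c (H (insort a w))"
  using assms
proof (induction w arbitrary: G H)
  case Nil
  then show ?case by (auto intro!: exI[of _ 1])
next
  case (Cons b w)
  show ?case
  proof (cases "a \<le> b")
    case True
    then show ?thesis by (auto intro!: exI[of _ 1])
  next
    case False
    obtain c where c: "G (b # a # w) = smul c (G (b # insort a w))"
        "H (b # a # w) = smul c (H (b # insort a w))"
      using Cons.IH[OF graded_sym_shift[OF Cons.prems(1), of b] graded_sym_shift[OF Cons.prems(2), of b]]
      by auto
    show ?thesis
      using False c graded_symD[OF Cons.prems(1), of "[]" a b] graded_symD[OF Cons.prems(2), of "[]" a b]
      by (auto intro!: exI[of _ "ksgn (deg a * deg b) * c"])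
  qed
qed

lemma graded_sym_sort:
  assumes "graded_sym deg G" "graded_sym deg H"
  shows "\<exists>c. G w = smul c (G (sort w)) \<and> H w = smul c (H (sort w))"
  using assms
proof (induction w arbitrary: G H)
  case Nil
  then show ?case by (auto intro!: exI[of _ 1])
next
  case (Cons a w)
  obtain c where c: "G (a # w) = smul c (G (a # sort w))" "H (a # w) = smul c (H (a # sort w))"
    using Cons.IH[OF graded_sym_shift[OF Cons.prems(1), of a] graded_sym_shift[OF Cons.prems(2), of a]]
    by auto
  obtain d where "G (a # sort w) = smul d (G (insort a (sort w)))"
      "H (a # sort w) = smul d (H (insort a (sort w)))"
    using graded_sym_insort[OF Cons.prems] by blast
  with c show ?case by (auto intro!: exI[of _ "c * d"])
qed

text \<open>Relies on 2 being nonzero in the field.\<close>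

lemma eq_uminus_zero:
  fixes v :: "'b \<Rightarrow>\<^sub>0 'k::field_char_0"
  assumes "v = - v"
  shows "v = 0"
proof (rule poly_mapping_eqI)
  fix x
  have "Poly_Mapping.lookup v x = - Poly_Mapping.lookup v x"
    using arg_cong[OF assms, of "\<lambda>v. Poly_Mapping.lookup v x"] by simp
  then show "Poly_Mapping.lookup v x = Poly_Mapping.lookup 0 x"
    by (simp add: eq_neg_iff_add_eq_0 flip: mult_2)
qed

text \<open>Moving the second copy up to the first gives two equal odd neighbours, and exchanging
  them shows that the value is its own negative.\<close>

lemma graded_sym_odd_repetition:
  fixes G :: "'a list \<Rightarrow> ('b \<Rightarrow>\<^sub>0 'k::field_char_0)"
  assumes "graded_sym deg G" "odd_repetition deg w"
  shows "G w = 0"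
  using assms
proof (induction w arbitrary: G)
  case Nil
  then show ?case by simp
next
  case (Cons a w)
  show ?case
  proof (cases "odd_repetition deg w")
    case True
    then show ?thesis using Cons.IH[OF graded_sym_shift[OF Cons.prems(1)]] by blast
  next
    case False
    then have a: "a \<in> set w" "odd (deg a)" using Cons.prems by auto
    then obtain u v where w: "w = u @ a # v" by (meson split_list)
    have "G (a # a # u @ v) = - G (a # a # u @ v)"
      using graded_symD[OF Cons.prems(1), of "[]" a a "u @ v"] a
      by (simp add: ksgn_def smul_minus_left)
    then have "G (a # a # u @ v) = 0" by (rule eq_uminus_zero)
    then show ?thesis
      using graded_sym_move[OF graded_sym_shift[OF Cons.prems(1)], of a u a v] by (simp add: w)
  qed
qed

lemma odd_inversions_sorted: "sorted w \<Longrightarrow> odd_inversions deg w = 0"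
  by (induction w) (auto simp: filter_empty_conv)

definition sym_extend :: "('a::linorder list \<Rightarrow> ('b \<Rightarrow>\<^sub>0 'k::comm_ring_1)) \<Rightarrow> ('a multiset \<Rightarrow>\<^sub>0 'k) \<Rightarrow> ('b \<Rightarrow>\<^sub>0 'k)" where
  "sym_extend G = lin (\<lambda>M. G (sorted_list_of_multiset M))"

lemma linear_map_sym_extend [intro!]: "linear_map (sym_extend G)"
  by (auto simp: sym_extend_def)

lemma sym_extend_bvec: "sym_extend G (bvec M) = G (sorted_list_of_multiset M)"
  by (simp add: sym_extend_def)

lemma sorted_list_of_multiset_mset_sort: "sorted_list_of_multiset (mset w) = sort w"
  by (metis mset_sorted_list_of_multiset properties_for_sort sorted_sorted_list_of_multiset)

text \<open>Sorting \<open>w\<close> changes \<open>G w\<close> and \<open>mono deg w\<close> by the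
  same factor, so only sorted words remain. There \<open>mono\<close> is a basis vector, or an odd
  letter is repeated and both sides vanish.\<close>

lemma sym_extend_mono:
  fixes G :: "'a::linorder list \<Rightarrow> ('b \<Rightarrow>\<^sub>0 'k::field_char_0)"
  assumes "graded_sym deg G"
  shows "sym_extend G (mono deg w) = G w"
proof -
  obtain c where c: "G w = smul c (G (sort w))"
      "(mono deg w :: 'a multiset \<Rightarrow>\<^sub>0 'k) = smul c (mono deg (sort w))"
    using graded_sym_sort[OF assms graded_sym_mono] by blast
  have "sym_extend G (mono deg (sort w)) = G (sort w)"
  proof (cases "odd_repetition deg (sort w)")
    case True
    then show ?thesis
      using graded_sym_odd_repetition[OF assms True]
      by (simp add: mono_eq linear_map_0[OF linear_map_sym_extend])
  next
    case False
    then show ?thesis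
      by (simp add: mono_eq odd_inversions_sorted sym_extend_bvec sorted_list_of_multiset_mset_sort)
  qed
  then show ?thesis
    using c by (simp add: linear_map_smul[OF linear_map_sym_extend])
qed

text \<open>Unlike \<open>valid_mon\<close> this admits the empty multiset, the unit of the full
  symmetric algebra.\<close>

definition valid :: "('a \<Rightarrow> int) \<Rightarrow> 'a multiset \<Rightarrow> bool" where
  "valid deg M \<longleftrightarrow> (\<forall>b. odd (deg b) \<longrightarrow> count M b \<le> 1)"

lemma odd_repetition_valid: "odd_repetition deg w \<longleftrightarrow> \<not> valid deg (mset w)"
proof (induction w)
  case Nil
  then show ?case by (simp add: valid_def)
next
  case (Cons a w)
  have "valid deg (mset (a # w)) \<longleftrightarrow> valid deg (mset w) \<and> \<not> (odd (deg a) \<and> a \<in> set w)"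
  proof
    assume v: "valid deg (mset (a # w))"
    have "count (mset w) b \<le> count (mset (a # w)) b" for b by simp
    then have "valid deg (mset w)" using v unfolding valid_def by (meson le_trans)
    moreover have "\<not> (odd (deg a) \<and> a \<in> set w)"
      using v unfolding valid_def by (auto dest!: spec[of _ a] simp: count_mset_0_iff)
    ultimately show "valid deg (mset w) \<and> \<not> (odd (deg a) \<and> a \<in> set w)" by blast
  next
    assume "valid deg (mset w) \<and> \<not> (odd (deg a) \<and> a \<in> set w)"
    then show "valid deg (mset (a # w))" by (auto simp: valid_def count_mset_0_iff)
  qed
  then show ?case using Cons by auto
qed

lemma mono_sorted_list: "valid deg M \<Longrightarrow> mono deg (sorted_list_of_multiset M) = bvec M"
  by (simp add: mono_eq odd_repetition_valid odd_inversions_sorted)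

lemma sym_extend_not_valid:
  fixes G :: "'a::linorder list \<Rightarrow> ('b \<Rightarrow>\<^sub>0 'k::field_char_0)"
  assumes "graded_sym deg G" "\<not> valid deg M"
  shows "sym_extend G (bvec M) = 0"
  using graded_sym_odd_repetition[OF assms(1), of "sorted_list_of_multiset M"] assms(2)
  by (simp add: sym_extend_bvec odd_repetition_valid)

text \<open>The type also contains basis vectors of multisets with a repeated odd letter, which are
  not reached by \<open>mono\<close>. The last premise covers them. The operators below vanish
  there, so their identities hold for all vectors and membership in \<open>SV\<close> need not be
  tracked.\<close>

lemma mono_linear_eqI:
  assumes "linear_map f" "linear_map g" "\<And>w. f (mono deg w) = g (mono deg w)"
    "\<And>M. \<not> valid deg M \<Longrightarrow> f (bvec M) = g (bvec M)"
  shows "\<forall>v. f v = g v"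
proof (rule allI, rule linear_eqI[OF assms(1,2)])
  fix M
  show "f (bvec M) = g (bvec M)"
    using assms(3)[of "sorted_list_of_multiset M"] assms(4)[of M]
    by (cases "valid deg M") (auto simp: mono_sorted_list)
qed

subsection \<open>Degrees\<close>

lemma homog_bvec: "homog deg (deg a) (bvec a)"
  by (auto simp: homog_def bvec_def split: if_splits)

lemma homog_linear_eqI:
  assumes "linear_map f" "linear_map g" "\<And>a. deg a = k \<Longrightarrow> f (bvec a) = g (bvec a)"
  shows "\<forall>x. homog deg k x \<longrightarrow> f x = g x"
proof (intro allI impI, rule linear_eqI[OF assms(1,2)])
  fix x a assume "homog deg k x" "a \<in> Poly_Mapping.keys x"
  then have "deg a = k" by (auto simp: homog_def)
  then show "f (bvec a) = g (bvec a)" by (rule assms(3))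
qed

lemma map_degD: "map_deg degA degB p f \<Longrightarrow> homog degA n x \<Longrightarrow> homog degB (n + p) (f x)"
  by (auto simp: map_deg_def)

lemma shomog_0 [simp]: "shomog deg n 0"
  by (simp add: shomog_def)

lemma shomog_add: "shomog deg n u \<Longrightarrow> shomog deg n v \<Longrightarrow> shomog deg n (u + v)"
  using Poly_Mapping.keys_add[of u v] by (auto simp: shomog_def)

lemma shomog_smul: "shomog deg n u \<Longrightarrow> shomog deg n (smul c u)"
  using keys_smul[of c u] by (auto simp: shomog_def)

lemma shomog_sum: "(\<And>x. x \<in> A \<Longrightarrow> shomog deg n (f x)) \<Longrightarrow> shomog deg n (sum f A)"
  by (induction A rule: infinite_finite_induct) (auto intro: shomog_add)

lemma shomog_lin: "(\<And>x. x \<in> Poly_Mapping.keys v \<Longrightarrow> shomog deg n (F x)) \<Longrightarrow> shomog deg n (lin F v)"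
  by (auto simp: lin_def intro!: shomog_sum shomog_smul)

lemma shomog_bvec: "shomog deg (tdeg deg M) (bvec M)"
  by (auto simp: shomog_def bvec_def split: if_splits)

lemma tdeg_mset: "tdeg deg (mset w) = sum_list (map deg w)"
  by (induction w) (auto simp: tdeg_def)

lemma tdeg_sorted_list: "sum_list (map deg (sorted_list_of_multiset M)) = tdeg deg M"
  using tdeg_mset[of deg "sorted_list_of_multiset M"] by simp

lemma shomog_mono: "shomog deg (sum_list (map deg w)) (mono deg w)"
  using shomog_bvec[of deg "mset w"] by (auto simp: mono_eq tdeg_mset intro!: shomog_smul)

definition smap_deg :: "('a \<Rightarrow> int) \<Rightarrow> ('b \<Rightarrow> int) \<Rightarrow> int
    \<Rightarrow> (('a multiset \<Rightarrow>\<^sub>0 'k::comm_ring_1) \<Rightarrow> ('b multiset \<Rightarrow>\<^sub>0 'k)) \<Rightarrow> bool" where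
  "smap_deg degA degB r F \<longleftrightarrow> (\<forall>M. shomog degB (tdeg degA M + r) (F (bvec M)))"

lemma smap_degD:
  assumes "smap_deg degA degB r F" "linear_map F" "shomog degA n v"
  shows "shomog degB (n + r) (F v)"
proof -
  have "shomog degB (n + r) (lin (\<lambda>x. F (bvec x)) v)"
  proof (rule shomog_lin)
    fix M assume "M \<in> Poly_Mapping.keys v"
    then have "tdeg degA M = n" using assms(3) by (auto simp: shomog_def)
    then show "shomog degB (n + r) (F (bvec M))" using assms(1) by (auto simp: smap_deg_def)
  qed
  then show ?thesis using linear_map_lin_bvec[OF assms(2), of v] by simp
qed

lemma smap_deg_id: "smap_deg deg deg 0 (\<lambda>x. x)"
  by (simp add: smap_deg_def shomog_bvec)

lemma smap_deg_add: "smap_deg degA degB r F \<Longrightarrow> smap_deg degA degB r G \<Longrightarrow> smap_deg degA degB r (\<lambda>x. F x + G x)"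
  by (simp add: smap_deg_def shomog_add)

lemma smap_deg_sym_extend:
  assumes "\<And>w. shomog degB (sum_list (map degA w) + r) (G w)"
  shows "smap_deg degA degB r (sym_extend G)"
  unfolding smap_deg_def sym_extend_bvec
proof
  fix M
  show "shomog degB (tdeg degA M + r) (G (sorted_list_of_multiset M))"
    using assms[of "sorted_list_of_multiset M"] by (simp add: tdeg_sorted_list)
qed

subsection \<open>Left multiplication and wedge products\<close>

text \<open>The operator \<open>x \<and> _\<close> on the full symmetric algebra. Applied repeatedly
  to the unit \<open>bvec {#}\<close> it produces all wedge products.\<close>

definition lmult :: "('a::linorder \<Rightarrow> int) \<Rightarrow> ('a \<Rightarrow>\<^sub>0 'k::comm_ring_1) \<Rightarrow> ('a multiset \<Rightarrow>\<^sub>0 'k) \<Rightarrow> ('a multiset \<Rightarrow>\<^sub>0 'k)" where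
  "lmult deg x v = lin (\<lambda>a. sym_extend (\<lambda>w. mono deg (a # w)) v) x"

lemma linear_map_lmult [intro!]: "linear_map (lmult deg x)"
  unfolding lmult_def by (rule linear_map_lin_param) auto

lemma linear_map_lmult_left [intro!]: "linear_map (\<lambda>x. lmult deg x v)"
  unfolding lmult_def by auto

lemmas lmult_simps =
  linear_map_add[OF linear_map_lmult] linear_map_smul[OF linear_map_lmult]
  linear_map_0[OF linear_map_lmult] linear_map_sum[OF linear_map_lmult]
  linear_map_add[OF linear_map_lmult_left] linear_map_smul[OF linear_map_lmult_left]
  linear_map_0[OF linear_map_lmult_left]

lemma lmult_mono:
  "lmult deg (bvec a) (mono deg w) = (mono deg (a # w) :: _ \<Rightarrow>\<^sub>0 'k::field_char_0)"
  by (simp add: lmult_def sym_extend_mono[OF graded_sym_shift[OF graded_sym_mono]])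

lemma lmult_not_valid:
  "\<not> valid deg M \<Longrightarrow> lmult deg x (bvec M) = (0 :: _ \<Rightarrow>\<^sub>0 'k::field_char_0)"
  by (simp add: lmult_def sym_extend_not_valid[OF graded_sym_shift[OF graded_sym_mono]])

lemma lmult_commute_bvec:
  "\<forall>v. lmult deg (bvec a) (lmult deg (bvec b) v) =
    smul (ksgn (deg a * deg b)) (lmult deg (bvec b) (lmult deg (bvec a) (v :: _ \<Rightarrow>\<^sub>0 'k::field_char_0)))"
proof (rule mono_linear_eqI[where deg = deg])
  fix w
  show "lmult deg (bvec a) (lmult deg (bvec b) (mono deg w)) =
    smul (ksgn (deg a * deg b)) (lmult deg (bvec b) (lmult deg (bvec a) (mono deg w :: _ \<Rightarrow>\<^sub>0 'k)))"
    unfolding lmult_mono using graded_symD[OF graded_sym_mono, of deg "[]" a b w] by simp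
qed (auto simp: lmult_not_valid lmult_simps intro!: linear_map_comp[OF linear_map_lmult])

lemma lmult_commute:
  fixes v :: "_ \<Rightarrow>\<^sub>0 'k::field_char_0"
  assumes "homog deg k x" "homog deg l y"
  shows "lmult deg x (lmult deg y v) = smul (ksgn (k * l)) (lmult deg y (lmult deg x v))"
proof -
  have basis: "\<forall>y. homog deg l y \<longrightarrow> lmult deg (bvec a) (lmult deg y v) =
      smul (ksgn (k * l)) (lmult deg y (lmult deg (bvec a) v))" if a: "deg a = k" for a
  proof (rule homog_linear_eqI)
    fix b assume "deg b = l"
    then show "lmult deg (bvec a) (lmult deg (bvec b) v) =
        smul (ksgn (k * l)) (lmult deg (bvec b) (lmult deg (bvec a) v))"
      using spec[OF lmult_commute_bvec[of deg a b], of v] a by simp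
  qed (auto intro!: linear_map_comp[OF linear_map_lmult])
  have "\<forall>x. homog deg k x \<longrightarrow>
      lmult deg x (lmult deg y v) = smul (ksgn (k * l)) (lmult deg y (lmult deg x v))"
  proof (rule homog_linear_eqI)
    fix a assume "deg a = k"
    then show "lmult deg (bvec a) (lmult deg y v) = smul (ksgn (k * l)) (lmult deg y (lmult deg (bvec a) v))"
      using basis assms(2) by blast
  qed (auto intro!: linear_map_comp[OF linear_map_lmult])
  with assms(1) show ?thesis by blast
qed

section \<open>Wedge products of lists of vectors\<close>

lemma wedge_Nil: "wedge deg [] = bvec {#}"
proof -
  have "{w::'a list. length w = length ([] :: ('a \<Rightarrow>\<^sub>0 'b) list) \<and>
     (\<forall>i<length ([] :: ('a \<Rightarrow>\<^sub>0 'b) list). w ! i \<in> Poly_Mapping.keys (([] :: ('a \<Rightarrow>\<^sub>0 'b) list) ! i))} = {[]}"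
    by auto
  then show ?thesis by (simp add: wedge_def mono_Nil)
qed

text \<open>Expanding \<open>x\<close> in the basis splits the first letter off every word. The
  recursion then replaces the sum over words that defines \<open>wedge\<close>.\<close>

lemma wedge_Cons:
  fixes x :: "'a::linorder \<Rightarrow>\<^sub>0 'k::field_char_0"
  shows "wedge deg (x # xs) = lmult deg x (wedge deg xs)"
proof -
  define W where "W xs = {w. length w = length xs \<and>
      (\<forall>i<length xs. w ! i \<in> Poly_Mapping.keys (xs ! i))}" for xs :: "('a \<Rightarrow>\<^sub>0 'k) list"
  have W: "W (x # xs) = (\<lambda>(a, w). a # w) ` (Poly_Mapping.keys x \<times> W xs)" (is "?l = ?r")
  proof (rule set_eqI)
    fix w
    show "w \<in> ?l \<longleftrightarrow> w \<in> ?r"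
      by (cases w) (auto simp: W_def image_iff less_Suc_eq_0_disj)
  qed
  have "wedge deg (x # xs) = (\<Sum>w\<in>W (x # xs).
      smul (\<Prod>i<length (x # xs). Poly_Mapping.lookup ((x # xs) ! i) (w ! i)) (mono deg w))"
    by (simp add: wedge_def W_def)
  also have "\<dots> = (\<Sum>(a, w)\<in>Poly_Mapping.keys x \<times> W xs.
      smul (\<Prod>i<length (x # xs). Poly_Mapping.lookup ((x # xs) ! i) ((a # w) ! i)) (mono deg (a # w)))"
    unfolding W by (subst sum.reindex) (auto simp: inj_on_def split_beta)
  also have "\<dots> = (\<Sum>a\<in>Poly_Mapping.keys x. \<Sum>w\<in>W xs.
      smul (Poly_Mapping.lookup x a) (smul (\<Prod>i<length xs. Poly_Mapping.lookup (xs ! i) (w ! i))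
        (lmult deg (bvec a) (mono deg w))))"
    unfolding sum.cartesian_product[symmetric] by (simp add: prod.lessThan_Suc_shift lmult_mono del: prod.lessThan_Suc)
  also have "\<dots> = (\<Sum>a\<in>Poly_Mapping.keys x. smul (Poly_Mapping.lookup x a) (lmult deg (bvec a) (wedge deg xs)))"
    by (simp add: smul_sum wedge_def W_def lmult_simps)
  also have "\<dots> = lmult deg x (wedge deg xs)"
    by (subst (2) linear_map_lin_bvec[OF linear_map_lmult_left]) (simp add: lin_def)
  finally show ?thesis .
qed

lemma wedge_map_bvec: "wedge deg (map bvec w) = (mono deg w :: _ \<Rightarrow>\<^sub>0 'k::field_char_0)"
  by (induction w) (auto simp: wedge_Nil wedge_Cons mono_Nil lmult_mono)

lemma wedge_singleton_bvec: "wedge deg [bvec a] = (bvec {#a#} :: _ \<Rightarrow>\<^sub>0 'k::field_char_0)"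
  using wedge_map_bvec[of deg "[a]"] by (simp add: mono_singleton)

text \<open>The degrees \<open>ds\<close> form a separate list because a homogeneous vector may be
  zero and then does not determine a degree. The sign is that of carrying \<open>x\<close> past all
  of \<open>us\<close>.\<close>

lemma wedge_insert:
  fixes x :: "'a::linorder \<Rightarrow>\<^sub>0 'k::field_char_0"
  assumes "homog deg k x" "list_all2 (homog deg) ds us"
  shows "wedge deg (us @ x # vs) = smul (ksgn (k * sum_list ds)) (lmult deg x (wedge deg (us @ vs)))"
  using assms(2)
proof induction
  case Nil
  then show ?case by (simp add: wedge_Cons)
next
  case (Cons d ds u us)
  have "lmult deg u (lmult deg x (wedge deg (us @ vs))) =
      smul (ksgn (k * d)) (lmult deg x (lmult deg u (wedge deg (us @ vs))))"
    using lmult_commute[OF Cons.hyps(1) assms(1)] by (simp add: mult.commute)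
  with Cons show ?case by (simp add: wedge_Cons lmult_simps ksgn_add distrib_left mult.commute)
qed

lemma smap_deg_lmult:
  fixes x :: "'a::linorder \<Rightarrow>\<^sub>0 'k::field_char_0"
  assumes "homog deg k x"
  shows "smap_deg deg deg k (lmult deg x)"
  unfolding smap_deg_def lmult_def sym_extend_bvec
proof (intro allI shomog_lin)
  fix M a assume "a \<in> Poly_Mapping.keys x"
  then have "deg a = k" using assms by (auto simp: homog_def)
  then show "shomog deg (tdeg deg M + k) (mono deg (a # sorted_list_of_multiset M) :: _ \<Rightarrow>\<^sub>0 'k)"
    using shomog_mono[of deg "a # sorted_list_of_multiset M"] by (simp add: tdeg_sorted_list add.commute)
qed

lemmas shomog_lmult = smap_degD[OF smap_deg_lmult linear_map_lmult]

subsection \<open>Derivations\<close>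

text \<open>The Leibniz rule for an operator of degree \<open>p\<close>. It serves with
  \<open>p = -1\<close> for the differential and with \<open>p = deg a\<close> for multiplication by
  the letter \<open>a\<close>.\<close>

fun gderiv_word :: "('a::linorder \<Rightarrow> int) \<Rightarrow> int \<Rightarrow> (('a \<Rightarrow>\<^sub>0 'k::comm_ring_1) \<Rightarrow> ('a \<Rightarrow>\<^sub>0 'k))
    \<Rightarrow> 'a list \<Rightarrow> ('a multiset \<Rightarrow>\<^sub>0 'k)" where
  "gderiv_word deg p f [] = 0"
| "gderiv_word deg p f (a # w) = lmult deg (f (bvec a)) (mono deg w) +
     smul (ksgn (p * deg a)) (lmult deg (bvec a) (gderiv_word deg p f w))"

definition gderiv :: "('a::linorder \<Rightarrow> int) \<Rightarrow> int \<Rightarrow> (('a \<Rightarrow>\<^sub>0 'k::comm_ring_1) \<Rightarrow> ('a \<Rightarrow>\<^sub>0 'k))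
    \<Rightarrow> ('a multiset \<Rightarrow>\<^sub>0 'k) \<Rightarrow> ('a multiset \<Rightarrow>\<^sub>0 'k)" where
  "gderiv deg p f = sym_extend (gderiv_word deg p f)"

lemma linear_map_gderiv [intro!]: "linear_map (gderiv deg p f)"
  by (auto simp: gderiv_def)

lemmas gderiv_simps =
  linear_map_add[OF linear_map_gderiv] linear_map_smul[OF linear_map_gderiv]
  linear_map_0[OF linear_map_gderiv]

text \<open>Makes the Leibniz rule independent of the order of the letters. Under an exchange of
  \<open>a\<close> and \<open>b\<close>, the term differentiating \<open>a\<close> on one side
  matches the term differentiating \<open>a\<close> on the other, and likewise for
  \<open>b\<close>.\<close>

lemma graded_sym_gderiv_word:
  fixes f :: "('a::linorder \<Rightarrow>\<^sub>0 'k::field_char_0) \<Rightarrow> ('a \<Rightarrow>\<^sub>0 'k)"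
  assumes "map_deg deg deg p f"
  shows "graded_sym deg (gderiv_word deg p f)"
  unfolding graded_sym_def
proof (intro allI)
  fix u a b v
  show "gderiv_word deg p f (u @ a # b # v) =
      smul (ksgn (deg a * deg b)) (gderiv_word deg p f (u @ b # a # v))"
  proof (induction u)
    case Nil
    \<comment> \<open>\<open>f (bvec c)\<close> has degree \<open>deg c + p\<close>: besides the
      sign of exchanging \<open>c\<close> and \<open>d\<close> it pays the sign that the Leibniz
      rule puts in front of \<open>d\<close>.\<close>
    have comm: "lmult deg (f (bvec c)) (lmult deg (bvec d) z) =
        smul (ksgn (deg c * deg d)) (smul (ksgn (p * deg d)) (lmult deg (bvec d) (lmult deg (f (bvec c)) z)))"
      for c d and z :: "'a multiset \<Rightarrow>\<^sub>0 'k"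
      using lmult_commute[OF map_degD[OF assms homog_bvec] homog_bvec, of c d z]
      by (simp add: ksgn_add distrib_right)
    show ?case
      using spec[OF lmult_commute_bvec[of deg a b], of "gderiv_word deg p f v"]
      by (simp add: lmult_simps smul_add comm[of a b] comm[of b a] mult.commute mult.left_commute
          flip: lmult_mono)
  next
    case (Cons c u)
    have "mono deg (u @ a # b # v) = smul (ksgn (deg a * deg b)) (mono deg (u @ b # a # v) :: _ \<Rightarrow>\<^sub>0 'k)"
      by (rule graded_symD[OF graded_sym_mono])
    with Cons show ?case by (simp add: lmult_simps smul_add mult.commute)
  qed
qed

lemma gderiv_mono:
  fixes f :: "('a::linorder \<Rightarrow>\<^sub>0 'k::field_char_0) \<Rightarrow> ('a \<Rightarrow>\<^sub>0 'k)"
  assumes "map_deg deg deg p f"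
  shows "gderiv deg p f (mono deg w) = gderiv_word deg p f w"
  unfolding gderiv_def by (rule sym_extend_mono[OF graded_sym_gderiv_word[OF assms]])

lemma gderiv_not_valid:
  fixes f :: "('a::linorder \<Rightarrow>\<^sub>0 'k::field_char_0) \<Rightarrow> ('a \<Rightarrow>\<^sub>0 'k)"
  assumes "map_deg deg deg p f" "\<not> valid deg M"
  shows "gderiv deg p f (bvec M) = 0"
  unfolding gderiv_def by (rule sym_extend_not_valid[OF graded_sym_gderiv_word[OF assms(1)] assms(2)])

lemma gderiv_unit: "gderiv deg p f (bvec {#}) = 0"
  by (simp add: gderiv_def sym_extend_bvec)

lemma gderiv_lmult:
  fixes f :: "('a::linorder \<Rightarrow>\<^sub>0 'k::field_char_0) \<Rightarrow> ('a \<Rightarrow>\<^sub>0 'k)"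
  assumes "map_deg deg deg p f" "linear_map f" "homog deg k x"
  shows "gderiv deg p f (lmult deg x v) = lmult deg (f x) v + smul (ksgn (p * k)) (lmult deg x (gderiv deg p f v))"
proof -
  have basis: "\<forall>v. gderiv deg p f (lmult deg (bvec a) v) =
      lmult deg (f (bvec a)) v + smul (ksgn (p * k)) (lmult deg (bvec a) (gderiv deg p f v))"
    if a: "deg a = k" for a
  proof (rule mono_linear_eqI[where deg = deg])
    fix w
    show "gderiv deg p f (lmult deg (bvec a) (mono deg w)) = lmult deg (f (bvec a)) (mono deg w) +
       smul (ksgn (p * k)) (lmult deg (bvec a) (gderiv deg p f (mono deg w)))"
      using a by (simp add: lmult_mono gderiv_mono[OF assms(1)])
  qed (auto simp: lmult_not_valid gderiv_not_valid[OF assms(1)] lmult_simps gderiv_simps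
      intro!: linear_map_comp[OF linear_map_lmult] linear_map_comp[OF linear_map_gderiv])
  have "\<forall>x. homog deg k x \<longrightarrow> gderiv deg p f (lmult deg x v) =
      lmult deg (f x) v + smul (ksgn (p * k)) (lmult deg x (gderiv deg p f v))"
  proof (rule homog_linear_eqI)
    fix a assume "deg a = k"
    then show "gderiv deg p f (lmult deg (bvec a) v) =
      lmult deg (f (bvec a)) v + smul (ksgn (p * k)) (lmult deg (bvec a) (gderiv deg p f v))"
      using basis by blast
  qed (auto intro!: linear_map_comp[OF linear_map_gderiv] linear_map_comp[OF linear_map_lmult_left assms(2)])
  with assms(3) show ?thesis by blast
qed

lemma gderiv_wedge:
  fixes f :: "('a::linorder \<Rightarrow>\<^sub>0 'k::field_char_0) \<Rightarrow> ('a \<Rightarrow>\<^sub>0 'k)"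
  assumes "map_deg deg deg p f" "linear_map f" "list_all2 (homog deg) ds xs"
  shows "gderiv deg p f (wedge deg xs) =
    (\<Sum>j<length xs. smul (ksgn (p * sum_list (take j ds))) (wedge deg (xs[j := f (xs ! j)])))"
  using assms(3)
proof induction
  case Nil
  then show ?case by (simp add: wedge_Nil gderiv_unit)
next
  case (Cons d ds x xs)
  then show ?case
    by (simp add: wedge_Cons gderiv_lmult[OF assms(1,2) Cons.hyps(1)] sum.lessThan_Suc_shift
        lmult_simps smul_sum ksgn_add distrib_left mult.commute del: sum.lessThan_Suc)
qed

lemma shomog_gderiv_word:
  fixes f :: "('a::linorder \<Rightarrow>\<^sub>0 'k::field_char_0) \<Rightarrow> ('a \<Rightarrow>\<^sub>0 'k)"
  assumes "map_deg deg deg p f"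
  shows "shomog deg (sum_list (map deg w) + p) (gderiv_word deg p f w)"
proof (induction w)
  case Nil
  then show ?case by simp
next
  case (Cons a w)
  show ?case
    using shomog_lmult[OF map_degD[OF assms homog_bvec[of deg a]] shomog_mono[of deg w]]
      shomog_smul[OF shomog_lmult[OF homog_bvec[of deg a] Cons.IH]]
    by (auto intro!: shomog_add simp: algebra_simps)
qed

lemma smap_deg_gderiv:
  fixes f :: "('a::linorder \<Rightarrow>\<^sub>0 'k::field_char_0) \<Rightarrow> ('a \<Rightarrow>\<^sub>0 'k)"
  assumes "map_deg deg deg p f"
  shows "smap_deg deg deg p (gderiv deg p f)"
  unfolding gderiv_def using shomog_gderiv_word[OF assms] by (rule smap_deg_sym_extend)

text \<open>The graded commutator of two derivations is a derivation, so it vanishes once it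
  vanishes on letters, which is \<open>comm\<close>. In the induction over words the terms with one
  derivative on the head and one on the tail cancel.\<close>

lemma gderiv_commute:
  fixes f g :: "('a::linorder \<Rightarrow>\<^sub>0 'k::field_char_0) \<Rightarrow> ('a \<Rightarrow>\<^sub>0 'k)"
  assumes f: "map_deg deg deg p f" "linear_map f" and g: "map_deg deg deg q g" "linear_map g"
    and comm: "\<And>x. f (g x) = smul (ksgn (p * q)) (g (f x))"
  shows "\<forall>v. gderiv deg p f (gderiv deg q g v) = smul (ksgn (p * q)) (gderiv deg q g (gderiv deg p f v))"
proof (rule mono_linear_eqI[where deg = deg])
  fix w
  show "gderiv deg p f (gderiv deg q g (mono deg w)) =
      smul (ksgn (p * q)) (gderiv deg q g (gderiv deg p f (mono deg w)))"
  proof (induction w)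
    case Nil
    then show ?case by (simp add: mono_Nil gderiv_unit gderiv_simps)
  next
    case (Cons a w)
    note D = gderiv_lmult[OF f homog_bvec] gderiv_lmult[OF g homog_bvec]
      gderiv_lmult[OF f map_degD[OF g(1) homog_bvec]] gderiv_lmult[OF g map_degD[OF f(1) homog_bvec]]
    show ?case
      using comm
      by (simp add: D Cons gderiv_simps lmult_simps smul_add ksgn_add distrib_left
          mult.commute mult.left_commute flip: lmult_mono)
  qed
qed (auto simp: gderiv_not_valid[OF f(1)] gderiv_not_valid[OF g(1)] gderiv_simps
      intro!: linear_map_comp[OF linear_map_gderiv])

subsection \<open>Extending graded commuting operators\<close>

definition graded_ops :: "('a \<Rightarrow> int) \<Rightarrow> ('a \<Rightarrow> ('b \<Rightarrow>\<^sub>0 'k::comm_ring_1) \<Rightarrow> ('b \<Rightarrow>\<^sub>0 'k)) \<Rightarrow> bool" where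
  "graded_ops deg P \<longleftrightarrow> (\<forall>a. linear_map (P a)) \<and>
    (\<forall>a b x. P a (P b x) = smul (ksgn (deg a * deg b)) (P b (P a x)))"

lemma graded_opsI:
  "(\<And>a. linear_map (P a)) \<Longrightarrow> (\<And>a b x. P a (P b x) = smul (ksgn (deg a * deg b)) (P b (P a x)))
    \<Longrightarrow> graded_ops deg P"
  unfolding graded_ops_def by blast

lemma graded_ops_linear: "graded_ops deg P \<Longrightarrow> linear_map (P a)"
  and graded_ops_commute: "graded_ops deg P \<Longrightarrow> P a (P b x) = smul (ksgn (deg a * deg b)) (P b (P a x))"
  unfolding graded_ops_def by blast+

text \<open>The start vector \<open>z\<close> is left open: it is the unit for coalgebra maps,
  \<open>bvec ({#}, {#})\<close> for the coproduct, and \<open>bvec N\<close> for products with a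
  fixed right factor.\<close>

definition op_extend :: "('a::linorder \<Rightarrow> ('b \<Rightarrow>\<^sub>0 'k::comm_ring_1) \<Rightarrow> ('b \<Rightarrow>\<^sub>0 'k)) \<Rightarrow> ('b \<Rightarrow>\<^sub>0 'k)
    \<Rightarrow> ('a multiset \<Rightarrow>\<^sub>0 'k) \<Rightarrow> ('b \<Rightarrow>\<^sub>0 'k)" where
  "op_extend P z = sym_extend (\<lambda>w. foldr P w z)"

lemma linear_map_op_extend [intro!]: "linear_map (op_extend P z)"
  by (auto simp: op_extend_def)

lemma op_extend_unit: "op_extend P z (bvec {#}) = z"
  by (simp add: op_extend_def sym_extend_bvec)

lemma op_extend_bvec: "op_extend P z (bvec M) = foldr P (sorted_list_of_multiset M) z"
  by (simp add: op_extend_def sym_extend_bvec)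

lemma graded_sym_foldr:
  assumes "graded_ops deg P"
  shows "graded_sym deg (\<lambda>w. foldr P w z)"
  unfolding graded_sym_def
proof (intro allI)
  fix u a b v
  show "foldr P (u @ a # b # v) z = smul (ksgn (deg a * deg b)) (foldr P (u @ b # a # v) z)"
  proof (induction u)
    case Nil
    then show ?case using graded_ops_commute[OF assms, of a b] by simp
  next
    case (Cons c u)
    then show ?case by (simp add: linear_map_smul[OF graded_ops_linear[OF assms]])
  qed
qed

lemma op_extend_mono:
  fixes P :: "'a::linorder \<Rightarrow> ('b \<Rightarrow>\<^sub>0 'k::field_char_0) \<Rightarrow> ('b \<Rightarrow>\<^sub>0 'k)"
  assumes "graded_ops deg P"
  shows "op_extend P z (mono deg w) = foldr P w z"
  unfolding op_extend_def by (rule sym_extend_mono[OF graded_sym_foldr[OF assms]])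

lemma op_extend_not_valid:
  fixes P :: "'a::linorder \<Rightarrow> ('b \<Rightarrow>\<^sub>0 'k::field_char_0) \<Rightarrow> ('b \<Rightarrow>\<^sub>0 'k)"
  assumes "graded_ops deg P" "\<not> valid deg M"
  shows "op_extend P z (bvec M) = 0"
  unfolding op_extend_def by (rule sym_extend_not_valid[OF graded_sym_foldr[OF assms(1)] assms(2)])

lemma op_extend_lmult:
  fixes P :: "'a::linorder \<Rightarrow> ('b \<Rightarrow>\<^sub>0 'k::field_char_0) \<Rightarrow> ('b \<Rightarrow>\<^sub>0 'k)"
  assumes "graded_ops deg P"
  shows "\<forall>v. op_extend P z (lmult deg (bvec a) v) = P a (op_extend P z v)"
proof (rule mono_linear_eqI[where deg = deg])
  fix w
  show "op_extend P z (lmult deg (bvec a) (mono deg w)) = P a (op_extend P z (mono deg w))"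
    by (simp add: lmult_mono op_extend_mono[OF assms])
qed (auto simp: lmult_not_valid op_extend_not_valid[OF assms] linear_map_0[OF graded_ops_linear[OF assms]]
    linear_map_0[OF linear_map_op_extend]
    intro!: linear_map_comp[OF linear_map_op_extend] linear_map_comp[OF graded_ops_linear[OF assms]])

lemma smap_deg_op_extend:
  fixes P :: "'a::linorder \<Rightarrow> ('b multiset \<Rightarrow>\<^sub>0 'k::field_char_0) \<Rightarrow> ('b multiset \<Rightarrow>\<^sub>0 'k)"
  assumes "graded_ops degA P" "\<And>a. smap_deg degB degB (degA a) (P a)"
  shows "smap_deg degA degB 0 (op_extend P (bvec {#}))"
  unfolding op_extend_def
proof (rule smap_deg_sym_extend)
  fix w
  show "shomog degB (sum_list (map degA w) + 0) (foldr P w (bvec {#}))"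
  proof (induction w)
    case Nil
    then show ?case using shomog_bvec[of degB "{#}"] by (simp add: tdeg_def)
  next
    case (Cons a w)
    then show ?case
      using smap_degD[OF assms(2) graded_ops_linear[OF assms(1)] Cons.IH] by (simp add: add.commute)
  qed
qed

subsection \<open>Tensor products of maps\<close>

lemma tensmap_bvec:
  "tensmap deg p F G (bvec (M, N)) = smul (ksgn (p * tdeg deg M)) (tens (F (bvec M)) (G (bvec N)))"
  by (simp add: tensmap_eq_lin)

text \<open>The sign in \<open>tensmap\<close> depends on the degree of the left factor, so
  \<open>u\<close> has to be homogeneous unless the right map has degree zero.\<close>

lemma tensmap_tens:
  assumes "linear_map F" "linear_map G" "p = 0 \<or> shomog deg k u"
  shows "tensmap deg p F G (tens u v) = smul (ksgn (p * k)) (tens (F u) (G v))"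
proof -
  have "tensmap deg p F G (tens u v) =
      lin (\<lambda>M. lin (\<lambda>N. smul (ksgn (p * tdeg deg M)) (tens (F (bvec M)) (G (bvec N)))) v) u"
    unfolding tens_eq_lin[of u v]
    by (simp add: linear_map_lin_comp[OF linear_map_tensmap] tensmap_bvec)
  also have "\<dots> = lin (\<lambda>M. smul (ksgn (p * k)) (tens (F (bvec M)) (G v))) u"
  proof (rule lin_cong)
    fix M assume "M \<in> Poly_Mapping.keys u"
    then have M: "p * tdeg deg M = p * k" using assms(3) by (auto simp: shomog_def)
    have "lin (\<lambda>N. tens (F (bvec M)) (G (bvec N))) v = tens (F (bvec M)) (G v)"
      by (rule linear_map_lin_bvec[OF linear_map_comp[OF linear_map_tens_right assms(2)], symmetric])
    then show "lin (\<lambda>N. smul (ksgn (p * tdeg deg M)) (tens (F (bvec M)) (G (bvec N)))) v =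
        smul (ksgn (p * k)) (tens (F (bvec M)) (G v))"
      by (simp add: lin_smul M)
  qed
  also have "\<dots> = smul (ksgn (p * k)) (tens (F u) (G v))"
    unfolding lin_smul
    by (rule arg_cong[OF linear_map_lin_bvec[OF linear_map_comp[OF linear_map_tens_left assms(1)], symmetric]])
  finally show ?thesis .
qed

lemma tensmap_0_tens:
  "linear_map F \<Longrightarrow> linear_map G \<Longrightarrow> tensmap deg 0 F G (tens u v) = tens (F u) (G v)"
  by (simp add: tensmap_tens[where k = 0])

text \<open>The sign comes from moving the right map of degree \<open>p\<close> past the left map
  \<open>F'\<close> of degree \<open>r\<close>. For \<open>p = 0\<close> nothing is moved, and
  \<open>F'\<close> may be inhomogeneous.\<close>

lemma tensmap_comp:
  fixes degA :: "'a \<Rightarrow> int"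
  assumes "linear_map F" "linear_map G" "p = 0 \<or> smap_deg degA degB r F'"
  shows "tensmap degB p F G (tensmap degA q F' G' x) =
    smul (ksgn (p * r)) (tensmap degA (p + q) (\<lambda>v. F (F' v)) (\<lambda>v. G (G' v)) x)"
proof -
  have "\<forall>x. tensmap degB p F G (tensmap degA q F' G' x) =
    smul (ksgn (p * r)) (tensmap degA (p + q) (\<lambda>v. F (F' v)) (\<lambda>v. G (G' v)) x)"
  proof (rule linear_ext)
    fix MN :: "'a multiset \<times> 'a multiset"
    obtain M N where MN: "MN = (M, N)" by (cases MN)
    have "p = 0 \<or> shomog degB (tdeg degA M + r) (F' (bvec M))"
      using assms(3) by (auto simp: smap_deg_def)
    from tensmap_tens[OF assms(1,2) this]
    show "tensmap degB p F G (tensmap degA q F' G' (bvec MN)) =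
      smul (ksgn (p * r)) (tensmap degA (p + q) (\<lambda>v. F (F' v)) (\<lambda>v. G (G' v)) (bvec MN))"
      by (simp add: MN tensmap_bvec linear_map_smul[OF linear_map_tensmap] ksgn_add
          distrib_left distrib_right mult.commute mult.left_commute)
  qed (auto intro!: linear_map_comp[OF linear_map_tensmap])
  then show ?thesis by blast
qed

lemma tensmap_add_left:
  "tensmap deg p (\<lambda>v. F v + F' v) G x = tensmap deg p F G x + tensmap deg p F' G x"
  and tensmap_add_right:
  "tensmap deg p F (\<lambda>v. G v + G' v) x = tensmap deg p F G x + tensmap deg p F G' x"
  and tensmap_smul_left: "tensmap deg p (\<lambda>v. smul c (F v)) G x = smul c (tensmap deg p F G x)"
  and tensmap_smul_right: "tensmap deg p F (\<lambda>v. smul c (G v)) x = smul c (tensmap deg p F G x)"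
  unfolding tensmap_eq_lin lin_add[symmetric] lin_smul[symmetric]
  by (simp_all add: case_prod_unfold tens_linear_simps smul_add mult.commute)

lemma linear_map_tensmap_left:
  assumes "\<And>v. linear_map (\<lambda>t. F t v)"
  shows "linear_map (\<lambda>t. tensmap deg p (F t) G x)"
  unfolding tensmap_eq_lin case_prod_unfold
  by (auto intro!: linear_map_lin_param linear_map_comp[OF linear_map_tens_left] assms)

lemma linear_map_tensmap_right:
  assumes "\<And>v. linear_map (\<lambda>t. G t v)"
  shows "linear_map (\<lambda>t. tensmap deg p F (G t) x)"
  unfolding tensmap_eq_lin case_prod_unfold
  by (auto intro!: linear_map_lin_param linear_map_comp[OF linear_map_tens_right] assms)

text \<open>The operator \<open>P \<otimes> 1 + 1 \<otimes> P\<close>, where \<open>p\<close> is the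
  degree of \<open>P\<close>. Both \<open>lmult\<close> by a homogeneous vector and
  \<open>gderiv\<close> turn into it when moved through \<open>full_coprod\<close>.\<close>

definition prim_ext :: "('a \<Rightarrow> int) \<Rightarrow> int \<Rightarrow> (('a multiset \<Rightarrow>\<^sub>0 'k::comm_ring_1) \<Rightarrow> ('a multiset \<Rightarrow>\<^sub>0 'k))
    \<Rightarrow> ('a multiset \<times> 'a multiset \<Rightarrow>\<^sub>0 'k) \<Rightarrow> ('a multiset \<times> 'a multiset \<Rightarrow>\<^sub>0 'k)" where
  "prim_ext deg p P x = tensmap deg 0 P (\<lambda>v. v) x + tensmap deg p (\<lambda>v. v) P x"

lemma linear_map_prim_ext [intro!]: "linear_map (prim_ext deg p P)"
  unfolding prim_ext_def by auto

lemmas prim_ext_simps =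
  linear_map_add[OF linear_map_prim_ext] linear_map_smul[OF linear_map_prim_ext]
  linear_map_0[OF linear_map_prim_ext]

text \<open>Exchanging \<open>P\<close> and \<open>Q\<close> exchanges the two mixed terms up to the
  factor \<open>ksgn (p * q)\<close>. Hence graded commutation of operators passes to their action
  on the tensor square.\<close>

lemma prim_ext_comp:
  assumes "linear_map P" "linear_map Q" "smap_deg deg deg q Q"
  shows "prim_ext deg p P (prim_ext deg q Q x) =
     tensmap deg 0 (\<lambda>v. P (Q v)) (\<lambda>v. v) x + tensmap deg q P Q x
     + smul (ksgn (p * q)) (tensmap deg p Q P x) + tensmap deg (p + q) (\<lambda>v. v) (\<lambda>v. P (Q v)) x"
  using tensmap_comp[OF assms(1) linear_map_id, of 0 deg deg 0]
    tensmap_comp[OF linear_map_id assms(1) disjI2[OF assms(3)]]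
    tensmap_comp[OF linear_map_id assms(1) disjI2[OF smap_deg_id]]
  by (simp add: prim_ext_def linear_map_add[OF linear_map_tensmap] algebra_simps)

subsection \<open>The unreduced coproduct\<close>

text \<open>Built from primitivity of the letters, which gives its recursion for free; agreement
  with the sum over subsets is \<open>full_coprod_subsets\<close>.\<close>

definition full_coprod :: "('a::linorder \<Rightarrow> int) \<Rightarrow> ('a multiset \<Rightarrow>\<^sub>0 'k::comm_ring_1)
    \<Rightarrow> ('a multiset \<times> 'a multiset \<Rightarrow>\<^sub>0 'k)" where
  "full_coprod deg = op_extend (\<lambda>a. prim_ext deg (deg a) (lmult deg (bvec a))) (bvec ({#}, {#}))"

lemma linear_map_full_coprod [intro!]: "linear_map (full_coprod deg)"
  by (auto simp: full_coprod_def)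

lemma graded_ops_prim_lmult:
  "graded_ops deg (\<lambda>a. prim_ext deg (deg a) (lmult deg (bvec a :: _ \<Rightarrow>\<^sub>0 'k::field_char_0)))"
proof (rule graded_opsI)
  fix a b and x :: "'a multiset \<times> 'a multiset \<Rightarrow>\<^sub>0 'k"
  have L: "(\<lambda>v. lmult deg (bvec a) (lmult deg (bvec b) v)) =
      (\<lambda>v. smul (ksgn (deg a * deg b)) (lmult deg (bvec b) (lmult deg (bvec a) (v :: _ \<Rightarrow>\<^sub>0 'k))))"
    using lmult_commute_bvec[of deg a b] by blast
  note C = prim_ext_comp[OF linear_map_lmult linear_map_lmult smap_deg_lmult[OF homog_bvec]]
  show "prim_ext deg (deg a) (lmult deg (bvec a)) (prim_ext deg (deg b) (lmult deg (bvec b)) x) =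
    smul (ksgn (deg a * deg b))
      (prim_ext deg (deg b) (lmult deg (bvec b)) (prim_ext deg (deg a) (lmult deg (bvec a)) x))"
    unfolding C L
    by (simp add: smul_add tensmap_smul_left tensmap_smul_right mult.commute algebra_simps)
qed auto

lemma full_coprod_lmult_bvec:
  "full_coprod deg (lmult deg (bvec a) v) =
    prim_ext deg (deg a) (lmult deg (bvec a)) (full_coprod deg (v :: _ \<Rightarrow>\<^sub>0 'k::field_char_0))"
  unfolding full_coprod_def using op_extend_lmult[OF graded_ops_prim_lmult] by blast

lemma full_coprod_unit: "full_coprod deg (bvec {#}) = bvec ({#}, {#})"
  by (simp add: full_coprod_def op_extend_unit)

lemma full_coprod_not_valid:
  "\<not> valid deg M \<Longrightarrow> full_coprod deg (bvec M) = (0 :: _ \<Rightarrow>\<^sub>0 'k::field_char_0)"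
  unfolding full_coprod_def by (rule op_extend_not_valid[OF graded_ops_prim_lmult])

lemma full_coprod_lmult:
  fixes v :: "_ \<Rightarrow>\<^sub>0 'k::field_char_0"
  assumes "homog deg k x"
  shows "full_coprod deg (lmult deg x v) = prim_ext deg k (lmult deg x) (full_coprod deg v)"
proof -
  have "\<forall>x. homog deg k x \<longrightarrow>
      full_coprod deg (lmult deg x v) = prim_ext deg k (lmult deg x) (full_coprod deg v)"
  proof (rule homog_linear_eqI)
    show "linear_map (\<lambda>x. prim_ext deg k (lmult deg x) (full_coprod deg v))"
      unfolding prim_ext_def by (auto intro!: linear_map_tensmap_left linear_map_tensmap_right)
  qed (use full_coprod_lmult_bvec in \<open>auto intro!: linear_map_comp[OF linear_map_full_coprod]\<close>)
  with assms show ?thesis by blast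
qed

text \<open>Holds because \<open>f\<close> sends letters to combinations of letters, and these are
  primitive again.\<close>

lemma full_coprod_gderiv:
  fixes f :: "('a::linorder \<Rightarrow>\<^sub>0 'k::field_char_0) \<Rightarrow> ('a \<Rightarrow>\<^sub>0 'k)"
  assumes "map_deg deg deg p f" "linear_map f"
  shows "\<forall>v. full_coprod deg (gderiv deg p f v) = prim_ext deg p (gderiv deg p f) (full_coprod deg v)"
proof (rule mono_linear_eqI[where deg = deg])
  fix w
  let ?D = "gderiv deg p f"
  show "full_coprod deg (?D (mono deg w)) = prim_ext deg p ?D (full_coprod deg (mono deg w))"
  proof (induction w)
    case Nil
    show ?case
      by (simp add: mono_Nil full_coprod_unit gderiv_unit prim_ext_def tensmap_bvec tens_linear_simps
          linear_map_0[OF linear_map_full_coprod])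
  next
    case (Cons a w)
    let ?L = "lmult deg (bvec a)" and ?X = "full_coprod deg (mono deg w)"
    have fa: "homog deg (deg a + p) (f (bvec a))" by (rule map_degD[OF assms(1) homog_bvec])
    have DL: "(\<lambda>v. ?D (?L v)) = (\<lambda>v. lmult deg (f (bvec a)) v + smul (ksgn (p * deg a)) (?L (?D v)))"
      using gderiv_lmult[OF assms homog_bvec] by blast
    note C = prim_ext_comp[OF linear_map_gderiv linear_map_lmult smap_deg_lmult[OF homog_bvec]]
      prim_ext_comp[OF linear_map_lmult linear_map_gderiv smap_deg_gderiv[OF assms(1)]]
    have "full_coprod deg (?D (mono deg (a # w))) = prim_ext deg (deg a + p) (lmult deg (f (bvec a))) ?X
       + smul (ksgn (p * deg a)) (prim_ext deg (deg a) ?L (prim_ext deg p ?D ?X))"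
      by (simp add: gderiv_lmult[OF assms homog_bvec] full_coprod_lmult[OF fa]
          full_coprod_lmult[OF homog_bvec] Cons linear_map_add[OF linear_map_full_coprod]
          linear_map_smul[OF linear_map_full_coprod] flip: lmult_mono)
    \<comment> \<open>Both orders of \<open>?D\<close> and \<open>?L\<close> produce the same two
      mixed tensors up to the factor \<open>ksgn (p * deg a)\<close>; the pure terms agree by
      \<open>DL\<close>.\<close>
    also have "\<dots> = prim_ext deg p ?D (prim_ext deg (deg a) ?L ?X)"
      unfolding C DL
      by (simp add: prim_ext_def smul_add tensmap_smul_left tensmap_smul_right tensmap_add_left
          tensmap_add_right mult.commute algebra_simps)
    also have "\<dots> = prim_ext deg p ?D (full_coprod deg (mono deg (a # w)))"
      by (simp add: full_coprod_lmult[OF homog_bvec] flip: lmult_mono)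
    finally show ?case .
  qed
qed (auto simp: full_coprod_not_valid gderiv_not_valid[OF assms(1)] prim_ext_simps linear_map_0[OF linear_map_full_coprod]
    intro!: linear_map_comp[OF linear_map_full_coprod] linear_map_comp[OF linear_map_prim_ext])

lemma full_coprod_op_extend:
  fixes P :: "'a::linorder \<Rightarrow> ('b::linorder multiset \<Rightarrow>\<^sub>0 'k::field_char_0) \<Rightarrow> ('b multiset \<Rightarrow>\<^sub>0 'k)"
  assumes P: "graded_ops degA P" and deg: "\<And>a. smap_deg degB degB (degA a) (P a)"
    and cop: "\<And>a v. full_coprod degB (P a v) = prim_ext degB (degA a) (P a) (full_coprod degB v)"
  defines "F \<equiv> op_extend P (bvec {#})"
  shows "\<forall>v. full_coprod degB (F v) = tensmap degA 0 F F (full_coprod degA v)"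
proof (rule mono_linear_eqI[where deg = degA])
  have lin: "linear_map F" unfolding F_def by auto
  then show "linear_map (\<lambda>v. full_coprod degB (F v))"
    by (rule linear_map_comp[OF linear_map_full_coprod])
  show "linear_map (\<lambda>v. tensmap degA 0 F F (full_coprod degA v))"
    by (rule linear_map_comp[OF linear_map_tensmap linear_map_full_coprod])
  fix w
  show "full_coprod degB (F (mono degA w)) = tensmap degA 0 F F (full_coprod degA (mono degA w))"
  proof (induction w)
    case Nil
    show ?case by (simp add: mono_Nil full_coprod_unit tensmap_bvec F_def op_extend_unit)
  next
    case (Cons a w)
    let ?L = "lmult degA (bvec a)" and ?X = "full_coprod degA (mono degA w)"
    have FL: "F (?L v) = P a (F v)" for v
      using op_extend_lmult[OF P] unfolding F_def by blast
    have "full_coprod degB (F (mono degA (a # w))) = prim_ext degB (degA a) (P a) (tensmap degA 0 F F ?X)"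
      by (simp add: FL cop Cons flip: lmult_mono)
    \<comment> \<open>\<open>F\<close> has degree zero, so \<open>P a\<close> passes it without a
      sign.\<close>
    also have "\<dots> = tensmap degA 0 (\<lambda>v. P a (F v)) F ?X + tensmap degA (degA a) F (\<lambda>v. P a (F v)) ?X"
      using smap_deg_op_extend[OF P deg, folded F_def]
      by (simp add: prim_ext_def tensmap_comp[OF graded_ops_linear[OF P] linear_map_id, of 0 degA degB 0]
          tensmap_comp[OF linear_map_id graded_ops_linear[OF P], of "degA a" degA degB 0])
    also have "\<dots> = tensmap degA 0 F F (prim_ext degA (degA a) ?L ?X)"
      using tensmap_comp[OF lin lin, of 0 degA degA 0]
      by (simp add: prim_ext_def linear_map_add[OF linear_map_tensmap] FL)
    also have "\<dots> = tensmap degA 0 F F (full_coprod degA (mono degA (a # w)))"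
      by (simp add: full_coprod_lmult[OF homog_bvec] flip: lmult_mono)
    finally show ?case .
  qed
next
  fix M assume M: "\<not> valid degA M"
  show "full_coprod degB (F (bvec M)) = tensmap degA 0 F F (full_coprod degA (bvec M))"
    by (simp add: F_def op_extend_not_valid[OF P M] full_coprod_not_valid[OF M]
        linear_map_0[OF linear_map_full_coprod] linear_map_0[OF linear_map_tensmap])
qed

subsection \<open>Signs of permutations\<close>

text \<open>The exponent of \<open>perm_sign\<close>, recursively and for an arbitrary degree
  function of positions, so that shifting all positions by \<open>Suc\<close> amounts to a change of
  \<open>d\<close>.\<close>

fun koszul_exp :: "(nat \<Rightarrow> int) \<Rightarrow> nat list \<Rightarrow> int" where
  "koszul_exp d [] = 0"
| "koszul_exp d (p # ps) = sum_list (map (\<lambda>q. if q < p then d p * d q else 0) ps) + koszul_exp d ps"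

lemma koszul_exp_eq:
  "(\<Sum>(p, q)\<in>{(p, q). p < q \<and> q < length ps \<and> ps ! q < ps ! p}. d (ps ! p) * d (ps ! q))
    = koszul_exp d ps"
proof (induction ps)
  case Nil
  then show ?case by simp
next
  case (Cons c ps)
  let ?X = "\<lambda>ps :: nat list. {(p, q). p < q \<and> q < length ps \<and> ps ! q < ps ! p}"
  let ?Y = "{q. q < length ps \<and> ps ! q < c}"
  let ?g = "\<lambda>(p, q). d ((c # ps) ! p) * d ((c # ps) ! q)"
  have split: "?X (c # ps) = (\<lambda>q. (0, Suc q)) ` ?Y \<union> map_prod Suc Suc ` ?X ps" (is "?l = ?r")
  proof (rule set_eqI)
    fix x :: "nat \<times> nat"
    obtain p q where x: "x = (p, q)" by (cases x)
    show "x \<in> ?l \<longleftrightarrow> x \<in> ?r"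
      unfolding x by (cases p; cases q) (auto simp: image_iff map_prod_def)
  qed
  have fin: "finite (?X ps)"
    by (rule finite_subset[of _ "{..<length ps} \<times> {..<length ps}"]) auto
  have "sum ?g (?X (c # ps)) = sum ?g ((\<lambda>q. (0, Suc q)) ` ?Y) + sum ?g (map_prod Suc Suc ` ?X ps)"
    unfolding split using fin by (intro sum.union_disjoint) auto
  also have "sum ?g (map_prod Suc Suc ` ?X ps) = koszul_exp d ps"
    unfolding Cons.IH[symmetric] by (subst sum.reindex) (auto simp: inj_on_def intro!: sum.cong)
  also have "sum ?g ((\<lambda>q. (0, Suc q)) ` ?Y) = (\<Sum>q\<in>?Y. d c * d (ps ! q))"
    by (subst sum.reindex) (auto simp: inj_on_def)
  also have "\<dots> = (\<Sum>q\<in>{0..<length ps}. if ps ! q < c then d c * d (ps ! q) else 0)"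
    by (subst sum.inter_filter[symmetric]) (auto intro!: sum.cong)
  also have "\<dots> = sum_list (map (\<lambda>q. if q < c then d c * d q else 0) ps)"
    by (simp add: sum_list_sum_nth)
  finally show ?case by simp
qed

lemma perm_sign_eq: "perm_sign deg w ps = ksgn (koszul_exp (\<lambda>i. deg (w ! i)) ps)"
  unfolding perm_sign_def koszul_exp_eq[symmetric] ..

text \<open>Position 0 is the smallest, so it is in inversion exactly with the entries in front of
  it; shifting the others keeps their relative order.\<close>

lemma koszul_exp_insert_0:
  "koszul_exp d (map Suc us @ 0 # map Suc vs) =
    d 0 * sum_list (map (\<lambda>u. d (Suc u)) us) + koszul_exp (\<lambda>i. d (Suc i)) (us @ vs)"
proof (induction us)
  case Nil
  have "koszul_exp d (map Suc vs) = koszul_exp (\<lambda>i. d (Suc i)) vs"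
    by (induction vs) (auto simp: o_def)
  then show ?case by (simp add: o_def)
next
  case (Cons u us)
  then show ?case by (simp add: o_def algebra_simps)
qed

lemma perm_sign_insert_0:
  "perm_sign deg (a # w) (map Suc us @ 0 # map Suc vs) =
    ksgn (deg a * sum_list (map (\<lambda>u. deg (w ! u)) us)) * perm_sign deg w (us @ vs)"
  by (simp add: perm_sign_eq koszul_exp_insert_0 ksgn_add)

lemma perm_sign_Cons_0: "perm_sign deg (a # w) (0 # map Suc vs) = perm_sign deg w vs"
  using koszul_exp_insert_0[of "\<lambda>i. deg ((a # w) ! i)" "[]" vs] by (simp add: perm_sign_eq)

lemma perm_sign_sorted:
  assumes "sorted ps"
  shows "perm_sign deg w ps = 1"
proof -
  have "koszul_exp d ps = 0" for d
    using assms
  proof (induction ps)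
    case Nil
    then show ?case by simp
  next
    case (Cons p ps)
    then have "map (\<lambda>q. if q < p then d p * d q else 0) ps = map (\<lambda>q. 0) ps" by auto
    then show ?case using Cons by (simp del: map_eq_conv)
  qed
  then show ?thesis by (simp add: perm_sign_eq)
qed

lemma sorted_list_of_set_Suc:
  assumes "finite S"
  shows "sorted_list_of_set (Suc ` S) = map Suc (sorted_list_of_set S)"
    "sorted_list_of_set (insert 0 (Suc ` S)) = 0 # map Suc (sorted_list_of_set S)"
  using assms
  by (intro sorted_list_of_set_unique[THEN iffD1]; auto simp: strict_sorted_iff sorted_wrt_map card_image distinct_map)+

lemma nths_Suc: "nths (a # w) (Suc ` S) = nths w S" "nths (a # w) (insert 0 (Suc ` S)) = a # nths w S"
  by (auto simp: nths_Cons intro!: arg_cong[of _ _ "nths w"])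

lemma Pow_lessThan_Suc:
  "Pow {..<Suc n} = (\<lambda>S. insert 0 (Suc ` S)) ` Pow {..<n} \<union> (\<lambda>S. Suc ` S) ` Pow {..<n}"
  unfolding lessThan_Suc_eq_insert_0 Pow_insert image_Pow_surj[OF refl, symmetric] image_image by auto

lemma sum_list_nths:
  assumes "S \<subseteq> {..<length w}"
  shows "sum_list (map (\<lambda>u. f (w ! u)) (sorted_list_of_set S)) = sum_list (map f (nths w S))"
  using assms
proof (induction w arbitrary: S)
  case Nil
  then show ?case by simp
next
  case (Cons a w)
  have "S \<in> Pow {..<Suc (length w)}" using Cons.prems by simp
  then obtain T where T: "T \<subseteq> {..<length w}" and S: "S = insert 0 (Suc ` T) \<or> S = Suc ` T"
    unfolding Pow_lessThan_Suc by auto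
  then have fin: "finite T" using finite_subset by auto
  from S show ?case
    by (elim disjE) (simp_all add: sorted_list_of_set_Suc[OF fin] nths_Suc Cons.IH[OF T] o_def)
qed

subsection \<open>The reduced coproduct\<close>

text \<open>Also meaningful for the empty and the full set, the two summands that the reduced
  coproduct leaves out.\<close>

definition coprod_term :: "('a::linorder \<Rightarrow> int) \<Rightarrow> 'a list \<Rightarrow> nat set \<Rightarrow> ('a multiset \<times> 'a multiset \<Rightarrow>\<^sub>0 'k::comm_ring_1)" where
  "coprod_term deg w S = smul (perm_sign deg w (sorted_list_of_set S @ sorted_list_of_set ({..<length w} - S)))
     (tens (mono deg (nths w S)) (mono deg (nths w ({..<length w} - S))))"

text \<open>The new letter has position 0. If it goes to the left factor it is already in front; if
  it goes to the right factor it passes all letters of \<open>S\<close>, which is the sign in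
  \<open>tensmap\<close>.\<close>

lemma coprod_term_Suc:
  assumes "S \<subseteq> {..<length w}"
  shows "coprod_term deg (a # w) (insert 0 (Suc ` S)) =
      tensmap deg 0 (lmult deg (bvec a)) (\<lambda>v. v) (coprod_term deg w S :: _ \<Rightarrow>\<^sub>0 'k::field_char_0)"
    and "coprod_term deg (a # w) (Suc ` S) =
      tensmap deg (deg a) (\<lambda>v. v) (lmult deg (bvec a)) (coprod_term deg w S :: _ \<Rightarrow>\<^sub>0 'k::field_char_0)"
proof -
  let ?T = "{..<length w} - S"
  have fin: "finite S" "finite ?T" using assms finite_subset by auto
  have "{..<length (a # w)} - insert 0 (Suc ` S) = Suc ` ?T"
    by (auto simp: less_Suc_eq_0_disj inj_image_mem_iff)
  then show "coprod_term deg (a # w) (insert 0 (Suc ` S)) =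
      tensmap deg 0 (lmult deg (bvec a)) (\<lambda>v. v) (coprod_term deg w S :: _ \<Rightarrow>\<^sub>0 'k)"
    by (simp add: tensmap_0_tens[OF linear_map_lmult linear_map_id] coprod_term_def sorted_list_of_set_Suc[OF fin(1)] sorted_list_of_set_Suc[OF fin(2)]
        nths_Suc linear_map_smul[OF linear_map_tensmap] lmult_mono perm_sign_Cons_0 flip: map_append)
  have "{..<length (a # w)} - Suc ` S = insert 0 (Suc ` ?T)"
    by (auto simp: less_Suc_eq_0_disj inj_image_mem_iff)
  then show "coprod_term deg (a # w) (Suc ` S) =
      tensmap deg (deg a) (\<lambda>v. v) (lmult deg (bvec a)) (coprod_term deg w S :: _ \<Rightarrow>\<^sub>0 'k)"
    by (simp add: tensmap_tens[OF linear_map_id linear_map_lmult disjI2[OF shomog_mono]] coprod_term_def sorted_list_of_set_Suc[OF fin(1)] sorted_list_of_set_Suc[OF fin(2)]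
        nths_Suc linear_map_smul[OF linear_map_tensmap] lmult_mono perm_sign_insert_0
        sum_list_nths[OF assms] mult.commute)
qed

lemma inj_on_Suc_image:
  "inj_on (\<lambda>S. insert 0 (Suc ` S)) A" "inj_on (\<lambda>S. Suc ` S) A"
  by (auto intro!: inj_onI simp: inj_image_eq_iff insert_ident)

text \<open>The two summands of \<open>prim_ext\<close> correspond to the subsets with and without
  the new position 0.\<close>

lemma full_coprod_subsets:
  "foldr (\<lambda>a. prim_ext deg (deg a) (lmult deg (bvec a))) w (bvec ({#}, {#})) =
    (\<Sum>S\<in>Pow {..<length w}. coprod_term deg w S :: _ \<Rightarrow>\<^sub>0 'k::field_char_0)"
proof (induction w)
  case Nil
  then show ?case by (simp add: coprod_term_def mono_Nil perm_sign_eq)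
next
  case (Cons a w)
  let ?A = "Pow {..<length w}"
  have "(\<Sum>S\<in>Pow {..<length (a # w)}. coprod_term deg (a # w) S :: _ \<Rightarrow>\<^sub>0 'k) =
     (\<Sum>S\<in>?A. coprod_term deg (a # w) (insert 0 (Suc ` S))) + (\<Sum>S\<in>?A. coprod_term deg (a # w) (Suc ` S))"
    unfolding length_Cons Pow_lessThan_Suc
    by (subst sum.union_disjoint) (auto simp: sum.reindex[OF inj_on_Suc_image(1)] sum.reindex[OF inj_on_Suc_image(2)])
  also have "\<dots> = prim_ext deg (deg a) (lmult deg (bvec a)) (\<Sum>S\<in>?A. coprod_term deg w S)"
    by (simp add: prim_ext_def linear_map_sum[OF linear_map_tensmap] coprod_term_Suc)
  finally show ?case using Cons by simp
qed

section \<open>The subspace of elements without constant term\<close>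

lemma SV_0 [simp]: "0 \<in> SV deg"
  by (simp add: SV_def)

lemma SV_add: "u \<in> SV deg \<Longrightarrow> v \<in> SV deg \<Longrightarrow> u + v \<in> SV deg"
  using Poly_Mapping.keys_add[of u v] by (auto simp: SV_def)

lemma SV_smul: "u \<in> SV deg \<Longrightarrow> smul c u \<in> SV deg"
  using keys_smul[of c u] by (auto simp: SV_def)

lemma SV_diff: "u \<in> SV deg \<Longrightarrow> v \<in> SV deg \<Longrightarrow> u - v \<in> (SV deg :: (_ \<Rightarrow>\<^sub>0 'k::comm_ring_1) set)"
  using SV_add[of u deg "smul (- 1) v"] SV_smul[of v deg "- 1"] by (simp add: smul_minus_left)

lemma SV_sum: "(\<And>x. x \<in> A \<Longrightarrow> f x \<in> SV deg) \<Longrightarrow> sum f A \<in> SV deg"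
  by (induction A rule: infinite_finite_induct) (auto intro: SV_add)

lemma SV_lin: "(\<And>x. x \<in> Poly_Mapping.keys v \<Longrightarrow> F x \<in> SV deg) \<Longrightarrow> lin F v \<in> SV deg"
  by (auto simp: lin_def intro!: SV_sum SV_smul)

lemma SV_bvec: "valid_mon deg M \<Longrightarrow> bvec M \<in> SV deg"
  by (auto simp: SV_def bvec_def split: if_splits)

lemma valid_mon_iff: "valid_mon deg M \<longleftrightarrow> M \<noteq> {#} \<and> valid deg M"
  by (simp add: valid_mon_def valid_def)

lemma SV_mono: "w \<noteq> [] \<Longrightarrow> mono deg w \<in> SV deg"
  by (auto simp: mono_eq odd_repetition_valid valid_mon_iff intro!: SV_smul SV_bvec)

text \<open>True even when \<open>v\<close> is the unit, since a word with a letter in front is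
  nonempty. This is how maps starting at the unit end up in \<open>SV\<close>.\<close>

lemma SV_lmult: "lmult deg x v \<in> SV deg"
  unfolding lmult_def sym_extend_def by (intro SV_lin SV_mono) simp

lemma SV_gderiv: "gderiv deg p f v \<in> SV deg"
proof -
  have "gderiv_word deg p f w \<in> SV deg" for w
    by (cases w) (auto intro!: SV_add SV_smul SV_lmult)
  then show ?thesis unfolding gderiv_def sym_extend_def by (auto intro: SV_lin)
qed

lemma SV_linear_eqI:
  assumes "v \<in> SV deg" "linear_map f" "linear_map g" "\<And>M. valid_mon deg M \<Longrightarrow> f (bvec M) = g (bvec M)"
  shows "f v = g v"
  using assms(1,4) by (auto intro!: linear_eqI[OF assms(2,3), of v] simp: SV_def)

lemma SV_linear_image:
  assumes "v \<in> SV degA" "linear_map f" "\<And>M. valid_mon degA M \<Longrightarrow> f (bvec M) \<in> SV degB"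
  shows "f v \<in> SV degB"
proof -
  have "lin (\<lambda>M. f (bvec M)) v \<in> SV degB"
    using assms(1,3) by (intro SV_lin) (auto simp: SV_def)
  then show ?thesis using linear_map_lin_bvec[OF assms(2), of v] by simp
qed

lemma linear_map_coprod [intro!]: "linear_map (coprod deg)"
  by (auto simp: coprod_def ext_eq_lin)

lemma coprod_eq_full_coprod:
  fixes v :: "'a::linorder multiset \<Rightarrow>\<^sub>0 'k::field_char_0"
  assumes "v \<in> SV deg"
  shows "coprod deg v = full_coprod deg v - tens v (bvec {#}) - tens (bvec {#}) v"
proof (rule SV_linear_eqI[OF assms])
  fix M :: "'a multiset" assume M: "valid_mon deg M"
  define w where "w = sorted_list_of_multiset M"
  have "mset w = M" by (simp add: w_def)
  then have "w \<noteq> []" using M by (auto simp: valid_mon_iff)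
  moreover have "mono deg w = (bvec M :: _ \<Rightarrow>\<^sub>0 'k)"
    using M by (simp add: w_def valid_mon_iff mono_sorted_list)
  ultimately have w: "mono deg w = (bvec M :: _ \<Rightarrow>\<^sub>0 'k)" "w \<noteq> []" by auto
  let ?R = "{S. S \<subseteq> {..<length w} \<and> S \<noteq> {} \<and> S \<noteq> {..<length w}}"
  have R: "Pow {..<length w} = insert {} (insert {..<length w} ?R)" by auto
  have fin: "finite ?R" by (rule finite_subset[of _ "Pow {..<length w}"]) auto
  \<comment> \<open>The empty and the full set must differ for two separate summands to be split
    off; at the unit they coincide.\<close>
  have ne: "{..<length w} \<noteq> {}" using w by auto
  have nths_all: "nths w {..<length w} = w" by (simp add: nths_all)
  have "full_coprod deg (bvec M) = (\<Sum>S\<in>Pow {..<length w}. coprod_term deg w S :: _ \<Rightarrow>\<^sub>0 'k)"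
    by (simp add: full_coprod_def op_extend_bvec full_coprod_subsets w_def)
  also have "\<dots> = coprod_term deg w {} + coprod_term deg w {..<length w} + (\<Sum>S\<in>?R. coprod_term deg w S)"
    unfolding R using fin ne by (subst sum.insert; simp add: algebra_simps)
  also have "coprod_term deg w {} = tens (bvec {#}) (bvec M :: _ \<Rightarrow>\<^sub>0 'k)"
    using w by (simp add: coprod_term_def mono_Nil nths_all perm_sign_sorted)
  also have "coprod_term deg w {..<length w} = tens (bvec M :: _ \<Rightarrow>\<^sub>0 'k) (bvec {#})"
    using w by (simp add: coprod_term_def mono_Nil nths_all perm_sign_sorted)
  also have "(\<Sum>S\<in>?R. coprod_term deg w S) = (coprod deg (bvec M) :: _ \<Rightarrow>\<^sub>0 'k)"
    by (simp add: coprod_def ext_eq_lin Let_def coprod_term_def w_def)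
  finally show "coprod deg (bvec M) = full_coprod deg (bvec M) - tens (bvec M) (bvec {#}) -
      (tens (bvec {#}) (bvec M) :: _ \<Rightarrow>\<^sub>0 'k)"
    by simp
qed (auto intro!: linear_map_tens_left linear_map_tens_right)

subsection \<open>Ordered decompositions\<close>

text \<open>Disjointness in the form \<open>sorted_wrt\<close> behaves well under append and map,
  the operations that relate decompositions of \<open>n\<close> and \<open>Suc n\<close>.\<close>

lemma odec_iff:
  "Bs \<in> odec n k \<longleftrightarrow> length Bs = k \<and> {} \<notin> set Bs \<and> sorted_wrt (\<lambda>A B. A \<inter> B = {}) Bs \<and> \<Union>(set Bs) = {..<n}"
proof -
  have "(\<forall>i<length Bs. \<forall>j<length Bs. i \<noteq> j \<longrightarrow> Bs ! i \<inter> Bs ! j = {}) \<longleftrightarrow>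
      sorted_wrt (\<lambda>A B. A \<inter> B = {}) Bs"
    (is "?l \<longleftrightarrow> ?r")
  proof
    assume ?l
    then show ?r unfolding sorted_wrt_iff_nth_less by simp
  next
    assume r: ?r
    show ?l
    proof (intro allI impI)
      fix i j assume ij: "i < length Bs" "j < length Bs" "i \<noteq> j"
      show "Bs ! i \<inter> Bs ! j = {}"
        using r[unfolded sorted_wrt_iff_nth_less, rule_format, of i j]
          r[unfolded sorted_wrt_iff_nth_less, rule_format, of j i] ij
        by (cases i j rule: linorder_cases) (auto simp: Int_commute)
    qed
  qed
  then show ?thesis unfolding odec_def by auto
qed

text \<open>Position 0 belongs to a letter put in front of the word, and the old positions move up
  by one. Here the new letter is a block of its own; in \<open>odec_join\<close> it enters the block
  number \<open>j\<close>.\<close>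

definition odec_insert :: "nat \<Rightarrow> nat set list \<Rightarrow> nat set list" where
  "odec_insert j Bs = map ((`) Suc) (take j Bs) @ {0} # map ((`) Suc) (drop j Bs)"

definition odec_join :: "nat \<Rightarrow> nat set list \<Rightarrow> nat set list" where
  "odec_join j Bs = map ((`) Suc) (take j Bs) @ insert 0 (Suc ` (Bs ! j)) # map ((`) Suc) (drop (Suc j) Bs)"

text \<open>Recovers the argument \<open>j\<close> from the result of \<open>odec_insert\<close> or
  \<open>odec_join\<close>.\<close>

definition zero_pos :: "nat set list \<Rightarrow> nat" where
  "zero_pos Bs = length (takeWhile (\<lambda>B. 0 \<notin> B) Bs)"

lemma zero_pos_append: "(\<And>B. B \<in> set us \<Longrightarrow> 0 \<notin> B) \<Longrightarrow> 0 \<in> B \<Longrightarrow> zero_pos (us @ B # vs) = length us"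
  by (simp add: zero_pos_def takeWhile_append2)

lemma Suc_vimage [simp]: "Suc -` Suc ` B = B" "Suc -` insert 0 (Suc ` B) = B" "Suc -` {0} = {}"
  by auto

lemma Suc_image_vimage: "0 \<notin> B \<Longrightarrow> Suc ` (Suc -` B) = B"
proof (intro equalityI subsetI)
  fix x assume "0 \<notin> B" "x \<in> B"
  then show "x \<in> Suc ` (Suc -` B)" by (cases x) auto
qed auto

lemma odec_split:
  assumes "Bs \<in> odec (Suc n) k"
  obtains us B vs where "Bs = us @ B # vs" "0 \<in> B" "\<And>A. A \<in> set us \<union> set vs \<Longrightarrow> 0 \<notin> A"
proof -
  have "0 \<in> \<Union>(set Bs)" using assms by (auto simp: odec_iff)
  then obtain B where "B \<in> set Bs" "0 \<in> B" by blast
  then obtain us vs where Bs: "Bs = us @ B # vs" by (meson split_list)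
  show ?thesis
  proof (rule that[OF Bs \<open>0 \<in> B\<close>])
    fix A assume "A \<in> set us \<union> set vs"
    then show "0 \<notin> A" using assms \<open>0 \<in> B\<close> by (auto simp: odec_iff Bs sorted_wrt_append)
  qed
qed

lemma odec_insert_in: "us @ vs \<in> odec n k \<Longrightarrow> map ((`) Suc) us @ {0} # map ((`) Suc) vs \<in> odec (Suc n) (Suc k)"
  by (auto simp: odec_iff sorted_wrt_append sorted_wrt_map lessThan_Suc_eq_insert_0
      simp flip: image_Int simp: image_Un[symmetric] image_Union[symmetric])

lemma odec_join_in:
  "us @ B # vs \<in> odec n k \<Longrightarrow> map ((`) Suc) us @ insert 0 (Suc ` B) # map ((`) Suc) vs \<in> odec (Suc n) k"
  by (auto simp: odec_iff sorted_wrt_append sorted_wrt_map lessThan_Suc_eq_insert_0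
      simp flip: image_Int simp: image_Un[symmetric] image_Union[symmetric])

lemma sorted_wrt_vimage:
  "sorted_wrt (\<lambda>A B. A \<inter> B = {}) Bs \<Longrightarrow> sorted_wrt (\<lambda>A B. Suc -` A \<inter> Suc -` B = {}) Bs"
  by (erule sorted_wrt_mono_rel[rotated]) auto

text \<open>Pulling back along \<open>Suc\<close> deletes the element 0. A block \<open>{0}\<close>
  would become empty, so it is dropped and the number of blocks falls by one.\<close>

lemma odec_vimage:
  assumes "us @ B # vs \<in> odec (Suc n) k" "0 \<in> B" "\<And>A. A \<in> set us \<union> set vs \<Longrightarrow> 0 \<notin> A"
  shows "B = {0} \<Longrightarrow> map ((-`) Suc) (us @ vs) \<in> odec n (k - 1)"
    and "B \<noteq> {0} \<Longrightarrow> map ((-`) Suc) (us @ B # vs) \<in> odec n k"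
proof -
  have un: "Suc -` (\<Union>(set us) \<union> B \<union> \<Union>(set vs)) = {..<n}"
    using assms(1) by (auto simp: odec_iff Un_ac)
  have ne: "Suc -` A \<noteq> {}" if "A \<in> set us \<union> set vs" for A
  proof -
    have "A \<noteq> {}" using assms(1) that by (auto simp: odec_iff)
    then show ?thesis using Suc_image_vimage[OF assms(3)[OF that]] by (metis image_empty)
  qed
  have "sorted_wrt (\<lambda>A B. A \<inter> B = {}) (us @ B # vs)" using assms(1) by (simp add: odec_iff)
  then have dj: "sorted_wrt (\<lambda>A B. Suc -` A \<inter> Suc -` B = {}) (us @ B # vs)"
    by (rule sorted_wrt_vimage)
  have len: "Suc (length us + length vs) = k" using assms(1) by (simp add: odec_iff)
  show "map ((-`) Suc) (us @ vs) \<in> odec n (k - 1)" if "B = {0}"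
    unfolding odec_iff
  proof (intro conjI)
    have "\<Union>(set (map ((-`) Suc) (us @ vs))) = Suc -` (\<Union>(set us) \<union> {0} \<union> \<Union>(set vs))" by auto
    then show "\<Union>(set (map ((-`) Suc) (us @ vs))) = {..<n}" using un that by simp
    show "{} \<notin> set (map ((-`) Suc) (us @ vs))" using ne by (metis (no_types) imageE set_append set_map)
    show "sorted_wrt (\<lambda>A B. A \<inter> B = {}) (map ((-`) Suc) (us @ vs))"
      using dj by (simp add: sorted_wrt_map sorted_wrt_append)
  qed (use len in simp)
  have "Suc -` B \<noteq> {}" if "B \<noteq> {0}"
  proof -
    obtain x where "x \<in> B" "x \<noteq> 0" using \<open>0 \<in> B\<close> \<open>B \<noteq> {0}\<close> by blast
    then show ?thesis by (cases x) auto
  qed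
  then show "map ((-`) Suc) (us @ B # vs) \<in> odec n k" if "B \<noteq> {0}"
    unfolding odec_iff
  proof (intro conjI)
    have "\<Union>(set (map ((-`) Suc) (us @ B # vs))) = Suc -` (\<Union>(set us) \<union> B \<union> \<Union>(set vs))" by auto
    then show "\<Union>(set (map ((-`) Suc) (us @ B # vs))) = {..<n}" using un by simp
    have "Suc -` A \<noteq> {}" if "A \<in> set (us @ B # vs)" for A
      using ne \<open>B \<noteq> {0} \<Longrightarrow> Suc -` B \<noteq> {}\<close> \<open>B \<noteq> {0}\<close> that by auto
    then show "{} \<notin> set (map ((-`) Suc) (us @ B # vs))" by (metis (no_types) imageE set_map)
    show "sorted_wrt (\<lambda>A B. A \<inter> B = {}) (map ((-`) Suc) (us @ B # vs))"
      using dj by (simp add: sorted_wrt_map sorted_wrt_append)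
  qed (use len in simp)
qed

lemma bij_betw_odec_insert:
  "bij_betw (\<lambda>(j, Bs). odec_insert j Bs) ({..<Suc k} \<times> odec n k) {Bs \<in> odec (Suc n) (Suc k). {0} \<in> set Bs}"
  (is "bij_betw ?f ?A ?B")
proof -
  let ?g = "\<lambda>Bs. (zero_pos Bs, map ((-`) Suc) (take (zero_pos Bs) Bs @ drop (Suc (zero_pos Bs)) Bs))"
  have 1: "?g (?f x) = x \<and> ?f x \<in> ?B" if "x \<in> ?A" for x
  proof -
    obtain j Bs where x: "x = (j, Bs)" by (cases x)
    with that have j: "j \<le> length Bs" and Bs: "Bs \<in> odec n k" by (auto simp: odec_iff)
    have z: "zero_pos (odec_insert j Bs) = j"
      unfolding odec_insert_def using j by (subst zero_pos_append) auto
    have "?g (odec_insert j Bs) = (j, Bs)"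
      unfolding z using j by (simp add: odec_insert_def o_def map_append[symmetric] del: map_append)
    moreover have "odec_insert j Bs \<in> ?B"
      using odec_insert_in[of "take j Bs" "drop j Bs" n k] Bs by (simp add: odec_insert_def)
    ultimately show ?thesis unfolding x prod.case by blast
  qed
  have 2: "?f (?g Bs) = Bs \<and> ?g Bs \<in> ?A" if "Bs \<in> ?B" for Bs
  proof -
    from that have Bs: "Bs \<in> odec (Suc n) (Suc k)" and in_Bs: "{0} \<in> set Bs" by auto
    obtain us B vs where u: "Bs = us @ B # vs" "0 \<in> B" "\<And>A. A \<in> set us \<union> set vs \<Longrightarrow> 0 \<notin> A"
      using odec_split[OF Bs] by blast
    then have B: "B = {0}" using in_Bs by auto
    have z: "zero_pos Bs = length us" using u by (simp add: zero_pos_append)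
    have id: "map ((`) Suc \<circ> (-`) Suc) us = us" "map ((`) Suc \<circ> (-`) Suc) vs = vs"
      using u(3) by (auto intro!: map_idI simp: Suc_image_vimage simp del: image_vimage_eq)
    have g: "?g Bs = (length us, map ((-`) Suc) (us @ vs))" unfolding z by (simp add: u(1))
    have "odec_insert (length us) (map ((-`) Suc) (us @ vs)) = Bs"
      by (simp add: odec_insert_def id u(1) B)
    moreover have "length us < Suc k" using Bs by (simp add: odec_iff u(1))
    moreover have "map ((-`) Suc) (us @ vs) \<in> odec n k"
      using odec_vimage(1)[OF Bs[unfolded u(1)] u(2,3) B] by simp
    ultimately show ?thesis unfolding g prod.case by blast
  qed
  show ?thesis
    by (rule bij_betw_byWitness[where f' = ?g]) (use 1 2 in blast)+
qed

lemma bij_betw_odec_join: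
  "bij_betw (\<lambda>(j, Bs). odec_join j Bs) ({..<k} \<times> odec n k) {Bs \<in> odec (Suc n) k. {0} \<notin> set Bs}"
  (is "bij_betw ?f ?A ?B")
proof -
  let ?g = "\<lambda>Bs. (zero_pos Bs, map ((-`) Suc) Bs)"
  have 1: "?g (?f x) = x \<and> ?f x \<in> ?B" if "x \<in> ?A" for x
  proof -
    obtain j Bs where x: "x = (j, Bs)" by (cases x)
    with that have j: "j < length Bs" and Bs: "Bs \<in> odec n k" by (auto simp: odec_iff)
    have split: "take j Bs @ Bs ! j # drop (Suc j) Bs = Bs" using j by (rule id_take_nth_drop[symmetric])
    have z: "zero_pos (odec_join j Bs) = j"
      unfolding odec_join_def using j by (subst zero_pos_append) auto
    have "?g (odec_join j Bs) = (j, Bs)"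
      unfolding z using split by (simp add: odec_join_def o_def)
    moreover have "odec_join j Bs \<in> odec (Suc n) k"
      using odec_join_in[of "take j Bs" "Bs ! j" "drop (Suc j) Bs" n k] Bs split by (simp add: odec_join_def)
    \<comment> \<open>Joining 0 to an empty block would create the block \<open>{0}\<close>;
      nonemptiness keeps the two kinds of decompositions apart.\<close>
    moreover have "Bs ! j \<noteq> {}" using Bs nth_mem[OF j] by (metis odec_iff)
    then have "{0} \<notin> set (odec_join j Bs)"
      by (auto simp: odec_join_def)
    ultimately show ?thesis unfolding x prod.case by blast
  qed
  have 2: "?f (?g Bs) = Bs \<and> ?g Bs \<in> ?A" if "Bs \<in> ?B" for Bs
  proof -
    from that have Bs: "Bs \<in> odec (Suc n) k" and in_Bs: "{0} \<notin> set Bs" by auto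
    obtain us B vs where u: "Bs = us @ B # vs" "0 \<in> B" "\<And>A. A \<in> set us \<union> set vs \<Longrightarrow> 0 \<notin> A"
      using odec_split[OF Bs] by blast
    then have B: "B \<noteq> {0}" using in_Bs by auto
    have z: "zero_pos Bs = length us" using u by (simp add: zero_pos_append)
    have id: "map ((`) Suc \<circ> (-`) Suc) us = us" "map ((`) Suc \<circ> (-`) Suc) vs = vs"
      using u(3) by (auto intro!: map_idI simp: Suc_image_vimage simp del: image_vimage_eq)
    have "Suc ` (Suc -` B) = B - {0}"
      using Suc_image_vimage[of "B - {0}"] by (auto simp: image_iff)
    then have B': "insert 0 (Suc ` (Suc -` B)) = B" using u(2) by auto
    have g: "?g Bs = (length us, map ((-`) Suc) (us @ B # vs))" unfolding z by (simp add: u(1))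
    have "odec_join (length us) (map ((-`) Suc) (us @ B # vs)) = Bs"
      by (simp add: odec_join_def id nth_append B' u(1) del: image_vimage_eq)
    moreover have "length us < k" using Bs by (auto simp: odec_iff u(1))
    moreover have "map ((-`) Suc) (us @ B # vs) \<in> odec n k"
      by (rule odec_vimage(2)[OF Bs[unfolded u(1)] u(2,3) B])
    ultimately show ?thesis unfolding g prod.case by blast
  qed
  show ?thesis
    by (rule bij_betw_byWitness[where f' = ?g]) (use 1 2 in blast)+
qed

lemma finite_odec: "finite (odec n k)"
proof (rule finite_subset[OF _ finite_lists_length_eq[of "Pow {..<n}" k]])
  show "odec n k \<subseteq> {Bs. set Bs \<subseteq> Pow {..<n} \<and> length Bs = k}"
  proof
    fix Bs assume Bs: "Bs \<in> odec n k"
    have "set Bs \<subseteq> Pow (\<Union>(set Bs))" by auto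
    also have "\<Union>(set Bs) = {..<n}" using Bs by (simp add: odec_iff)
    finally show "Bs \<in> {Bs. set Bs \<subseteq> Pow {..<n} \<and> length Bs = k}"
      using Bs by (simp add: odec_iff)
  qed
qed simp

lemma odec_Suc_0: "odec (Suc n) 0 = {}"
  by (auto simp: odec_iff)

lemma odec_zero: "odec 0 0 = {[]}" "odec 0 (Suc k) = {}"
proof -
  show "odec 0 (Suc k) = {}"
  proof (rule equals0I)
    fix Bs assume "Bs \<in> odec 0 (Suc k)"
    then show False by (cases Bs) (auto simp: odec_iff)
  qed
qed (auto simp: odec_iff)

text \<open>In the second part the sum over \<open>j\<close> is the inner one: for fixed blocks it
  is the Leibniz sum of a derivation.\<close>

lemma sum_odec_Suc:
  "(\<Sum>Bs\<in>odec (Suc n) (Suc k). h Bs) =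
    (\<Sum>j<Suc k. \<Sum>Bs\<in>odec n k. h (odec_insert j Bs)) + (\<Sum>Bs\<in>odec n (Suc k). \<Sum>j<Suc k. h (odec_join j Bs))"
proof -
  let ?X = "{Bs \<in> odec (Suc n) (Suc k). {0} \<in> set Bs}" and ?Y = "{Bs \<in> odec (Suc n) (Suc k). {0} \<notin> set Bs}"
  have "sum h (odec (Suc n) (Suc k)) = sum h (?X \<union> ?Y)" by (rule sum.cong) auto
  also have "\<dots> = sum h ?X + sum h ?Y"
    by (rule sum.union_disjoint) (auto simp: finite_odec)
  also have "sum h ?X = (\<Sum>(j, Bs)\<in>{..<Suc k} \<times> odec n k. h (odec_insert j Bs))"
    using sum.reindex_bij_betw[OF bij_betw_odec_insert, of h k n] by (simp add: case_prod_unfold)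
  also have "\<dots> = (\<Sum>j<Suc k. \<Sum>Bs\<in>odec n k. h (odec_insert j Bs))"
    by (rule sum.cartesian_product[symmetric])
  also have "sum h ?Y = (\<Sum>(j, Bs)\<in>{..<Suc k} \<times> odec n (Suc k). h (odec_join j Bs))"
    using sum.reindex_bij_betw[OF bij_betw_odec_join, of h "Suc k" n] by (simp add: case_prod_unfold)
  also have "\<dots> = (\<Sum>j<Suc k. \<Sum>Bs\<in>odec n (Suc k). h (odec_join j Bs))"
    by (rule sum.cartesian_product[symmetric])
  also have "\<dots> = (\<Sum>Bs\<in>odec n (Suc k). \<Sum>j<Suc k. h (odec_join j Bs))"
    by (rule sum.swap)
  finally show ?thesis .
qed

text \<open>The recursion \<open>sum_odec_Suc\<close> for the constant function 1 computes the
  cardinality, which is zero by induction.\<close>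

lemma odec_empty: "n < k \<Longrightarrow> odec n k = {}"
proof (induction n arbitrary: k)
  case 0
  then show ?case by (cases k) (auto simp: odec_zero)
next
  case (Suc n)
  then obtain k' where k: "k = Suc k'" "n < k'" by (cases k) auto
  have "card (odec (Suc n) k) = 0"
    using sum_odec_Suc[of "\<lambda>_. 1 :: nat" n k'] k Suc.IH by simp
  then show ?case by (simp add: finite_odec)
qed

subsection \<open>The cumulant bijection\<close>

lemma gc_algebra_linear: "gc_algebra deg m \<Longrightarrow> linear_map (m x)" "gc_algebra deg m \<Longrightarrow> linear_map (\<lambda>x. m x y)"
  and gc_algebra_assoc: "gc_algebra deg m \<Longrightarrow> m (m x y) z = m x (m y z)"
  and gc_algebra_homog: "gc_algebra deg m \<Longrightarrow> homog deg n x \<Longrightarrow> homog deg k y \<Longrightarrow> homog deg (n + k) (m x y)"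
  and gc_algebra_commute:
    "gc_algebra deg m \<Longrightarrow> homog deg n x \<Longrightarrow> homog deg k y \<Longrightarrow> m x y = smul (ksgn (n * k)) (m y x)"
  unfolding gc_algebra_def by blast+

lemma map_deg_mult: "gc_algebra deg m \<Longrightarrow> map_deg deg deg (deg a) (m (bvec a))"
  unfolding map_deg_def using gc_algebra_homog[of deg m _ "bvec a"] homog_bvec[of deg a]
  by (metis add.commute gc_algebra_homog)

definition cumulant_op :: "('a::linorder \<Rightarrow> int) \<Rightarrow> (('a \<Rightarrow>\<^sub>0 'k::comm_ring_1) \<Rightarrow> ('a \<Rightarrow>\<^sub>0 'k) \<Rightarrow> ('a \<Rightarrow>\<^sub>0 'k))
    \<Rightarrow> 'a \<Rightarrow> ('a multiset \<Rightarrow>\<^sub>0 'k) \<Rightarrow> ('a multiset \<Rightarrow>\<^sub>0 'k)" where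
  "cumulant_op deg m a v = lmult deg (bvec a) v + gderiv deg (deg a) (m (bvec a)) v"

definition cumulant :: "('a::linorder \<Rightarrow> int) \<Rightarrow> (('a \<Rightarrow>\<^sub>0 'k::comm_ring_1) \<Rightarrow> ('a \<Rightarrow>\<^sub>0 'k) \<Rightarrow> ('a \<Rightarrow>\<^sub>0 'k))
    \<Rightarrow> ('a multiset \<Rightarrow>\<^sub>0 'k) \<Rightarrow> ('a multiset \<Rightarrow>\<^sub>0 'k)" where
  "cumulant deg m = op_extend (cumulant_op deg m) (bvec {#})"

lemma linear_map_cumulant_op [intro!]: "linear_map (cumulant_op deg m a)"
  unfolding cumulant_op_def by auto

text \<open>Passing \<open>D\<^sub>a\<close> over the letter \<open>b\<close> leaves the extra term
  \<open>(a b) \<and> v\<close>, which is symmetric up to sign because the algebra is graded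
  commutative. Associativity is used in addition for the commutation of \<open>D\<^sub>a\<close>
  with \<open>D\<^sub>b\<close>.\<close>

lemma graded_ops_cumulant_op:
  fixes m :: "('a::linorder \<Rightarrow>\<^sub>0 'k::field_char_0) \<Rightarrow> ('a \<Rightarrow>\<^sub>0 'k) \<Rightarrow> ('a \<Rightarrow>\<^sub>0 'k)"
  assumes "gc_algebra deg m"
  shows "graded_ops deg (cumulant_op deg m)"
proof (rule graded_opsI)
  fix a b and v :: "'a multiset \<Rightarrow>\<^sub>0 'k"
  have ab: "m (bvec a) (bvec b) = smul (ksgn (deg a * deg b)) (m (bvec b) (bvec a))"
    by (rule gc_algebra_commute[OF assms homog_bvec homog_bvec])
  have "m (bvec a) (m (bvec b) x) = smul (ksgn (deg a * deg b)) (m (bvec b) (m (bvec a) x))" for x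
    using ab by (simp flip: gc_algebra_assoc[OF assms] add: linear_map_smul[OF gc_algebra_linear(2)[OF assms]])
  then have DD: "gderiv deg (deg a) (m (bvec a)) (gderiv deg (deg b) (m (bvec b)) v) =
      smul (ksgn (deg a * deg b)) (gderiv deg (deg b) (m (bvec b)) (gderiv deg (deg a) (m (bvec a)) v))"
    using gderiv_commute[OF map_deg_mult[OF assms] gc_algebra_linear(1)[OF assms]
      map_deg_mult[OF assms] gc_algebra_linear(1)[OF assms]] by blast
  have DL: "gderiv deg (deg c) (m (bvec c)) (lmult deg (bvec d) v) =
      lmult deg (m (bvec c) (bvec d)) v +
      smul (ksgn (deg c * deg d)) (lmult deg (bvec d) (gderiv deg (deg c) (m (bvec c)) v))" for c d
    by (rule gderiv_lmult[OF map_deg_mult[OF assms] gc_algebra_linear(1)[OF assms] homog_bvec])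
  have LL: "lmult deg (bvec a) (lmult deg (bvec b) v) =
      smul (ksgn (deg a * deg b)) (lmult deg (bvec b) (lmult deg (bvec a) v))"
    by (rule lmult_commute[OF homog_bvec homog_bvec])
  show "cumulant_op deg m a (cumulant_op deg m b v) =
      smul (ksgn (deg a * deg b)) (cumulant_op deg m b (cumulant_op deg m a v))"
    unfolding cumulant_op_def
    by (simp add: lmult_simps gderiv_simps DL LL DD ab smul_add mult.commute algebra_simps)
qed auto

lemma homog_listprod:
  assumes "gc_algebra deg m" "w \<noteq> []"
  shows "homog deg (sum_list (map deg w)) (listprod m (map bvec w))"
  using assms(2)
proof (induction w rule: induct_list012)
  case (2 a)
  then show ?case using homog_bvec[of deg a] by simp
next
  case (3 a b w)
  then show ?case using gc_algebra_homog[OF assms(1) homog_bvec[of deg a], of _ "listprod m (map bvec (b # w))"] by simp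
qed simp

definition block_term :: "('a::linorder \<Rightarrow> int) \<Rightarrow> (('a \<Rightarrow>\<^sub>0 'k::comm_ring_1) \<Rightarrow> ('a \<Rightarrow>\<^sub>0 'k) \<Rightarrow> ('a \<Rightarrow>\<^sub>0 'k))
    \<Rightarrow> 'a list \<Rightarrow> nat set list \<Rightarrow> ('a multiset \<Rightarrow>\<^sub>0 'k)" where
  "block_term deg m w Bs = smul (perm_sign deg w (concat (map sorted_list_of_set Bs)))
     (wedge deg (map (\<lambda>B. listprod m (map bvec (nths w B))) Bs))"

lemma concat_sorted_list_Suc:
  "(\<And>B. B \<in> set Bs \<Longrightarrow> finite B) \<Longrightarrow>
    concat (map sorted_list_of_set (map ((`) Suc) Bs)) = map Suc (concat (map sorted_list_of_set Bs))"
  by (induction Bs) (auto simp: sorted_list_of_set_Suc)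

lemma sum_list_concat_nths:
  "(\<And>B. B \<in> set Bs \<Longrightarrow> B \<subseteq> {..<length w}) \<Longrightarrow>
    sum_list (map (\<lambda>u. f (w ! u)) (concat (map sorted_list_of_set Bs))) =
    sum_list (map (\<lambda>B. sum_list (map f (nths w B))) Bs)"
  by (induction Bs) (auto simp: sum_list_nths)

lemma nths_not_Nil: "B \<subseteq> {..<length w} \<Longrightarrow> B \<noteq> {} \<Longrightarrow> nths w B \<noteq> []"
  using set_nths[of w B] by fastforce

context
  fixes deg :: "'a::linorder \<Rightarrow> int" and m :: "('a \<Rightarrow>\<^sub>0 'k::field_char_0) \<Rightarrow> ('a \<Rightarrow>\<^sub>0 'k) \<Rightarrow> ('a \<Rightarrow>\<^sub>0 'k)"
  assumes alg: "gc_algebra deg m"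
begin

context
  fixes w :: "'a list" and Bs :: "nat set list" and k :: nat
  assumes Bs: "Bs \<in> odec (length w) k"
begin

text \<open>The words of the blocks have to be nonempty, since \<open>listprod m []\<close> is
  unspecified.\<close>

private lemma block: "B \<in> set Bs \<Longrightarrow> B \<subseteq> {..<length w} \<and> finite B \<and> B \<noteq> {} \<and> nths w B \<noteq> []"
proof -
  assume B: "B \<in> set Bs"
  then have "B \<subseteq> {..<length w}" using Bs unfolding odec_iff by auto
  moreover have "B \<noteq> {}" using Bs B unfolding odec_iff by auto
  ultimately show ?thesis using nths_not_Nil[of B w] finite_subset by auto
qed

private lemma homog_blocks:
  "list_all2 (homog deg) (map (\<lambda>B. sum_list (map deg (nths w B))) Bs)
     (map (\<lambda>B. listprod m (map bvec (nths w B))) Bs)"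
  by (auto simp: list_all2_map1 list_all2_map2 block intro!: list.rel_refl_strong homog_listprod[OF alg])

text \<open>The sign of moving position 0 past the earlier blocks cancels the sign of carrying
  \<open>a\<close> to the front of the wedge product. Hence the result does not depend on
  \<open>j\<close>.\<close>

lemma block_term_insert:
  "block_term deg m (a # w) (odec_insert j Bs) = lmult deg (bvec a) (block_term deg m w Bs)"
proof -
  let ?x = "\<lambda>B. listprod m (map bvec (nths w B))" and ?d = "\<lambda>B. sum_list (map deg (nths w B))"
  let ?us = "take j Bs" and ?vs = "drop j Bs"
  have fin: "B \<in> set ?us \<union> set ?vs \<Longrightarrow> B \<subseteq> {..<length w} \<and> finite B" for B
    using block by (meson UnE in_set_dropD in_set_takeD)
  have "concat (map sorted_list_of_set (odec_insert j Bs)) =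
      map Suc (concat (map sorted_list_of_set ?us)) @ 0 # map Suc (concat (map sorted_list_of_set ?vs))"
    unfolding odec_insert_def map_append list.map concat_append concat.simps
    using fin by (subst (1 2) concat_sorted_list_Suc) auto
  then have "perm_sign deg (a # w) (concat (map sorted_list_of_set (odec_insert j Bs))) =
      (ksgn (deg a * sum_list (map ?d ?us)) * perm_sign deg w (concat (map sorted_list_of_set Bs)) :: 'k)"
    using fin by (simp add: perm_sign_insert_0 sum_list_concat_nths flip: concat_append map_append)
  moreover have "map (\<lambda>B. listprod m (map bvec (nths (a # w) B))) (odec_insert j Bs) =
      map ?x ?us @ bvec a # map ?x ?vs"
    using nths_Suc(2)[of a w "{}"] by (simp add: odec_insert_def o_def nths_Suc)
  moreover have "wedge deg (map ?x ?us @ bvec a # map ?x ?vs) =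
      smul (ksgn (deg a * sum_list (map ?d ?us))) (lmult deg (bvec a) (wedge deg (map ?x ?us @ map ?x ?vs)))"
    using list_all2_takeI[OF homog_blocks, of j]
    by (intro wedge_insert[OF homog_bvec]) (simp add: take_map)
  moreover have "map ?x ?us @ map ?x ?vs = map ?x Bs" by (simp flip: map_append)
  ultimately show ?thesis
    by (simp add: block_term_def lmult_simps mult.commute mult.left_commute)
qed

text \<open>Only the sign of moving position 0 past the earlier blocks is left; it is the sign with
  which a derivation of degree \<open>deg a\<close> reaches factor \<open>j\<close>.\<close>

lemma block_term_join:
  assumes "j < length Bs"
  defines "xs \<equiv> map (\<lambda>B. listprod m (map bvec (nths w B))) Bs"
  shows "block_term deg m (a # w) (odec_join j Bs) =
    smul (ksgn (deg a * sum_list (take j (map (\<lambda>B. sum_list (map deg (nths w B))) Bs))))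
     (smul (perm_sign deg w (concat (map sorted_list_of_set Bs)))
       (wedge deg (xs[j := m (bvec a) (xs ! j)])))"
proof -
  let ?x = "\<lambda>B. listprod m (map bvec (nths w B))" and ?d = "\<lambda>B. sum_list (map deg (nths w B))"
  let ?us = "take j Bs" and ?B = "Bs ! j" and ?vs = "drop (Suc j) Bs"
  have split: "Bs = ?us @ ?B # ?vs" by (rule id_take_nth_drop[OF assms(1)])
  have fin: "B \<in> set ?us \<union> set ?vs \<Longrightarrow> B \<subseteq> {..<length w} \<and> finite B" for B
    using block by (meson UnE in_set_dropD in_set_takeD)
  have B: "finite ?B" "nths w ?B \<noteq> []" using block[OF nth_mem[OF assms(1)]] by auto
  have "concat (map sorted_list_of_set (odec_join j Bs)) =
      map Suc (concat (map sorted_list_of_set ?us)) @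
      0 # map Suc (sorted_list_of_set ?B @ concat (map sorted_list_of_set ?vs))"
    unfolding odec_join_def map_append list.map concat_append concat.simps
    using fin by (subst (1 2) concat_sorted_list_Suc) (auto simp: sorted_list_of_set_Suc[OF B(1)])
  moreover have "concat (map sorted_list_of_set ?us) @ sorted_list_of_set ?B @ concat (map sorted_list_of_set ?vs)
      = concat (map sorted_list_of_set Bs)"
    by (subst (4) split) simp
  ultimately have "perm_sign deg (a # w) (concat (map sorted_list_of_set (odec_join j Bs))) =
      (ksgn (deg a * sum_list (map ?d ?us)) * perm_sign deg w (concat (map sorted_list_of_set Bs)) :: 'k)"
    using fin by (simp only: perm_sign_insert_0) (simp add: sum_list_concat_nths)
  moreover obtain y ys where y: "nths w ?B = y # ys" using B(2) by (cases "nths w ?B") auto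
  have "map (\<lambda>B. listprod m (map bvec (nths (a # w) B))) (odec_join j Bs) =
      map ?x ?us @ m (bvec a) (?x ?B) # map ?x ?vs"
    by (simp add: odec_join_def o_def nths_Suc y)
  moreover have "map ?x ?us @ m (bvec a) (?x ?B) # map ?x ?vs = xs[j := m (bvec a) (xs ! j)]"
    using assms(1) by (simp add: xs_def upd_conv_take_nth_drop take_map drop_map)
  ultimately show ?thesis
    by (simp add: block_term_def take_map)
qed

lemma sum_block_term_join:
  "(\<Sum>j<k. block_term deg m (a # w) (odec_join j Bs)) = gderiv deg (deg a) (m (bvec a)) (block_term deg m w Bs)"
proof -
  have len: "length Bs = k" using Bs by (simp add: odec_iff)
  show ?thesis
    unfolding block_term_def[of deg m w] gderiv_simps
      gderiv_wedge[OF map_deg_mult[OF alg] gc_algebra_linear(1)[OF alg] homog_blocks]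
    by (simp add: block_term_join len smul_sum mult.commute)
qed

end

text \<open>The \<open>Suc k\<close> places for a new block give equal terms, and this factor turns
  \<open>1 / (k + 1)!\<close> into \<open>1 / k!\<close>. The sum starts at \<open>k = 0\<close> to
  account for the unit.\<close>

lemma cumulant_word:
  "foldr (cumulant_op deg m) w (bvec {#}) =
    (\<Sum>k\<le>length w. smul (inverse (fact k)) (\<Sum>Bs\<in>odec (length w) k. block_term deg m w Bs))"
proof (induction w)
  case Nil
  then show ?case by (simp add: odec_zero block_term_def wedge_Nil perm_sign_eq)
next
  case (Cons a w)
  let ?n = "length w" and ?L = "lmult deg (bvec a)" and ?D = "gderiv deg (deg a) (m (bvec a))"
  let ?T = "\<lambda>k. \<Sum>Bs\<in>odec ?n k. block_term deg m w Bs"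
  have step: "(\<Sum>Bs\<in>odec (Suc ?n) (Suc k). block_term deg m (a # w) Bs) =
      smul (of_nat (Suc k)) (?L (?T k)) + ?D (?T (Suc k))" for k
  proof -
    have const: "(\<Sum>j<Suc k. v) = smul (of_nat (Suc k)) v" for v :: "'a multiset \<Rightarrow>\<^sub>0 'k"
      using sum_smul_left[of "\<lambda>_. 1" "{..<Suc k}" v] by simp
    show ?thesis
      by (simp add: sum_odec_Suc block_term_insert sum_block_term_join const
          linear_map_sum[OF linear_map_lmult] linear_map_sum[OF linear_map_gderiv]
          del: sum.lessThan_Suc of_nat_Suc sum_constant)
  qed
  have inv: "inverse (fact (Suc k)) * of_nat (Suc k) = (inverse (fact k) :: 'k)" for k
    by (simp add: field_simps del: of_nat_Suc)
  \<comment> \<open>Index shift: the term \<open>k = 0\<close> vanishes because a derivation kills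
    the unit and a nonempty word has no decomposition into zero blocks; the added top term has more
    blocks than letters.\<close>
  have T0: "?D (\<Sum>k\<le>?n. smul (inverse (fact k)) (?T k)) =
     (\<Sum>k\<le>?n. smul (inverse (fact (Suc k))) (?D (?T (Suc k))))"
  proof -
    have D0: "?D (?T 0) = 0"
    proof (cases w)
      case Nil
      then show ?thesis by (simp add: odec_zero block_term_def wedge_Nil gderiv_simps gderiv_unit)
    next
      case (Cons b u)
      then show ?thesis by (simp add: odec_Suc_0 gderiv_simps)
    qed
    have "?D (\<Sum>k\<le>?n. smul (inverse (fact k)) (?T k)) = (\<Sum>k\<le>?n. smul (inverse (fact k)) (?D (?T k)))"
      by (simp add: linear_map_sum[OF linear_map_gderiv, of _ _ _ "\<lambda>k. smul (inverse (fact k)) (?T k)"] gderiv_simps)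
    also have "\<dots> = (\<Sum>k\<le>Suc ?n. smul (inverse (fact k)) (?D (?T k)))"
      by (simp add: odec_empty gderiv_simps)
    also have "\<dots> = smul (inverse (fact 0)) (?D (?T 0)) +
        (\<Sum>k\<le>?n. smul (inverse (fact (Suc k))) (?D (?T (Suc k))))"
      by (rule sum.atMost_Suc_shift)
    finally show ?thesis using D0 by simp
  qed
  have "(\<Sum>k\<le>length (a # w). smul (inverse (fact k)) (\<Sum>Bs\<in>odec (length (a # w)) k. block_term deg m (a # w) Bs)) =
     (\<Sum>k\<le>?n. smul (inverse (fact (Suc k))) (\<Sum>Bs\<in>odec (Suc ?n) (Suc k). block_term deg m (a # w) Bs))"
    by (simp add: sum.atMost_Suc_shift odec_Suc_0 del: sum.atMost_Suc fact_Suc)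
  also have "\<dots> = (\<Sum>k\<le>?n. ?L (smul (inverse (fact k)) (?T k))) +
      (\<Sum>k\<le>?n. smul (inverse (fact (Suc k))) (?D (?T (Suc k))))"
    by (simp add: step smul_add sum.distrib inv lmult_simps(2) del: fact_Suc of_nat_Suc)
  also have "\<dots> = cumulant_op deg m a (\<Sum>k\<le>?n. smul (inverse (fact k)) (?T k))"
    unfolding cumulant_op_def T0 by (simp add: linear_map_sum[OF linear_map_lmult, symmetric])
  finally show ?case using Cons by simp
qed

text \<open>Restricted to \<open>SV\<close> because the maps differ at the unit:
  \<open>tau_tilde\<close> sends it to 0 and \<open>cumulant\<close> fixes it.\<close>

lemma tau_tilde_eq_cumulant:
  assumes "v \<in> SV deg"
  shows "tau_tilde deg m v = cumulant deg m v"
proof (rule SV_linear_eqI[OF assms])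
  show "linear_map (tau_tilde deg m)" "linear_map (cumulant deg m)"
    by (auto simp: tau_tilde_def ext_eq_lin cumulant_def)
  fix M assume M: "valid_mon deg M"
  define w where "w = sorted_list_of_multiset M"
  have "mset w = M" by (simp add: w_def)
  then obtain n where n: "length w = Suc n" using M by (cases w) (auto simp: valid_mon_iff)
  have "cumulant deg m (bvec M) =
      (\<Sum>k\<le>length w. smul (inverse (fact k)) (\<Sum>Bs\<in>odec (length w) k. block_term deg m w Bs))"
    by (simp add: cumulant_def op_extend_bvec cumulant_word w_def)
  also have "\<dots> = (\<Sum>k\<in>{1..length w}. smul (inverse (fact k)) (\<Sum>Bs\<in>odec (length w) k. block_term deg m w Bs))"
  proof (rule sum.mono_neutral_right)
    show "\<forall>k\<in>{..length w} - {1..length w}.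
        smul (inverse (fact k)) (\<Sum>Bs\<in>odec (length w) k. block_term deg m w Bs) = 0"
    proof
      fix k assume "k \<in> {..length w} - {1..length w}"
      then have "k = 0" by auto
      then show "smul (inverse (fact k)) (\<Sum>Bs\<in>odec (length w) k. block_term deg m w Bs) = 0"
        by (simp add: n odec_Suc_0)
    qed
  qed auto
  also have "\<dots> = tau_tilde deg m (bvec M)"
    by (simp add: tau_tilde_def ext_eq_lin Let_def block_term_def w_def)
  finally show "tau_tilde deg m (bvec M) = cumulant deg m (bvec M)" ..
qed

end

subsection \<open>Coalgebra morphisms\<close>

lemma keys_tens:
  fixes x :: "'a \<Rightarrow>\<^sub>0 'k::comm_ring_1"
  shows "Poly_Mapping.keys (tens x y) \<subseteq> Poly_Mapping.keys x \<times> Poly_Mapping.keys y"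
proof -
  have "Poly_Mapping.keys (tens x y) \<subseteq>
      (\<Union>M\<in>Poly_Mapping.keys x. \<Union>N\<in>Poly_Mapping.keys y. Poly_Mapping.keys (bvec (M, N) :: _ \<Rightarrow>\<^sub>0 'k))"
    unfolding tens_eq_lin by (rule order_trans[OF keys_lin]) (intro UN_mono order_refl keys_lin)
  then show ?thesis by (auto simp: keys_bvec)
qed

lemma keys_mono: "K \<in> Poly_Mapping.keys (mono deg w) \<Longrightarrow> K = mset w \<and> valid deg K"
  using keys_smul[of "ksgn (int (odd_inversions deg w))" "bvec (mset w)"]
  by (auto simp: mono_eq odd_repetition_valid keys_bvec split: if_splits)

text \<open>As both factors are nonempty, each is strictly smaller than \<open>M\<close>, which
  permits induction on the size.\<close>

lemma keys_coprod_bvec: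
  assumes "(P, Q) \<in> Poly_Mapping.keys (coprod deg (bvec M) :: _ \<Rightarrow>\<^sub>0 'k::comm_ring_1)"
  shows "valid_mon deg P \<and> valid_mon deg Q \<and> size P + size Q = size M"
proof -
  define w where "w = sorted_list_of_multiset M"
  let ?R = "{S. S \<subseteq> {..<length w} \<and> S \<noteq> {} \<and> S \<noteq> {..<length w}}"
  have "coprod deg (bvec M) = (\<Sum>S\<in>?R. coprod_term deg w S :: _ \<Rightarrow>\<^sub>0 'k)"
    by (simp add: coprod_def ext_eq_lin Let_def coprod_term_def w_def)
  then obtain S where S: "S \<in> ?R" "(P, Q) \<in> Poly_Mapping.keys (coprod_term deg w S :: _ \<Rightarrow>\<^sub>0 'k)"
    using assms Poly_Mapping.keys_sum[of "coprod_term deg w :: _ \<Rightarrow> _ \<Rightarrow>\<^sub>0 'k" ?R] by auto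
  let ?u = "nths w S" and ?v = "nths w ({..<length w} - S)"
  have "(P, Q) \<in> Poly_Mapping.keys (tens (mono deg ?u) (mono deg ?v) :: _ \<Rightarrow>\<^sub>0 'k)"
    using S(2) unfolding coprod_term_def by (rule subsetD[OF keys_smul])
  then have PQ: "P = mset ?u" "valid deg P" "Q = mset ?v" "valid deg Q"
    by (auto dest!: subsetD[OF keys_tens] keys_mono)
  have "{..<length w} - S \<noteq> {}" using S(1) by auto
  then have "?u \<noteq> []" "?v \<noteq> []"
    using S(1) nths_not_Nil[of S w] nths_not_Nil[of "{..<length w} - S" w] by auto
  moreover have "length ?u + length ?v = length w"
  proof -
    have "length ?u + length ?v = card ({i. i < length w \<and> i \<in> S} \<union> {i. i < length w \<and> i \<in> {..<length w} - S})"
      unfolding length_nths by (rule card_Un_disjoint[symmetric]) auto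
    also have "{i. i < length w \<and> i \<in> S} \<union> {i. i < length w \<and> i \<in> {..<length w} - S} = {..<length w}" by auto
    finally show ?thesis by simp
  qed
  moreover have "size M = length w" unfolding w_def by (metis mset_sorted_list_of_multiset size_mset)
  ultimately show ?thesis using PQ by (auto simp: valid_mon_iff)
qed

lemma keys_coprod:
  assumes "(P, Q) \<in> Poly_Mapping.keys (coprod deg v :: _ \<Rightarrow>\<^sub>0 'k::comm_ring_1)"
  shows "valid_mon deg P \<and> valid_mon deg Q"
proof -
  have "coprod deg v = lin (\<lambda>M. coprod deg (bvec M)) v"
    by (rule linear_map_lin_bvec[OF linear_map_coprod])
  then show ?thesis
    using assms keys_lin[of "\<lambda>M. coprod deg (bvec M)" v] keys_coprod_bvec by fastforce
qed

text \<open>A coproduct involves only valid nonempty monomials, so \<open>tensmap\<close> evaluates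
  its maps inside \<open>SV\<close>.\<close>

lemma coalg_morph_cong:
  assumes "\<And>v. v \<in> SV degA \<Longrightarrow> F v = G v" "coalg_morph degA degB F"
  shows "coalg_morph degA degB G"
proof -
  have "tensmap degA 0 F F (coprod degA v) = tensmap degA 0 G G (coprod degA v)" for v
    unfolding tensmap_eq_lin
  proof (rule lin_cong)
    fix x assume x: "x \<in> Poly_Mapping.keys (coprod degA v)"
    obtain P Q where PQ: "x = (P, Q)" by (cases x)
    show "(case x of (M, N) \<Rightarrow> smul (ksgn (0 * tdeg degA M)) (tens (F (bvec M)) (F (bvec N)))) =
       (case x of (M, N) \<Rightarrow> smul (ksgn (0 * tdeg degA M)) (tens (G (bvec M)) (G (bvec N))))"
      using keys_coprod[OF x[unfolded PQ]] assms(1) by (simp add: PQ SV_bvec)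
  qed
  then show ?thesis
    using assms(2) unfolding coalg_morph_def by (simp add: assms(1)[symmetric] SV_add SV_smul)
qed

lemma coalg_morph_comp:
  assumes "coalg_morph degA degB F" "coalg_morph degB degC G" "linear_map G"
  shows "coalg_morph degA degC (\<lambda>v. G (F v))"
proof -
  have "tensmap degB 0 G G (tensmap degA 0 F F x) = tensmap degA 0 (\<lambda>v. G (F v)) (\<lambda>v. G (F v)) x" for x
    using tensmap_comp[OF assms(3,3), of 0 degA degB 0 F] by simp
  then show ?thesis using assms(1,2) unfolding coalg_morph_def by simp
qed

text \<open>The map fixes the unit, so the terms subtracted from the full coproduct on both sides
  correspond.\<close>

lemma coalg_morph_op_extend:
  fixes P :: "'a::linorder \<Rightarrow> ('b::linorder multiset \<Rightarrow>\<^sub>0 'k::field_char_0) \<Rightarrow> ('b multiset \<Rightarrow>\<^sub>0 'k)"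
  assumes P: "graded_ops degA P" and deg: "\<And>a. smap_deg degB degB (degA a) (P a)"
    and cop: "\<And>a v. full_coprod degB (P a v) = prim_ext degB (degA a) (P a) (full_coprod degB v)"
    and SV: "\<And>a v. P a v \<in> SV degB"
  shows "coalg_morph degA degB (op_extend P (bvec {#}))"
proof -
  let ?F = "op_extend P (bvec {#})"
  have lin: "linear_map ?F" by auto
  have range: "?F v \<in> SV degB" if "v \<in> SV degA" for v
  proof (rule SV_linear_image[OF that lin])
    fix M assume M: "valid_mon degA M"
    have "mset (sorted_list_of_multiset M) = M" by simp
    then have "sorted_list_of_multiset M \<noteq> []" using M by (auto simp: valid_mon_iff simp del: mset_sorted_list_of_multiset)
    then show "?F (bvec M) \<in> SV degB" unfolding op_extend_bvec by (cases "sorted_list_of_multiset M") (auto simp: SV)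
  qed
  have "coprod degB (?F v) = tensmap degA 0 ?F ?F (coprod degA v)" if "v \<in> SV degA" for v
    using spec[OF full_coprod_op_extend[OF P deg cop], of v]
    by (simp add: coprod_eq_full_coprod[OF range[OF that]] coprod_eq_full_coprod[OF that]
        linear_map_diff[OF linear_map_tensmap] tensmap_0_tens[OF lin lin] op_extend_unit)
  moreover have "shomog degB n (?F v)" if "shomog degA n v" for n v
    using smap_degD[OF smap_deg_op_extend[OF P deg] lin that] by simp
  ultimately show ?thesis
    unfolding coalg_morph_def using range by (simp add: linear_map_add[OF lin] linear_map_smul[OF lin])
qed

lemma coalg_morph_cumulant:
  fixes m :: "('a::linorder \<Rightarrow>\<^sub>0 'k::field_char_0) \<Rightarrow> ('a \<Rightarrow>\<^sub>0 'k) \<Rightarrow> ('a \<Rightarrow>\<^sub>0 'k)"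
  assumes "gc_algebra deg m"
  shows "coalg_morph deg deg (cumulant deg m)"
  unfolding cumulant_def
proof (rule coalg_morph_op_extend[OF graded_ops_cumulant_op[OF assms]])
  fix a and v :: "'a multiset \<Rightarrow>\<^sub>0 'k"
  show "smap_deg deg deg (deg a) (cumulant_op deg m a)"
    unfolding cumulant_op_def
    by (intro smap_deg_add smap_deg_lmult homog_bvec smap_deg_gderiv map_deg_mult assms)
  show "cumulant_op deg m a v \<in> SV deg"
    unfolding cumulant_op_def by (intro SV_add SV_lmult SV_gderiv)
  show "full_coprod deg (cumulant_op deg m a v) = prim_ext deg (deg a) (cumulant_op deg m a) (full_coprod deg v)"
    using spec[OF full_coprod_gderiv[OF map_deg_mult[OF assms] gc_algebra_linear(1)[OF assms]], of a v]
    by (simp add: cumulant_op_def[abs_def] linear_map_add[OF linear_map_full_coprod] full_coprod_lmult[OF homog_bvec]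
        prim_ext_def tensmap_add_left tensmap_add_right algebra_simps)
qed

section \<open>Extensions of linear maps as derivations and coalgebra morphisms\<close>

lemma coder_ext_eq_gderiv:
  fixes f :: "('a::linorder \<Rightarrow>\<^sub>0 'k::field_char_0) \<Rightarrow> ('a \<Rightarrow>\<^sub>0 'k)"
  assumes "map_deg deg deg (-1) f" "linear_map f"
  shows "\<forall>v. coder_ext deg f v = gderiv deg (-1) f v"
proof (rule linear_ext)
  show "linear_map (coder_ext deg f)" by (auto simp: coder_ext_def ext_eq_lin)
  fix M :: "'a multiset"
  let ?w = "sorted_list_of_multiset M"
  have hom: "list_all2 (homog deg) (map deg ?w) (map bvec ?w :: (_ \<Rightarrow>\<^sub>0 'k) list)"
    by (auto simp: list_all2_map1 list_all2_map2 homog_bvec intro!: list.rel_refl_strong)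
  \<comment> \<open>For \<open>M\<close> with a repeated odd letter the wedge product is 0 while
    \<open>bvec M\<close> is not; still both sides equal \<open>gderiv_word\<close> of the sorted
    word.\<close>
  have "gderiv deg (-1) f (bvec M) = gderiv deg (-1) f (wedge deg (map bvec ?w))"
    unfolding wedge_map_bvec gderiv_mono[OF assms(1)] by (simp add: gderiv_def sym_extend_bvec)
  also have "\<dots> = (\<Sum>j<length ?w. smul (ksgn (sum_list (map deg (take j ?w))))
      (wedge deg ((map bvec ?w)[j := f (bvec (?w ! j))])))"
    unfolding gderiv_wedge[OF assms hom] length_map
  proof (rule sum.cong[OF refl])
    fix j assume "j \<in> {..<length ?w}"
    moreover have "ksgn (- 1 * sum_list (take j (map deg ?w))) = (ksgn (sum_list (map deg (take j ?w))) :: 'k)"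
      unfolding take_map by (rule ksgn_diff_even) simp
    ultimately show "smul (ksgn (- 1 * sum_list (take j (map deg ?w))))
        (wedge deg ((map bvec ?w)[j := f (map bvec ?w ! j)])) =
      smul (ksgn (sum_list (map deg (take j ?w)))) (wedge deg ((map bvec ?w)[j := f (bvec (?w ! j))]))"
      by simp
  qed
  also have "\<dots> = coder_ext deg f (bvec M)"
    by (simp add: coder_ext_def ext_eq_lin Let_def)
  finally show "coder_ext deg f (bvec M) = gderiv deg (-1) f (bvec M)" ..
qed auto

context
  fixes degA :: "'a::linorder \<Rightarrow> int" and degB :: "'b::linorder \<Rightarrow> int"
    and g :: "('a \<Rightarrow>\<^sub>0 'k::field_char_0) \<Rightarrow> ('b \<Rightarrow>\<^sub>0 'k)"
  assumes g: "linear_map g" "map_deg degA degB 0 g"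
begin

lemma coalg_ext_eq_op_extend: "coalg_ext degB g = op_extend (\<lambda>a. lmult degB (g (bvec a))) (bvec {#})"
proof -
  have "wedge degB (map (\<lambda>b. g (bvec b)) w) = foldr (\<lambda>a. lmult degB (g (bvec a))) w (bvec {#})" for w
    by (induction w) (auto simp: wedge_Nil wedge_Cons)
  then show ?thesis by (simp add: coalg_ext_def ext_eq_lin op_extend_def sym_extend_def)
qed

lemma homog_image_bvec: "homog degB (degA a) (g (bvec a))"
  using map_degD[OF g(2) homog_bvec[of degA a]] by simp

lemma graded_ops_coalg_ext: "graded_ops degA (\<lambda>a. lmult degB (g (bvec a)))"
  by (rule graded_opsI) (auto intro!: lmult_commute homog_image_bvec)

lemma coalg_morph_coalg_ext: "coalg_morph degA degB (coalg_ext degB g)"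
  unfolding coalg_ext_eq_op_extend
  by (rule coalg_morph_op_extend[OF graded_ops_coalg_ext])
    (auto intro!: smap_deg_lmult homog_image_bvec full_coprod_lmult SV_lmult)

lemma linear_map_coalg_ext: "linear_map (coalg_ext degB g)"
  by (auto simp: coalg_ext_eq_op_extend)

lemma coalg_ext_unit: "coalg_ext degB g (bvec {#}) = bvec {#}"
  by (simp add: coalg_ext_eq_op_extend op_extend_unit)

lemma coalg_ext_lmult: "\<forall>x. coalg_ext degB g (lmult degA x v) = lmult degB (g x) (coalg_ext degB g v)"
proof (rule linear_ext)
  fix a
  show "coalg_ext degB g (lmult degA (bvec a) v) = lmult degB (g (bvec a)) (coalg_ext degB g v)"
    unfolding coalg_ext_eq_op_extend using op_extend_lmult[OF graded_ops_coalg_ext] by blast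
qed (auto intro!: linear_map_comp[OF linear_map_coalg_ext] linear_map_comp[OF linear_map_lmult_left g(1)])

text \<open>Both sides obey the same Leibniz rule along \<open>coalg_ext degB g\<close> and agree on
  letters by \<open>chain\<close>; no sign changes because \<open>g\<close> preserves
  degrees.\<close>

lemma coalg_ext_gderiv:
  assumes f: "map_deg degA degA p f" "linear_map f" and h: "map_deg degB degB p h" "linear_map h"
    and chain: "\<And>x. g (f x) = h (g x)"
  shows "\<forall>v. coalg_ext degB g (gderiv degA p f v) = gderiv degB p h (coalg_ext degB g v)"
proof (rule mono_linear_eqI[where deg = degA])
  fix w
  show "coalg_ext degB g (gderiv degA p f (mono degA w)) = gderiv degB p h (coalg_ext degB g (mono degA w))"
  proof (induction w)
    case Nil
    show ?case by (simp add: mono_Nil gderiv_unit coalg_ext_unit linear_map_0[OF linear_map_coalg_ext])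
  next
    case (Cons a w)
    then show ?case
      by (simp add: gderiv_lmult[OF f homog_bvec] gderiv_lmult[OF h homog_image_bvec] chain coalg_ext_lmult
          linear_map_add[OF linear_map_coalg_ext] linear_map_smul[OF linear_map_coalg_ext] flip: lmult_mono)
  qed
next
  fix M assume M: "\<not> valid degA M"
  have "coalg_ext degB g (bvec M) = 0"
    unfolding coalg_ext_eq_op_extend by (rule op_extend_not_valid[OF graded_ops_coalg_ext M])
  then show "coalg_ext degB g (gderiv degA p f (bvec M)) = gderiv degB p h (coalg_ext degB g (bvec M))"
    by (simp add: gderiv_not_valid[OF f(1) M] gderiv_simps linear_map_0[OF linear_map_coalg_ext])
qed (auto intro!: linear_map_comp[OF linear_map_coalg_ext] linear_map_comp[OF linear_map_gderiv] linear_map_coalg_ext)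

end

subsection \<open>Bijectivity of coalgebra endomorphisms\<close>

text \<open>The product of the full symmetric algebra as a linear map on its tensor square.\<close>

definition mult_map :: "('a::linorder \<Rightarrow> int) \<Rightarrow> ('a multiset \<times> 'a multiset \<Rightarrow>\<^sub>0 'k::comm_ring_1) \<Rightarrow> ('a multiset \<Rightarrow>\<^sub>0 'k)" where
  "mult_map deg = lin (\<lambda>(M, N). foldr (\<lambda>a. lmult deg (bvec a)) (sorted_list_of_multiset M) (bvec N))"

lemma linear_map_mult_map [intro!]: "linear_map (mult_map deg)"
  by (auto simp: mult_map_def)

lemma linear_map_foldr: "(\<And>a. linear_map (P a)) \<Longrightarrow> linear_map (foldr P w)"
  by (induction w) (auto simp: linear_map_def)

lemma graded_ops_lmult: "graded_ops deg (\<lambda>a. lmult deg (bvec a :: _ \<Rightarrow>\<^sub>0 'k::field_char_0))"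
  by (rule graded_opsI) (auto intro!: lmult_commute homog_bvec)

lemma mult_map_tens_bvec_left:
  "\<forall>v. mult_map deg (tens (bvec M) v) = foldr (\<lambda>a. lmult deg (bvec a)) (sorted_list_of_multiset M) v"
  by (rule linear_ext)
    (auto simp: mult_map_def intro!: linear_map_comp[OF linear_map_lin linear_map_tens_right] linear_map_foldr)

lemma mult_map_tens_bvec_right:
  "\<forall>u. mult_map deg (tens u (bvec N)) = op_extend (\<lambda>a. lmult deg (bvec a)) (bvec N) u"
  by (rule linear_ext)
    (auto simp: mult_map_def op_extend_bvec intro!: linear_map_comp[OF linear_map_lin linear_map_tens_left])

lemma foldr_lmult_commute:
  fixes v :: "_ \<Rightarrow>\<^sub>0 'k::field_char_0"
  shows "foldr (\<lambda>a. lmult deg (bvec a)) w (lmult deg (bvec c) v) =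
    smul (ksgn (deg c * sum_list (map deg w))) (lmult deg (bvec c) (foldr (\<lambda>a. lmult deg (bvec a)) w v))"
proof (induction w)
  case Nil
  then show ?case by simp
next
  case (Cons a w)
  then show ?case
    using lmult_commute[OF homog_bvec[of deg a] homog_bvec[of deg c],
        of "foldr (\<lambda>a. lmult deg (bvec a)) w v"]
    by (simp add: lmult_simps ksgn_add distrib_left mult.commute)
qed

text \<open>A letter placed in the right factor returns to the front past \<open>M\<close>, and the
  sign for this cancels the one in \<open>prim_ext\<close>. So both summands have the same product,
  whence the 2.\<close>

lemma mult_map_prim_ext:
  "\<forall>x. mult_map deg (prim_ext deg (deg a) (lmult deg (bvec a)) x) =
    smul 2 (lmult deg (bvec a) (mult_map deg x :: _ \<Rightarrow>\<^sub>0 'k::field_char_0))"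
proof (rule linear_ext)
  fix x :: "'a multiset \<times> 'a multiset"
  obtain M N where x: "x = (M, N)" by (cases x)
  have L: "mult_map deg (tens (lmult deg (bvec a) (bvec M)) (bvec N)) =
      (lmult deg (bvec a) (mult_map deg (bvec (M, N))) :: _ \<Rightarrow>\<^sub>0 'k)"
    using mult_map_tens_bvec_right[of deg N] op_extend_lmult[OF graded_ops_lmult, of deg "bvec N :: _ \<Rightarrow>\<^sub>0 'k" a]
    by (metis tens_bvec)
  have R: "mult_map deg (tens (bvec M) (lmult deg (bvec a) (bvec N))) =
      smul (ksgn (deg a * tdeg deg M)) (lmult deg (bvec a) (mult_map deg (bvec (M, N))) :: _ \<Rightarrow>\<^sub>0 'k)"
    unfolding mult_map_tens_bvec_left[rule_format] foldr_lmult_commute tdeg_sorted_list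
    by (simp add: mult_map_def)
  have two: "smul 2 v = v + v" for v :: "'a multiset \<Rightarrow>\<^sub>0 'k"
    using smul_add_left[of 1 1 v] by simp
  show "mult_map deg (prim_ext deg (deg a) (lmult deg (bvec a)) (bvec x)) =
    smul 2 (lmult deg (bvec a) (mult_map deg (bvec x) :: _ \<Rightarrow>\<^sub>0 'k))"
    by (simp add: x prim_ext_def tensmap_bvec L R linear_map_add[OF linear_map_mult_map]
        linear_map_smul[OF linear_map_mult_map] two)
qed (auto intro!: linear_map_comp[OF linear_map_mult_map] linear_map_comp[OF linear_map_lmult])

lemma mult_map_full_coprod:
  "mult_map deg (full_coprod deg (mono deg w)) = smul (2 ^ length w) (mono deg w :: _ \<Rightarrow>\<^sub>0 'k::field_char_0)"
proof (induction w)
  case Nil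
  then show ?case by (simp add: mono_Nil full_coprod_unit mult_map_def)
next
  case (Cons a w)
  then show ?case
    by (simp add: full_coprod_lmult[OF homog_bvec] mult_map_prim_ext lmult_simps flip: lmult_mono)
qed

text \<open>Each letter contributes a factor 2, and the two terms removed from the full coproduct
  both multiply to the monomial itself.\<close>

lemma mult_map_coprod:
  fixes v :: "'a::linorder multiset \<Rightarrow>\<^sub>0 'k::field_char_0"
  assumes "v \<in> SV deg"
  shows "mult_map deg (coprod deg v) = lin (\<lambda>M. smul (2 ^ size M - 2) (bvec M)) v"
proof (rule SV_linear_eqI[OF assms])
  fix M :: "'a multiset" assume M: "valid_mon deg M"
  let ?w = "sorted_list_of_multiset M"
  have minus2: "smul (c - 2) v = smul c v - v - v" for c and v :: "'a multiset \<Rightarrow>\<^sub>0 'k"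
    by (rule poly_mapping_eqI) (simp only: lookup_smul lookup_minus left_diff_distrib mult_2 diff_diff_eq lookup_add)
  have w: "mono deg ?w = (bvec M :: _ \<Rightarrow>\<^sub>0 'k)" using M by (simp add: valid_mon_iff mono_sorted_list)
  have len: "length ?w = size M" by (metis mset_sorted_list_of_multiset size_mset)
  have "foldr (\<lambda>a. lmult deg (bvec a)) w (bvec {#}) = (mono deg w :: _ \<Rightarrow>\<^sub>0 'k)" for w
    by (induction w) (auto simp: mono_Nil lmult_mono)
  then have "mult_map deg (bvec (M, {#})) = (bvec M :: _ \<Rightarrow>\<^sub>0 'k)" "mult_map deg (bvec ({#}, M)) = (bvec M :: _ \<Rightarrow>\<^sub>0 'k)"
    using w by (simp_all add: mult_map_def)
  then show "mult_map deg (coprod deg (bvec M)) = lin (\<lambda>M. smul (2 ^ size M - 2) (bvec M :: _ \<Rightarrow>\<^sub>0 'k)) (bvec M)"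
    using mult_map_full_coprod[of deg ?w, where 'k = 'k]
    by (simp add: coprod_eq_full_coprod[OF SV_bvec[OF M]] linear_map_diff[OF linear_map_mult_map] w len minus2)
qed (auto intro!: linear_map_comp[OF linear_map_mult_map])

section \<open>The filtration by word length\<close>

definition size_le :: "nat \<Rightarrow> ('a multiset \<Rightarrow>\<^sub>0 'k::zero) \<Rightarrow> bool" where
  "size_le n v \<longleftrightarrow> (\<forall>M\<in>Poly_Mapping.keys v. size M \<le> n)"

lemma size_le_add: "size_le n u \<Longrightarrow> size_le n v \<Longrightarrow> size_le n (u + v)"
  using Poly_Mapping.keys_add[of u v] by (auto simp: size_le_def)

lemma size_le_lin: "(\<And>x. x \<in> Poly_Mapping.keys v \<Longrightarrow> size_le n (F x)) \<Longrightarrow> size_le n (lin F v)"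
  using keys_lin[of F v] by (fastforce simp: size_le_def)

lemma size_le_uminus: "size_le n (- v) \<longleftrightarrow> size_le n v"
  by (simp add: size_le_def)

lemma size_le_mono: "size_le n v \<Longrightarrow> n \<le> n' \<Longrightarrow> size_le n' v"
  by (auto simp: size_le_def)

lemma size_le_bvec: "size_le (size M) (bvec M :: _ \<Rightarrow>\<^sub>0 'k::comm_ring_1)"
  by (simp add: size_le_def keys_bvec)

lemma size_le_exists: "\<exists>n. size_le n v"
  using finite_nat_set_iff_bounded_le[of "size ` Poly_Mapping.keys v"] by (auto simp: size_le_def)

lemma size_le_lmult:
  assumes "size_le n v"
  shows "size_le (Suc n) (lmult deg (bvec a) v)"
  unfolding lmult_def lin_bvec sym_extend_def
proof (rule size_le_lin)
  fix M assume "M \<in> Poly_Mapping.keys v"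
  then have "size M \<le> n" using assms by (auto simp: size_le_def)
  moreover have "length (sorted_list_of_multiset M) = size M" by (metis mset_sorted_list_of_multiset size_mset)
  ultimately show "size_le (Suc n) (mono deg (a # sorted_list_of_multiset M))"
    by (auto simp: size_le_def dest!: keys_mono)
qed

lemma size_le_mult_map:
  assumes "\<And>M N. (M, N) \<in> Poly_Mapping.keys x \<Longrightarrow> size M + size N \<le> n"
  shows "size_le n (mult_map deg (x :: _ \<Rightarrow>\<^sub>0 'k::comm_ring_1))"
  unfolding mult_map_def
proof (rule size_le_lin)
  fix y assume y: "y \<in> Poly_Mapping.keys x"
  obtain M N where MN: "y = (M, N)" by (cases y)
  have "size_le (length w + size N) (foldr (\<lambda>a. lmult deg (bvec a)) w (bvec N :: _ \<Rightarrow>\<^sub>0 'k))" for w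
    by (induction w) (auto simp: size_le_bvec intro: size_le_lmult)
  moreover have "length (sorted_list_of_multiset M) = size M" by (metis mset_sorted_list_of_multiset size_mset)
  ultimately have "size_le (size M + size N)
      (foldr (\<lambda>a. lmult deg (bvec a)) (sorted_list_of_multiset M) (bvec N :: _ \<Rightarrow>\<^sub>0 'k))"
    by metis
  then show "size_le n (case y of (M, N) \<Rightarrow> foldr (\<lambda>a. lmult deg (bvec a)) (sorted_list_of_multiset M) (bvec N :: _ \<Rightarrow>\<^sub>0 'k))"
    using assms y by (auto simp: MN intro: size_le_mono)
qed

text \<open>The multiplication composed with the reduced coproduct scales monomials of size \<open>n\<close> by
  \<open>2\<^sup>n - 2\<close>, so the reduced coproduct detects the size of every monomial of size at least two.\<close>

lemma size_le_coprodD: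
  fixes u :: "'a::linorder multiset \<Rightarrow>\<^sub>0 'k::field_char_0"
  assumes "u \<in> SV deg" "1 \<le> n" "\<And>M N. (M, N) \<in> Poly_Mapping.keys (coprod deg u) \<Longrightarrow> size M + size N \<le> n"
  shows "size_le n u"
  unfolding size_le_def
proof
  fix K assume K: "K \<in> Poly_Mapping.keys u"
  show "size K \<le> n"
  proof (rule ccontr)
    assume big: "\<not> size K \<le> n"
    have "Poly_Mapping.lookup (mult_map deg (coprod deg u)) K =
        (\<Sum>M\<in>Poly_Mapping.keys u. if M = K then Poly_Mapping.lookup u M * (2 ^ size M - 2) else 0)"
      unfolding mult_map_coprod[OF assms(1)] lin_def lookup_sum
      by (intro sum.cong) (auto simp: bvec_def lookup_single)
    also have "\<dots> = Poly_Mapping.lookup u K * (2 ^ size K - 2)"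
      using K by simp
    finally have lookup: "Poly_Mapping.lookup (mult_map deg (coprod deg u)) K = Poly_Mapping.lookup u K * (2 ^ size K - 2)" .
    \<comment> \<open>Here \<open>1 \<le> n\<close> is used: it makes \<open>size K\<close> at least
      two, so the factor \<open>2 ^ size K - 2\<close> is nonzero.\<close>
    have "(2::nat) ^ 1 < 2 ^ size K" using big assms(2) by (intro power_strict_increasing) auto
    then have "of_nat (2 ^ size K) \<noteq> (of_nat 2 :: 'k)" unfolding of_nat_eq_iff by simp
    then have "K \<in> Poly_Mapping.keys (mult_map deg (coprod deg u))"
      using K lookup by (simp add: in_keys_iff)
    then show False
      using size_le_mult_map[OF assms(3), where deg = deg] big by (auto simp: size_le_def)
  qed
qed

text \<open>\<open>coalg_morph\<close> provides linearity on \<open>SV\<close> only; this yields a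
  map that is linear everywhere and agrees with \<open>T\<close> on \<open>SV\<close>.\<close>

lemma coalg_morph_linear_eq:
  fixes T :: "('a::linorder multiset \<Rightarrow>\<^sub>0 'k::comm_ring_1) \<Rightarrow> ('b::linorder multiset \<Rightarrow>\<^sub>0 'k)"
  assumes "coalg_morph degA degB T" "v \<in> SV degA"
  shows "T v = lin (\<lambda>M. T (bvec M)) v"
proof -
  note T = assms(1)[unfolded coalg_morph_def]
  have T0: "T 0 = 0" using T SV_0 smul_simps(2) by metis
  have "T (\<Sum>M\<in>A. smul (c M) (bvec M)) = (\<Sum>M\<in>A. smul (c M) (T (bvec M)))"
    if "finite A" "\<And>M. M \<in> A \<Longrightarrow> valid_mon degA M" for A c
    using that
  proof (induction A rule: finite_induct)
    case empty
    then show ?case by (simp add: T0)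
  next
    case (insert M A)
    have 1: "(bvec M :: _ \<Rightarrow>\<^sub>0 'k) \<in> SV degA" using insert by (intro SV_bvec) simp
    have 2: "(\<Sum>M\<in>A. smul (c M) (bvec M)) \<in> SV degA"
      using insert by (intro SV_sum SV_smul SV_bvec) simp
    have "T (smul (c M) (bvec M) + (\<Sum>M\<in>A. smul (c M) (bvec M))) =
        smul (c M) (T (bvec M)) + T (\<Sum>M\<in>A. smul (c M) (bvec M))"
      using T 1 2 SV_smul[OF 1] by auto
    then show ?case using insert by simp
  qed
  from this[of "Poly_Mapping.keys v" "Poly_Mapping.lookup v"]
  have "T (lin bvec v) = lin (\<lambda>M. T (bvec M)) v"
    using assms(2) by (simp add: lin_def SV_def)
  then show ?thesis by (simp add: lin_bvec_self)
qed

text \<open>By \<open>size_le_coprodD\<close> it suffices to bound the coproduct of the difference.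
  Its factors come from smaller monomials, on which \<open>T\<close> is already known to be the
  identity up to shorter words.\<close>

lemma coalg_endomorphism_unipotent:
  fixes T :: "('a::linorder multiset \<Rightarrow>\<^sub>0 'k::field_char_0) \<Rightarrow> ('a multiset \<Rightarrow>\<^sub>0 'k)"
  assumes T: "coalg_morph deg deg T" "linear_map T" and T1: "\<And>a. T (bvec {#a#}) = bvec {#a#}"
    and M: "valid_mon deg M"
  shows "size_le (size M - 1) (T (bvec M) - bvec M)"
  using M
proof (induction "size M" arbitrary: M rule: less_induct)
  case less
  show ?case
  proof (cases "size M = 1")
    case True
    then obtain a where "M = {#a#}" using size_1_singleton_mset by blast
    then show ?thesis by (simp add: T1 size_le_def)
  next
    case False
    have "size M \<noteq> 0" using less.prems by (simp add: valid_mon_iff)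
    with False have n: "2 \<le> size M" by linarith
    let ?X = "coprod deg (bvec M :: _ \<Rightarrow>\<^sub>0 'k)"
    have range: "T (bvec M) \<in> SV deg" "bvec M \<in> (SV deg :: (_ \<Rightarrow>\<^sub>0 'k) set)"
      using T(1) SV_bvec[OF less.prems] unfolding coalg_morph_def by auto
    have "coprod deg (T (bvec M) - bvec M) = tensmap deg 0 T T ?X - ?X"
      using T(1) range unfolding coalg_morph_def by (simp add: linear_map_diff[OF linear_map_coprod])
    also have "\<dots> = lin (\<lambda>x. tensmap deg 0 T T (bvec x) - bvec x) ?X"
      by (rule linear_map_lin_bvec) auto
    finally have cop: "coprod deg (T (bvec M) - bvec M) = lin (\<lambda>x. tensmap deg 0 T T (bvec x) - bvec x) ?X" .
    have small: "size K + size L \<le> size M - 1"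
      if KL: "(K, L) \<in> Poly_Mapping.keys (coprod deg (T (bvec M) - bvec M))" for K L
    proof -
      obtain P Q where PQ: "(P, Q) \<in> Poly_Mapping.keys ?X"
          "(K, L) \<in> Poly_Mapping.keys (tensmap deg 0 T T (bvec (P, Q)) - bvec (P, Q))"
        using subsetD[OF keys_lin KL[unfolded cop]] by auto
      have PQ_size: "valid_mon deg P" "valid_mon deg Q" "size P + size Q = size M"
        using keys_coprod_bvec[OF PQ(1)] by auto
      then have pos: "1 \<le> size P" "1 \<le> size Q" by (auto simp: valid_mon_iff Suc_le_eq nonempty_has_size)
      have P: "size_le (size P - 1) (T (bvec P) - bvec P)" and Q: "size_le (size Q - 1) (T (bvec Q) - bvec Q)"
        using less.hyps[of P] less.hyps[of Q] PQ_size pos by auto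
      have TQ: "size_le (size Q) (T (bvec Q))"
        using size_le_add[OF size_le_mono[OF Q] size_le_bvec[of Q, where 'k = 'k]] by simp
      \<comment> \<open>Telescoping: in each summand one factor is a difference and has lost at
        least one letter.\<close>
      have "tensmap deg 0 T T (bvec (P, Q)) - bvec (P, Q) =
          tens (T (bvec P) - bvec P) (T (bvec Q)) + tens (bvec P) (T (bvec Q) - bvec Q)"
        by (simp add: tensmap_bvec tens_linear_simps)
      then have "(K, L) \<in> Poly_Mapping.keys (tens (T (bvec P) - bvec P) (T (bvec Q))) \<union>
          Poly_Mapping.keys (tens (bvec P) (T (bvec Q) - bvec Q))"
        using PQ(2) by (auto dest: subsetD[OF Poly_Mapping.keys_add])
      then have "size K \<le> size P - 1 \<and> size L \<le> size Q \<or> size K \<le> size P \<and> size L \<le> size Q - 1"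
        using P Q TQ by (auto dest!: subsetD[OF keys_tens] simp: size_le_def keys_bvec)
      then show ?thesis using PQ_size(3) pos by linarith
    qed
    \<comment> \<open>The bound \<open>size M - 1\<close> must be at least 1 here, which is why
      monomials of size one were treated apart.\<close>
    show ?thesis
      by (rule size_le_coprodD[OF SV_diff[OF range] _ small]) (use n in simp)
  qed
qed

lemma bij_betw_coalg_endomorphism:
  fixes T :: "('a::linorder multiset \<Rightarrow>\<^sub>0 'k::field_char_0) \<Rightarrow> ('a multiset \<Rightarrow>\<^sub>0 'k)"
  assumes "coalg_morph deg deg T" "\<And>a. T (bvec {#a#}) = bvec {#a#}"
  shows "bij_betw T (SV deg) (SV deg)"
proof -
  \<comment> \<open>Outside \<open>SV\<close> the map \<open>T\<close> is arbitrary;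
    \<open>U\<close> replaces it by a linear map.\<close>
  define U where "U = lin (\<lambda>M. T (bvec M))"
  have U: "linear_map U" "\<And>v. v \<in> SV deg \<Longrightarrow> T v = U v" "coalg_morph deg deg U" "\<And>a. U (bvec {#a#}) = bvec {#a#}"
    using coalg_morph_linear_eq[OF assms(1)] coalg_morph_cong[OF _ assms(1), of U] assms(2)
    by (auto simp: U_def)
  have range: "U v \<in> SV deg" if "v \<in> SV deg" for v
    using U(3) that unfolding coalg_morph_def by blast
  have lower: "size_le (n - 1) (U v - v)" if "v \<in> SV deg" "size_le n v" for n v
  proof -
    have "U v - v = lin (\<lambda>M. U (bvec M) - bvec M) v"
      by (rule linear_map_lin_bvec) (auto intro!: U(1))
    moreover have "size_le (n - 1) \<dots>"
    proof (rule size_le_lin)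
      fix M assume "M \<in> Poly_Mapping.keys v"
      then have "valid_mon deg M" "size M \<le> n" using that by (auto simp: SV_def size_le_def)
      then show "size_le (n - 1) (U (bvec M) - bvec M)"
        using coalg_endomorphism_unipotent[OF U(3,1,4), of M] by (auto intro: size_le_mono)
    qed
    ultimately show ?thesis by simp
  qed
  have zero: "v = 0" if "v \<in> SV deg" "size_le 0 v" for v :: "'a multiset \<Rightarrow>\<^sub>0 'k"
  proof -
    have "Poly_Mapping.keys v = {}" using that by (auto simp: SV_def size_le_def valid_mon_iff)
    then show ?thesis by simp
  qed
  have inj: "v = 0" if "size_le n v" "v \<in> SV deg" "U v = 0" for n v
    using that
  proof (induction n)
    case 0
    then show ?case using zero by blast
  next
    case (Suc n)
    then have "size_le n v" using lower[OF Suc.prems(2,1)] by (simp add: size_le_uminus)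
    then show ?case using Suc by blast
  qed
  have surj: "\<exists>v\<in>SV deg. U v = u" if "size_le n u" "u \<in> SV deg" for n u
    using that
  proof (induction n arbitrary: u)
    case 0
    then have "u = 0" using zero by blast
    then show ?case using linear_map_0[OF U(1)] by (intro bexI[of _ 0]) auto
  next
    case (Suc n)
    \<comment> \<open>The error of the guess \<open>u\<close> is shorter than \<open>u\<close>;
      adding a preimage of it corrects the guess. Iterated, this is the finite geometric series for
      the inverse.\<close>
    have "size_le n (u - U u)"
      using lower[OF Suc.prems(2,1)] size_le_uminus[of n "U u - u"] by simp
    then obtain v where v: "v \<in> SV deg" "U v = u - U u"
      using Suc.IH SV_diff[OF Suc.prems(2) range[OF Suc.prems(2)]] by blast
    then have "U (u + v) = u" by (simp add: linear_map_add[OF U(1)])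
    then show ?case using SV_add[OF Suc.prems(2) v(1)] by blast
  qed
  have "bij_betw U (SV deg) (SV deg)"
    unfolding bij_betw_def
  proof
    show "inj_on U (SV deg)"
    proof (rule inj_onI)
      fix x y assume xy: "x \<in> SV deg" "y \<in> SV deg" "U x = U y"
      obtain n where "size_le n (x - y)" using size_le_exists by blast
      moreover have "U (x - y) = 0" using xy(3) by (simp add: linear_map_diff[OF U(1)])
      ultimately have "x - y = 0" using inj SV_diff[OF xy(1,2)] by blast
      then show "x = y" by simp
    qed
    have "u \<in> U ` SV deg" if "u \<in> SV deg" for u
      using size_le_exists[of u] surj[OF _ that] by blast
    then show "U ` SV deg = SV deg" using range by blast
  qed
  then show ?thesis using U(2) by (simp cong: bij_betw_cong)
qed

subsection \<open>The transferred cumulant bijection\<close>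

lemma linear_map_tau_tilde: "linear_map (tau_tilde deg m)"
  by (auto simp: tau_tilde_def ext_eq_lin)

context
  fixes deg :: "'a::linorder \<Rightarrow> int" and m :: "('a \<Rightarrow>\<^sub>0 'k::field_char_0) \<Rightarrow> ('a \<Rightarrow>\<^sub>0 'k) \<Rightarrow> ('a \<Rightarrow>\<^sub>0 'k)"
  assumes alg: "gc_algebra deg m"
begin

lemma coalg_morph_tau_tilde: "coalg_morph deg deg (tau_tilde deg m)"
  by (rule coalg_morph_cong[OF tau_tilde_eq_cumulant[OF alg, symmetric] coalg_morph_cumulant[OF alg]])

lemma tau_tilde_singleton: "tau_tilde deg m (bvec {#a#}) = bvec {#a#}"
proof -
  have "bvec {#a#} \<in> (SV deg :: (_ \<Rightarrow>\<^sub>0 'k) set)"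
    by (rule SV_bvec) (auto simp: valid_mon_def)
  then have "tau_tilde deg m (bvec {#a#}) = cumulant deg m (bvec {#a#})"
    by (rule tau_tilde_eq_cumulant[OF alg])
  also have "\<dots> = lmult deg (bvec a) (mono deg [])"
    by (simp add: cumulant_def op_extend_bvec cumulant_op_def gderiv_unit mono_Nil)
  finally show ?thesis by (simp add: lmult_mono mono_singleton)
qed

text \<open>Arbitrary vectors are needed, because \<open>i (bvec a)\<close> is in general not a
  basis vector.\<close>

lemma tau_tilde_wedge_singleton: "\<forall>x. tau_tilde deg m (wedge deg [x]) = wedge deg [x]"
  unfolding wedge_Cons wedge_Nil
proof (rule linear_ext)
  fix a
  show "tau_tilde deg m (lmult deg (bvec a) (bvec {#})) = lmult deg (bvec a) (bvec {#})"
    using tau_tilde_singleton[of a] by (simp add: lmult_mono mono_singleton flip: mono_Nil[of deg])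
qed (auto intro!: linear_map_comp[OF linear_map_tau_tilde])

lemma bij_betw_tau_tilde: "bij_betw (tau_tilde deg m) (SV deg) (SV deg)"
  by (rule bij_betw_coalg_endomorphism[OF coalg_morph_tau_tilde tau_tilde_singleton])

end

theorem theorem1:
  fixes degA :: "'a::linorder \<Rightarrow> int" and degC :: "'c::linorder \<Rightarrow> int"
    and m :: "('a \<Rightarrow>\<^sub>0 'k::field_char_0) \<Rightarrow> ('a \<Rightarrow>\<^sub>0 'k) \<Rightarrow> ('a \<Rightarrow>\<^sub>0 'k)"
    and dA :: "('a \<Rightarrow>\<^sub>0 'k) \<Rightarrow> ('a \<Rightarrow>\<^sub>0 'k)"
    and dC :: "('c \<Rightarrow>\<^sub>0 'k) \<Rightarrow> ('c \<Rightarrow>\<^sub>0 'k)"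
    and i :: "('c \<Rightarrow>\<^sub>0 'k) \<Rightarrow> ('a \<Rightarrow>\<^sub>0 'k)"
    and I :: "('a \<Rightarrow>\<^sub>0 'k) \<Rightarrow> ('c \<Rightarrow>\<^sub>0 'k)"
    and s :: "('a \<Rightarrow>\<^sub>0 'k) \<Rightarrow> ('a \<Rightarrow>\<^sub>0 'k)"
    and dinf :: "('c multiset \<Rightarrow>\<^sub>0 'k) \<Rightarrow> ('c multiset \<Rightarrow>\<^sub>0 'k)"
    and iota :: "('c multiset \<Rightarrow>\<^sub>0 'k) \<Rightarrow> ('a multiset \<Rightarrow>\<^sub>0 'k)"
  assumes alg: "gc_algebra degA m"
    and d_lin: "linear_map dA" and d_deg: "map_deg degA degA (-1) dA"
    and d_sq: "\<And>x. dA (dA x) = 0"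
    and dC_lin: "linear_map dC" and dC_deg: "map_deg degC degC (-1) dC"
    and dC_sq: "\<And>x. dC (dC x) = 0"
    and i_lin: "linear_map i" and i_deg: "map_deg degC degA 0 i"
    and i_chain: "\<And>x. dA (i x) = i (dC x)"
    and I_lin: "linear_map I" and I_deg: "map_deg degA degC 0 I"
    and I_chain: "\<And>x. I (dA x) = dC (I x)"
    and I_i: "\<And>x. I (i x) = x"
    and s_lin: "linear_map s" and s_deg: "map_deg degA degA 1 s"
    and homotopy: "\<And>x. dA (s x) + s (dA x) = i (I x) - x"
    and coder: "coderivation degC dinf"
    and iota_morph: "coalg_morph degC degA iota"
    and iota_chain: "\<And>v. v \<in> SV degC \<Longrightarrow> iota (dinf v) = d_tilde degA m dA (iota v)"
    and iota_lin_part: "\<And>c. iota (wedge degC [c]) = wedge degA [i c]"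
  shows "bij_betw (\<lambda>v. coalg_ext degC I (tau_tilde degA m (iota v))) (SV degC) (SV degC)
       \<and> coalg_morph degC degC (\<lambda>v. coalg_ext degC I (tau_tilde degA m (iota v)))
       \<and> (\<forall>v\<in>SV degC. coalg_ext degC I (tau_tilde degA m (iota (dinf v)))
                      = coder_ext degC dC (coalg_ext degC I (tau_tilde degA m (iota v))))"
proof -
  let ?T = "tau_tilde degA m" and ?J = "coalg_ext degC I"
  let ?F = "\<lambda>v. ?J (?T (iota v))"
  have "coalg_morph degC degA (\<lambda>v. ?T (iota v))"
    by (rule coalg_morph_comp[OF iota_morph coalg_morph_tau_tilde[OF alg] linear_map_tau_tilde])
  then have morph: "coalg_morph degC degC ?F"
    by (rule coalg_morph_comp[OF _ coalg_morph_coalg_ext[OF I_lin I_deg] linear_map_coalg_ext[OF I_lin I_deg]])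
  \<comment> \<open>On single letters \<open>iota\<close> is \<open>i\<close>, the cumulant
    bijection is the identity and the last map is \<open>I\<close>, so \<open>I_i\<close>
    applies.\<close>
  have "?F (bvec {#a#}) = bvec {#a#}" for a
  proof -
    have "?F (bvec {#a#}) = ?J (wedge degA [i (bvec a)])"
      using iota_lin_part[of "bvec a"] tau_tilde_wedge_singleton[OF alg] by (simp add: wedge_singleton_bvec)
    also have "\<dots> = wedge degC [I (i (bvec a))]"
      by (simp add: wedge_Cons wedge_Nil coalg_ext_lmult[OF I_lin I_deg] coalg_ext_unit[OF I_lin I_deg])
    finally show ?thesis by (simp add: I_i wedge_singleton_bvec)
  qed
  then have bij: "bij_betw ?F (SV degC) (SV degC)"
    by (rule bij_betw_coalg_endomorphism[OF morph])
  have "?F (dinf v) = coder_ext degC dC (?F v)" if v: "v \<in> SV degC" for v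
  proof -
    \<comment> \<open>\<open>inv_into\<close> is a right inverse only on the image of
      \<open>SV degA\<close> under \<open>?T\<close>, which is \<open>SV degA\<close> by
      bijectivity.\<close>
    have "coder_ext degA dA (?T (iota v)) \<in> SV degA"
      using coder_ext_eq_gderiv[OF d_deg d_lin] SV_gderiv by metis
    then have "?T (iota (dinf v)) = coder_ext degA dA (?T (iota v))"
      unfolding iota_chain[OF v] d_tilde_def
      using bij_betw_imp_surj_on[OF bij_betw_tau_tilde[OF alg]] by (intro f_inv_into_f) simp
    \<comment> \<open>With \<open>d_tilde\<close> eliminated, both differentials are derivations
      induced from letters, and \<open>I_chain\<close> compares them.\<close>
    then show ?thesis
      using coalg_ext_gderiv[OF I_lin I_deg d_deg d_lin dC_deg dC_lin I_chain]
      by (simp add: coder_ext_eq_gderiv[OF d_deg d_lin] coder_ext_eq_gderiv[OF dC_deg dC_lin])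
  qed
  with bij morph show ?thesis by blast
qed

end
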